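(* Let $0<\alpha<0.3$ and $\varepsilon>0$. Then for any $f\in\mathcal F$, $$274\,\varepsilon^2> R_z(\varepsilon;f)\cdot R_m(\varepsilon;f)^2\ \ge\ \frac{\Phi(-0.5)^3}{2}\,\varepsilon^2,$$ $$3^7(1-2\alpha)^3z_\alpha^3\,\varepsilon^2> L_{z,\alpha}(\varepsilon;f)\cdot L_{m,\alpha}(\varepsilon;f)^2\ \ge\ \frac{(0.6-2\alpha)^3}{18}\,\varepsilon^2.$$
   Context: $\Phi$ is the standard normal cdf and $z_\alpha=\Phi^{-1}(1-\alpha)$. $\mathcal F$ is the collection of convex functions $f:[0,1]\to\mathbb R$ with a unique minimizer $Z(f)=\arg\min_{0\le t\le1}f(t)$; $M(f)=f(Z(f))$ is the minimum value. White noise model: one observes $dY(t)=f(t)\,dt+\varepsilon\,dW(t)$, $0\le t\le 1$, with $W$ a standard Brownian motion and $\varepsilon>0$ the noise level; $\mathbb E_f$ denotes expectation when the drift is $f$. Estimation benchmarks: $$R_z(\varepsilon;f)=\sup_{g\in\mathcal F}\inf_{\hat Z}\max_{h\in\{f,g\}}\mathbb E_h|\hat Z-Z(h)|,\qquad R_m(\varepsilon;f)=\sup_{g\in\mathcal F}\inf_{\hat M}\max_{h\in\{f,g\}}\mathbb E_h|\hat M-M(h)|,$$ the infima being over all estimators based on $Y$. Inference benchmarks: for $\mathcal G\subseteq\mathcal F$ let $\mathcal I_{z,\alpha}(\mathcal G)$ (resp. $\mathcal I_{m,\alpha}(\mathcal G)$) be the collection of confidence intervals based on $Y$ that contain $Z(h)$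 (resp. $M(h)$) with probability at least $1-\alpha$ under drift $h$, for every $h\in\mathcal G$. With $L(CI)$ the length of $CI$, $$L_{z,\alpha}(\varepsilon;f)=\sup_{g\in\mathcal F}\inf_{CI\in\mathcal I_{z,\alpha}(\{f,g\})}\mathbb E_fL(CI),\qquad L_{m,\alpha}(\varepsilon;f)=\sup_{g\in\mathcal F}\inf_{CI\in\mathcal I_{m,\alpha}(\{f,g\})}\mathbb E_fL(CI).$$ *)

theory Defs
  imports "HOL-Probability.Probability"
begin

definition std_normal_cdf :: "real \<Rightarrow> real" where
  "std_normal_cdf = cdf std_normal_distribution"

definition z_quantile :: "real \<Rightarrow> real" where
  "z_quantile \<alpha> = inv std_normal_cdf (1 - \<alpha>)"

text \<open>Functions on the unit interval are represented by functions on the reals; no definition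
  below depends on their values outside \<open>{0..1}\<close>.\<close>

definition convex_class :: "(real \<Rightarrow> real) set" where
  "convex_class = {f. convex_on {0..1} f \<and> (\<exists>!t. is_arg_min f (\<lambda>t. t \<in> {0..1}) t)}"

definition minimizer :: "(real \<Rightarrow> real) \<Rightarrow> real" where
  "minimizer f = arg_min_on f {0..1}"

definition minimum :: "(real \<Rightarrow> real) \<Rightarrow> real" where
  "minimum f = f (minimizer f)"

definition standard_brownian_motion :: "'a measure \<Rightarrow> (real \<Rightarrow> 'a \<Rightarrow> real) \<Rightarrow> bool" where
  "standard_brownian_motion M W \<longleftrightarrow>
     prob_space M \<and>
     (\<forall>t\<in>{0..1}. W t \<in> borel_measurable M) \<and>
     (AE \<omega> in M. W 0 \<omega> = 0) \<and>
     (AE \<omega> in M. continuous_on {0..1} (\<lambda>t. W t \<omega>)) \<and>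
     (\<forall>s t. 0 \<le> s \<and> s < t \<and> t \<le> 1 \<longrightarrow>
        distributed M lborel (\<lambda>\<omega>. W t \<omega> - W s \<omega>) (normal_density 0 (sqrt (t - s)))) \<and>
     (\<forall>(n::nat) t. (\<forall>i\<le>n. t i \<in> {0..1}) \<and> (\<forall>i<n. t i < t (Suc i)) \<longrightarrow>
        prob_space.indep_vars M (\<lambda>_. borel) (\<lambda>i \<omega>. W (t (Suc i)) \<omega> - W (t i) \<omega>) {..<n})"

text \<open>The sample space of the observation \<open>Y\<close>: the \<open>\<sigma>\<close>-algebra is generated by the
  evaluations, and its trace on the continuous paths is the Borel \<open>\<sigma>\<close>-algebra of the supremum
  norm. A statistic based on \<open>Y\<close> is a measurable function on this space.\<close>

abbreviation path_space :: "(real \<Rightarrow> real) measure" where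
  "path_space \<equiv> PiM {0..1} (\<lambda>_. borel)"

text \<open>The integrated form of \<open>dY(t) = f(t) dt + \<epsilon> dW(t)\<close>, \<open>Y(0) = 0\<close>.\<close>

definition observation ::
  "(real \<Rightarrow> 'a \<Rightarrow> real) \<Rightarrow> real \<Rightarrow> (real \<Rightarrow> real) \<Rightarrow> 'a \<Rightarrow> real \<Rightarrow> real" where
  "observation W \<epsilon> f \<omega> = (\<lambda>t\<in>{0..1}. integral {0..t} f + \<epsilon> * W t \<omega>)"

definition white_noise ::
  "'a measure \<Rightarrow> (real \<Rightarrow> 'a \<Rightarrow> real) \<Rightarrow> real \<Rightarrow> (real \<Rightarrow> real) \<Rightarrow> (real \<Rightarrow> real) measure" where
  "white_noise M W \<epsilon> f = distr M path_space (observation W \<epsilon> f)"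

text \<open>In the benchmarks, \<open>P h\<close> is the law of \<open>Y\<close> under drift \<open>h\<close>, and \<open>\<theta>\<close> is the functional of
  interest. Risks and expected lengths live in \<^typ>\<open>ennreal\<close>, so non-integrable losses count as
  infinite.\<close>

definition estimation_benchmark ::
  "((real \<Rightarrow> real) \<Rightarrow> (real \<Rightarrow> real) measure) \<Rightarrow> ((real \<Rightarrow> real) \<Rightarrow> real) \<Rightarrow> (real \<Rightarrow> real) \<Rightarrow> ennreal"
where
  "estimation_benchmark P \<theta> f =
     (SUP g\<in>convex_class. INF T\<in>borel_measurable path_space.
        MAX h\<in>{f, g}. \<integral>\<^sup>+ y. ennreal \<bar>T y - \<theta> h\<bar> \<partial>P h)"

text \<open>The pair \<open>(l, u)\<close> stands for the interval \<open>{l y..u y}\<close>.\<close>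

definition confidence_intervals ::
  "((real \<Rightarrow> real) \<Rightarrow> (real \<Rightarrow> real) measure) \<Rightarrow> ((real \<Rightarrow> real) \<Rightarrow> real) \<Rightarrow> real \<Rightarrow>
   (real \<Rightarrow> real) set \<Rightarrow> (((real \<Rightarrow> real) \<Rightarrow> real) \<times> ((real \<Rightarrow> real) \<Rightarrow> real)) set"
where
  "confidence_intervals P \<theta> \<alpha> G =
     {(l, u). l \<in> borel_measurable path_space \<and> u \<in> borel_measurable path_space \<and>
        (\<forall>y\<in>space path_space. l y \<le> u y) \<and>
        (\<forall>h\<in>G. measure (P h) {y \<in> space path_space. \<theta> h \<in> {l y..u y}} \<ge> 1 - \<alpha>)}"

definition inference_benchmark ::
  "((real \<Rightarrow> real) \<Rightarrow> (real \<Rightarrow> real) measure) \<Rightarrow> ((real \<Rightarrow> real) \<Rightarrow> real) \<Rightarrow> real \<Rightarrow>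
   (real \<Rightarrow> real) \<Rightarrow> ennreal"
where
  "inference_benchmark P \<theta> \<alpha> f =
     (SUP g\<in>convex_class. INF (l, u)\<in>confidence_intervals P \<theta> \<alpha> {f, g}.
        \<integral>\<^sup>+ y. ennreal (u y - l y) \<partial>P f)"

definition R_z :: "'a measure \<Rightarrow> (real \<Rightarrow> 'a \<Rightarrow> real) \<Rightarrow> real \<Rightarrow> (real \<Rightarrow> real) \<Rightarrow> ennreal" where
  "R_z M W \<epsilon> f = estimation_benchmark (white_noise M W \<epsilon>) minimizer f"

definition R_m :: "'a measure \<Rightarrow> (real \<Rightarrow> 'a \<Rightarrow> real) \<Rightarrow> real \<Rightarrow> (real \<Rightarrow> real) \<Rightarrow> ennreal" where
  "R_m M W \<epsilon> f = estimation_benchmark (white_noise M W \<epsilon>) minimum f"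

definition L_z ::
  "'a measure \<Rightarrow> (real \<Rightarrow> 'a \<Rightarrow> real) \<Rightarrow> real \<Rightarrow> real \<Rightarrow> (real \<Rightarrow> real) \<Rightarrow> ennreal" where
  "L_z M W \<alpha> \<epsilon> f = inference_benchmark (white_noise M W \<epsilon>) minimizer \<alpha> f"

definition L_m ::
  "'a measure \<Rightarrow> (real \<Rightarrow> 'a \<Rightarrow> real) \<Rightarrow> real \<Rightarrow> real \<Rightarrow> (real \<Rightarrow> real) \<Rightarrow> ennreal" where
  "L_m M W \<alpha> \<epsilon> f = inference_benchmark (white_noise M W \<epsilon>) minimum \<alpha> f"

end

theory Submission
  imports Defs
begin

text \<open>
  Both products are governed by one pair of numbers attached to \<open>f\<close>. For \<open>\<delta> > 0\<close> pour water into
  the graph of \<open>f\<close> up to the level \<open>u = M(f) + m\<close> at which \<open>max f u\<close> has \<open>L\<^sup>2\<close>-distance \<open>\<delta>\<close> from \<open>f\<close>,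
  and let \<open>r\<close> be the largest distance from \<open>Z(f)\<close> to a point of \<open>{f \<le> u}\<close>. Bounding \<open>u - f\<close> above by \<open>m\<close>
  and below by a chord of \<open>f\<close> gives \<open>\<delta>\<^sup>2 \<le> 2 m\<^sup>2 r\<close> and \<open>m\<^sup>2 r \<le> 3 \<delta>\<^sup>2\<close>.

  Tilting \<open>max f u\<close> slightly produces members of the class at distance about \<open>\<delta>\<close> whose minimum is \<open>u\<close> and
  whose minimizer is any prescribed point of \<open>{f \<le> u}\<close>. Conversely, convexity forces every \<open>g\<close> at
  distance at most \<open>x \<delta>\<close>, \<open>x \<ge> 1\<close>, to satisfy \<open>\<bar>M(g) - M(f)\<bar> \<le> 4 x m\<close> and \<open>\<bar>Z(g) - Z(f)\<bar> \<le> 5 x r\<close>.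

  What remains is the two-point problem for Gaussian shifts. The lower bounds use that every measurable set
  \<open>A\<close> of paths has \<open>P\<^sub>f(A) + P\<^sub>g(A\<^sup>c) \<ge> 2 \<Phi>(-d / 2\<epsilon>)\<close>, where \<open>d\<close> is the distance of \<open>f\<close> and \<open>g\<close>: this is
  the Neyman-Pearson lemma for finitely many increments, and cylinder sets approximate all others, so no
  stochastic integral is needed. The upper bounds use tests based on a step-function contrast of \<open>Y\<close>
  whose signal-to-noise ratio approaches \<open>d / \<epsilon>\<close>.
\<close>

section \<open>Convex functions on the unit interval\<close>

text \<open>Convex functions on the closed interval may jump at the endpoints, so continuity is only required
  in the interior.\<close>

definition tame :: "(real \<Rightarrow> real) \<Rightarrow> bool" where
  "tame h \<longleftrightarrow> continuous_on {0<..<1} h \<and> (\<exists>K. \<forall>t\<in>{0..1}. \<bar>h t\<bar> \<le> K)"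

lemma tameD: "tame h \<Longrightarrow> continuous_on {0<..<1} h"
  by (simp add: tame_def)

lemma tame_boundE:
  assumes "tame h" obtains K where "K > 0" "\<And>t. t \<in> {0..1} \<Longrightarrow> \<bar>h t\<bar> \<le> K"
proof -
  obtain K where K: "\<forall>t\<in>{0..1}. \<bar>h t\<bar> \<le> K" using assms by (auto simp: tame_def)
  show ?thesis using K by (intro that[of "max K 1"]) (auto simp: le_max_iff_disj)
qed

lemma tame_integrable01: assumes "tame h" shows "h integrable_on {0..1}"
proof -
  obtain K where K: "\<And>t. t \<in> {0..1} \<Longrightarrow> \<bar>h t\<bar> \<le> K" using tame_boundE[OF assms] by blast
  have "h integrable_on {0<..<1}"
  proof (rule measurable_bounded_by_integrable_imp_integrable)
    show "h \<in> borel_measurable (lebesgue_on {0<..<1})"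
      using tameD[OF assms] by (rule continuous_imp_measurable_on_sets_lebesgue) auto
    show "(\<lambda>_. K) integrable_on {0<..<1::real}"
      by (subst integrable_on_Icc_iff_Ioo[symmetric]) (rule integrable_const_ivl)
    show "norm (h t) \<le> K" if "t \<in> {0<..<1}" for t using K[of t] that by auto
  qed auto
  then show ?thesis by (simp add: integrable_on_Icc_iff_Ioo)
qed

lemma tame_integrable: "tame h \<Longrightarrow> 0 \<le> a \<Longrightarrow> b \<le> 1 \<Longrightarrow> h integrable_on {a..b}"
  by (rule integrable_on_subinterval[OF tame_integrable01]) auto

lemma tame_const: "tame (\<lambda>_. c)"
  by (auto simp: tame_def)

lemma tame_id: "tame (\<lambda>t. t)"
  unfolding tame_def by (auto intro!: exI[of _ 1])

lemma tame_boundE2: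
  assumes "tame f" "tame g"
  obtains K where "K > 0" "\<And>t. t \<in> {0..1} \<Longrightarrow> \<bar>f t\<bar> \<le> K" "\<And>t. t \<in> {0..1} \<Longrightarrow> \<bar>g t\<bar> \<le> K"
proof -
  obtain K where K: "K > 0" "\<And>t. t \<in> {0..1} \<Longrightarrow> \<bar>f t\<bar> \<le> K"
    using tame_boundE[OF assms(1)] by blast
  obtain L where L: "L > 0" "\<And>t. t \<in> {0..1} \<Longrightarrow> \<bar>g t\<bar> \<le> L"
    using tame_boundE[OF assms(2)] by blast
  show ?thesis
    using K L by (intro that[of "max K L"]) (auto simp: le_max_iff_disj)
qed

lemma tameI: "continuous_on {0<..<1} h \<Longrightarrow> (\<And>t. t \<in> {0..1} \<Longrightarrow> \<bar>h t\<bar> \<le> K) \<Longrightarrow> tame h"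
  unfolding tame_def by blast

lemma tame_add: assumes "tame f" "tame g" shows "tame (\<lambda>t. f t + g t)"
proof -
  obtain K where K: "K > 0" "\<And>t. t \<in> {0..1} \<Longrightarrow> \<bar>f t\<bar> \<le> K" "\<And>t. t \<in> {0..1} \<Longrightarrow> \<bar>g t\<bar> \<le> K"
    by (rule tame_boundE2[OF assms]) (rule that)
  show ?thesis
  proof (rule tameI)
    show "continuous_on {0<..<1} (\<lambda>t. f t + g t)"
      using assms[THEN tameD] by (rule continuous_on_add)
    show "\<bar>f t + g t\<bar> \<le> K + K" if "t \<in> {0..1}" for t using K(2,3)[OF that] by linarith
  qed
qed

lemma tame_mult: assumes "tame f" "tame g" shows "tame (\<lambda>t. f t * g t)"
proof -
  obtain K where K: "K > 0" "\<And>t. t \<in> {0..1} \<Longrightarrow> \<bar>f t\<bar> \<le> K" "\<And>t. t \<in> {0..1} \<Longrightarrow> \<bar>g t\<bar> \<le> K"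
    by (rule tame_boundE2[OF assms]) (rule that)
  show ?thesis
  proof (rule tameI)
    show "continuous_on {0<..<1} (\<lambda>t. f t * g t)"
      using assms[THEN tameD] by (rule continuous_on_mult)
    show "\<bar>f t * g t\<bar> \<le> K * K" if "t \<in> {0..1}" for t
      unfolding abs_mult using K(1) K(2,3)[OF that] by (intro mult_mono) auto
  qed
qed

lemma tame_max: assumes "tame f" "tame g" shows "tame (\<lambda>t. max (f t) (g t))"
proof -
  obtain K where K: "K > 0" "\<And>t. t \<in> {0..1} \<Longrightarrow> \<bar>f t\<bar> \<le> K" "\<And>t. t \<in> {0..1} \<Longrightarrow> \<bar>g t\<bar> \<le> K"
    by (rule tame_boundE2[OF assms]) (rule that)
  show ?thesis
  proof (rule tameI)
    show "continuous_on {0<..<1} (\<lambda>t. max (f t) (g t))"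
      using assms[THEN tameD] by (rule continuous_on_max)
    show "\<bar>max (f t) (g t)\<bar> \<le> K" if "t \<in> {0..1}" for t using K(2,3)[OF that] by linarith
  qed
qed

lemma tame_diff: assumes "tame f" "tame g" shows "tame (\<lambda>t. f t - g t)"
  using tame_add[OF assms(1) tame_mult[OF tame_const[of "-1"] assms(2)]] by simp

lemma tame_power2: "tame f \<Longrightarrow> tame (\<lambda>t. (f t)\<^sup>2)"
  unfolding power2_eq_square by (rule tame_mult)

lemma tame_flip: assumes "tame f" shows "tame (\<lambda>t. f (1 - t))"
proof -
  obtain K where K: "\<And>t. t \<in> {0..1} \<Longrightarrow> \<bar>f t\<bar> \<le> K" using tame_boundE[OF assms] by blast
  show ?thesis
  proof (rule tameI)
    show "continuous_on {0<..<1} (\<lambda>t. f (1 - t))"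
      by (rule continuous_on_compose2[OF tameD[OF assms]]) (auto intro!: continuous_intros)
    show "\<bar>f (1 - t)\<bar> \<le> K" if "t \<in> {0..1}" for t using K[of "1 - t"] that by auto
  qed
qed

lemmas tame_intros = tame_const tame_id tame_add tame_diff tame_mult tame_max tame_power2

text \<open>Pointwise bounds are asked for only inside the interval: the piecewise estimates below
  are available there, and the endpoints have measure zero.\<close>

lemma tame_integral_mono:
  assumes "tame u" "tame v" "0 \<le> a" "b \<le> 1" "\<And>t. a < t \<Longrightarrow> t < b \<Longrightarrow> u t \<le> v t"
  shows "integral {a..b} u \<le> integral {a..b} v"
proof -
  have "integral {a<..<b} u \<le> integral {a<..<b} v"
    using assms tame_integrable[of u a b] tame_integrable[of v a b]
    by (intro integral_le) (auto simp: integrable_on_Icc_iff_Ioo)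
  then show ?thesis by (simp add: integral_open_interval_real)
qed

lemma tame_integral_ge:
  assumes "tame v" "0 \<le> a" "a \<le> b" "b \<le> 1" "\<And>t. a < t \<Longrightarrow> t < b \<Longrightarrow> c \<le> v t"
  shows "c * (b - a) \<le> integral {a..b} v"
  using tame_integral_mono[of "\<lambda>_. c" v a b] assms tame_const by (simp add: mult.commute)

lemma tame_integral_le:
  assumes "tame v" "0 \<le> a" "a \<le> b" "b \<le> 1" "\<And>t. a < t \<Longrightarrow> t < b \<Longrightarrow> v t \<le> c"
  shows "integral {a..b} v \<le> c * (b - a)"
  using tame_integral_mono[of v "\<lambda>_. c" a b] assms tame_const by (simp add: mult.commute)

lemma tame_integral_split:
  assumes "tame v" "0 \<le> a" "a \<le> c" "c \<le> b" "b \<le> 1"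
  shows "integral {a..b} v = integral {a..c} v + integral {c..b} v"
  using Henstock_Kurzweil_Integration.integral_combine[of a c b v] tame_integrable[OF assms(1)] assms by simp

lemma integral_flip:
  fixes h :: "real \<Rightarrow> real"
  shows "integral {a..b} (\<lambda>t. h (1 - t)) = integral {1 - b..1 - a} h"
proof -
  have "integral {a..b} (\<lambda>t. h (1 - t)) = integral {-b..-a} (\<lambda>t. h (1 + t))"
    using Henstock_Kurzweil_Integration.integral_reflect_real[of "-a" "-b" "\<lambda>t. h (1 + t)"] by simp
  also have "\<dots> = integral {1 - b..1 - a} h"
    using integral_shift_Icc_real[of "-b" "-a" h 1] by (simp add: o_def add.commute)
  finally show ?thesis .
qed

text \<open>Convexity with the denominators cleared, so that chord comparisons become polynomial
  inequalities and \<open>a = b\<close> needs no exception.\<close>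

lemma convex_three_points:
  fixes f :: "real \<Rightarrow> real"
  assumes "convex_on S f" "a \<in> S" "b \<in> S" "a \<le> t" "t \<le> b"
  shows "f t * (b - a) \<le> f a * (b - t) + f b * (t - a)"
proof (cases "a = b")
  case False
  define s where "s = (t - a) / (b - a)"
  have ab: "a < b" using False assms by auto
  have s: "0 \<le> s" "s \<le> 1" "t = (1 - s) * a + s * b"
    using assms ab by (auto simp: s_def divide_simps) (simp add: algebra_simps)
  have "f t \<le> (1 - s) * f a + s * f b"
    using convex_onD[OF assms(1) s(1,2) assms(2,3)] s(3) by simp
  then have "f t * (b - a) \<le> ((1 - s) * f a + s * f b) * (b - a)"
    using ab by (simp add: mult_right_mono)
  also have "\<dots> = f a * ((1 - s) * (b - a)) + f b * (s * (b - a))" by (simp add: algebra_simps)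
  also have "s * (b - a) = t - a" using ab by (simp add: s_def)
  also have "(1 - s) * (b - a) = b - t" using ab by (simp add: s_def field_simps)
  finally show ?thesis .
qed (use assms in auto)

lemma convex_on_flip:
  assumes "convex_on {0..1} (f :: real \<Rightarrow> real)" shows "convex_on {0..1} (\<lambda>t. f (1 - t))"
proof (rule convex_onI)
  fix t x y :: real assume *: "t > 0" "t < 1" "x \<in> {0..1}" "y \<in> {0..1}"
  have "1 - ((1 - t) *\<^sub>R x + t *\<^sub>R y) = (1 - t) *\<^sub>R (1 - x) + t *\<^sub>R (1 - y)"
    by (simp add: algebra_simps)
  then show "f (1 - ((1 - t) *\<^sub>R x + t *\<^sub>R y)) \<le> (1 - t) * f (1 - x) + t * f (1 - y)"
    using convex_onD[OF assms, of t "1 - x" "1 - y"] * by simp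
qed simp

lemma convex_on_max:
  fixes f g :: "real \<Rightarrow> real"
  assumes "convex_on S f" "convex_on S g" shows "convex_on S (\<lambda>x. max (f x) (g x))"
proof (rule convex_onI)
  show "convex S" using assms by (simp add: convex_on_def)
  fix t x y :: real assume *: "t > 0" "t < 1" "x \<in> S" "y \<in> S"
  have "(1 - t) * f x + t * f y \<le> (1 - t) * max (f x) (g x) + t * max (f y) (g y)"
    "(1 - t) * g x + t * g y \<le> (1 - t) * max (f x) (g x) + t * max (f y) (g y)"
    using * by (auto intro!: add_mono mult_left_mono)
  then show "max (f ((1 - t) *\<^sub>R x + t *\<^sub>R y)) (g ((1 - t) *\<^sub>R x + t *\<^sub>R y))
      \<le> (1 - t) * max (f x) (g x) + t * max (f y) (g y)"
    using convex_onD[OF assms(1), of t x y] convex_onD[OF assms(2), of t x y] * by simp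
qed

section \<open>The class of convex functions with a unique minimizer\<close>

lemma convex_classD:
  assumes "f \<in> convex_class"
  shows "convex_on {0..1} f" "minimizer f \<in> {0..1}"
    "\<And>t. t \<in> {0..1} \<Longrightarrow> minimum f \<le> f t"
    "\<And>t. t \<in> {0..1} \<Longrightarrow> f t \<le> minimum f \<Longrightarrow> t = minimizer f"
proof -
  show "convex_on {0..1} f" using assms by (simp add: convex_class_def)
  have ex1: "\<exists>!t. is_arg_min f (\<lambda>t. t \<in> {0..1}) t" using assms by (simp add: convex_class_def)
  have "is_arg_min f (\<lambda>t. t \<in> {0..1}) (minimizer f)"
    unfolding minimizer_def arg_min_on_def arg_min_def using ex1 by (metis someI_ex)
  note m = this
  then show "minimizer f \<in> {0..1}" "\<And>t. t \<in> {0..1} \<Longrightarrow> minimum f \<le> f t"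
    by (auto simp: is_arg_min_linorder minimum_def)
  show "t = minimizer f" if "t \<in> {0..1}" "f t \<le> minimum f" for t
  proof -
    have "is_arg_min f (\<lambda>t. t \<in> {0..1}) t"
      using m that by (force simp: is_arg_min_linorder minimum_def)
    with m ex1 show ?thesis by blast
  qed
qed

lemma convex_classI:
  assumes "convex_on {0..1} f" "b \<in> {0..1}" "\<And>t. t \<in> {0..1} \<Longrightarrow> t \<noteq> b \<Longrightarrow> f b < f t"
  shows "f \<in> convex_class" "minimizer f = b"
proof -
  have b: "is_arg_min f (\<lambda>t. t \<in> {0..1}) b"
    using assms by (force simp: is_arg_min_linorder)
  have u: "t = b" if "is_arg_min f (\<lambda>t. t \<in> {0..1}) t" for t
    using that assms by (force simp: is_arg_min_linorder)
  show "f \<in> convex_class" unfolding convex_class_def using assms(1) b u by blast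
  show "minimizer f = b"
    unfolding minimizer_def arg_min_on_def arg_min_def using b u by (metis someI)
qed

text \<open>A convex function is continuous in the interior, lies below the chord over the whole
  interval, and here also has a minimum below.\<close>

lemma convex_class_tame: assumes "f \<in> convex_class" shows "tame f"
proof -
  have c: "convex_on {0..1} f" using convex_classD[OF assms] by simp
  have "continuous_on {0<..<1} f"
    by (rule convex_on_continuous) (auto intro: convex_on_subset[OF c])
  moreover have "\<bar>f t\<bar> \<le> \<bar>minimum f\<bar> + \<bar>f 0\<bar> + \<bar>f 1\<bar>" if "t \<in> {0..1}" for t
  proof -
    have "f t \<le> f 0 * (1 - t) + f 1 * t" using convex_three_points[OF c, of 0 1 t] that by simp
    also have "f 0 * (1 - t) \<le> \<bar>f 0\<bar> * 1" using that by (intro mult_mono) auto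
    also have "f 1 * t \<le> \<bar>f 1\<bar> * 1" using that by (intro mult_mono) auto
    finally show ?thesis using convex_classD(3)[OF assms that] by simp
  qed
  ultimately show ?thesis by (rule tameI)
qed

section \<open>Distance forced by a far minimizer or a deep minimum\<close>

definition sq_dist :: "(real \<Rightarrow> real) \<Rightarrow> (real \<Rightarrow> real) \<Rightarrow> real" where
  "sq_dist f g = integral {0..1} (\<lambda>t. (f t - g t)\<^sup>2)"

text \<open>The squared \<open>L\<^sup>2\<close>-distance of \<open>f\<close> and \<open>max f u\<close>.\<close>

definition water_level :: "(real \<Rightarrow> real) \<Rightarrow> real \<Rightarrow> real" where
  "water_level f u = integral {0..1} (\<lambda>t. (max 0 (u - f t))\<^sup>2)"

lemma integral_square_linear:
  fixes k c :: real
  assumes "a \<le> b"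
  shows "integral {a..b} (\<lambda>t. (k * (t - c))\<^sup>2) = k\<^sup>2 * ((b - c) ^ 3 - (a - c) ^ 3) / 3"
proof -
  have "((\<lambda>t. (k * (t - c))\<^sup>2) has_integral k\<^sup>2 * (b - c) ^ 3 / 3 - k\<^sup>2 * (a - c) ^ 3 / 3) {a..b}"
    using assms
    by (intro fundamental_theorem_of_calculus)
      (auto intro!: derivative_eq_intros simp flip: has_real_derivative_iff_has_vector_derivative
        simp: power2_eq_square)
  then show ?thesis by (simp add: integral_unique right_diff_distrib diff_divide_distrib)
qed

lemma sq_dist_flip: "sq_dist (\<lambda>t. f (1 - t)) (\<lambda>t. g (1 - t)) = sq_dist f g"
  using integral_flip[of 0 1 "\<lambda>t. (f t - g t)\<^sup>2"] by (simp add: sq_dist_def)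

lemma tame_integral_subset:
  assumes "tame v" "0 \<le> a" "b \<le> 1" "\<And>t. t \<in> {0..1} \<Longrightarrow> 0 \<le> v t"
  shows "integral {a..b} v \<le> integral {0..1} v"
  using assms tame_integrable[of v a b] tame_integrable[of v 0 1]
  by (intro integral_subset_le) auto

lemma convex_nonincreasing_to_min:
  fixes g :: "real \<Rightarrow> real"
  assumes g: "convex_on S g" and y: "y \<in> S" "\<And>t. t \<in> S \<Longrightarrow> g y \<le> g t"
    and st: "s \<in> S" "t \<in> S" "s \<le> t" "t \<le> y"
  shows "g t \<le> g s"
proof (cases "t = y")
  case False
  have "g t * (y - s) \<le> g s * (y - t) + g y * (t - s)"
    using convex_three_points[OF g, of s y t] st y by auto
  also have "g y * (t - s) \<le> g t * (t - s)" using y(2)[of t] st by (intro mult_right_mono) auto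
  finally have "g t * (y - t) \<le> g s * (y - t)" by (simp add: algebra_simps)
  then show ?thesis using False st by auto
qed (use y st in auto)

text \<open>Between \<open>z\<close> and \<open>y\<close> the function \<open>g\<close> decreases while \<open>f\<close> grows with slope at least \<open>m / \<rho>\<close> from
  \<open>z + \<rho>\<close> on, so \<open>f - g\<close> is far from zero on one of the two sides of \<open>c = z + 3 \<rho>\<close>.\<close>

lemma sq_dist_far_minimizer_right:
  assumes f: "convex_on {0..1} f" "tame f" and g: "convex_on {0..1} g" "tame g"
    and z: "z \<in> {0..1}" and y: "y \<in> {0..1}" and gy: "\<And>t. t \<in> {0..1} \<Longrightarrow> g y \<le> g t"
    and m: "m > 0" and r: "r > 0"
    and far: "\<And>t. t \<in> {0..1} \<Longrightarrow> z + r < t \<Longrightarrow> f z + m < f t"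
    and zy: "z + 5 * r < y"
  shows "2 * m\<^sup>2 * r < sq_dist f g"
proof -
  \<comment> \<open>Stretching \<open>r\<close> to \<open>\<rho>\<close> makes \<open>y\<close> lie
    exactly five units from \<open>z\<close>, so that \<open>c\<close> is the midpoint of the
    stretch from \<open>z + \<rho>\<close> to \<open>y\<close> and both halves have length
    \<open>2 * \<rho>\<close>.\<close>
  define \<rho> where "\<rho> = (y - z) / 5"
  have \<rho>: "r < \<rho>" "0 < \<rho>" "y = z + 5 * \<rho>" using zy r by (auto simp: \<rho>_def field_simps)
  have bnd: "0 \<le> z" "y \<le> 1" using z y by auto
  define k where "k = m / \<rho>"
  have k: "k > 0" using m \<rho> by (simp add: k_def)
  define c where "c = z + 3 * \<rho>"
  \<comment> \<open>The chord from \<open>z\<close> to \<open>s\<close> has slope at least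
    \<open>m / \<rho>\<close>, and chords further right are steeper. Multiplying the two facts and
    cancelling \<open>s - z\<close> avoids quotients.\<close>
  have slope: "k * (t - s) \<le> f t - f s" if "z + \<rho> \<le> s" "s < t" "t \<le> 1" for s t
  proof -
    have sz: "s - z > 0" using that \<rho> by simp
    have "f (z + \<rho>) * (s - z) \<le> f z * (s - (z + \<rho>)) + f s * \<rho>"
      using convex_three_points[OF f(1), of z s "z + \<rho>"] that z \<rho> by auto
    moreover have "(f z + m) * (s - z) \<le> f (z + \<rho>) * (s - z)"
      using far[of "z + \<rho>"] sz \<rho> bnd by (intro mult_right_mono) auto
    ultimately have a: "m * (s - z) \<le> \<rho> * (f s - f z)" by (simp add: algebra_simps)
    have b: "(f s - f z) * (t - s) \<le> (f t - f s) * (s - z)"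
      using convex_three_points[OF f(1), of z t s] that z sz by (simp add: algebra_simps)
    have "(m * (s - z)) * (t - s) \<le> (\<rho> * (f s - f z)) * (t - s)"
      using a that by (intro mult_right_mono) auto
    also have "\<dots> \<le> \<rho> * ((f t - f s) * (s - z))"
      using b \<rho> by (simp add: mult.assoc)
    finally have "(m * (t - s)) * (s - z) \<le> (\<rho> * (f t - f s)) * (s - z)"
      by (simp add: ac_simps)
    then have "m * (t - s) \<le> \<rho> * (f t - f s)" using sz by simp
    then show ?thesis using \<rho>(2) by (simp add: k_def field_simps)
  qed
  have gm: "g t \<le> g s" if "z \<le> s" "s \<le> t" "t \<le> y" for s t
    using that bnd by (intro convex_nonincreasing_to_min[OF g(1) y gy]) auto
  have tm: "tame (\<lambda>t. (f t - g t)\<^sup>2)" "tame (\<lambda>t. (k * (t - c))\<^sup>2)"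
    by (intro tame_intros f g)+
  \<comment> \<open>Each half would contribute a squared wedge of slope \<open>k\<close> over length
    \<open>2 * \<rho>\<close>; its integral 8/3 m^2 \<rho> exceeds the required 2 m^2 r.\<close>
  have val: "8 / 3 * m\<^sup>2 * \<rho> = k\<^sup>2 * (2 * \<rho>) ^ 3 / 3"
    using \<rho>(2) by (simp add: k_def field_simps power2_eq_square power3_eq_cube)
  have val': "8 / 3 * m\<^sup>2 * \<rho> = k\<^sup>2 * (0 - (z + \<rho> - c) ^ 3) / 3"
    unfolding val c_def by (simp add: power3_eq_cube)
  have "2 * m\<^sup>2 * r < 8 / 3 * m\<^sup>2 * \<rho>"
  proof -
    have "m\<^sup>2 * r < m\<^sup>2 * \<rho>" "0 < m\<^sup>2 * r" using \<rho> m r by auto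
    then show ?thesis by linarith
  qed
  also have "\<dots> \<le> sq_dist f g"
  proof (cases "g c \<le> f c")
    case True
    have "8 / 3 * m\<^sup>2 * \<rho> = integral {c..y} (\<lambda>t. (k * (t - c))\<^sup>2)"
      using \<rho> by (subst integral_square_linear) (auto simp: c_def val simp del: times_divide_eq_left times_divide_eq_right)
    also have "\<dots> \<le> integral {c..y} (\<lambda>t. (f t - g t)\<^sup>2)"
    proof (rule tame_integral_mono[OF tm(2,1)])
      fix t assume t: "c < t" "t < y"
      have "k * (t - c) \<le> f t - g t"
        using slope[of c t] gm[of c t] t True \<rho> bnd by (auto simp: c_def)
      then show "(k * (t - c))\<^sup>2 \<le> (f t - g t)\<^sup>2"
        using k t by (intro power_mono) auto
    qed (use \<rho> bnd in \<open>auto simp: c_def\<close>)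
    also have "\<dots> \<le> sq_dist f g"
      unfolding sq_dist_def using \<rho> bnd by (intro tame_integral_subset tm) (auto simp: c_def)
    finally show ?thesis .
  next
    case False
    have "8 / 3 * m\<^sup>2 * \<rho> = integral {z + \<rho>..c} (\<lambda>t. (k * (t - c))\<^sup>2)"
      using \<rho> unfolding val' by (subst integral_square_linear) (auto simp: c_def)
    also have "\<dots> \<le> integral {z + \<rho>..c} (\<lambda>t. (f t - g t)\<^sup>2)"
    proof (rule tame_integral_mono[OF tm(2,1)])
      fix t assume t: "z + \<rho> < t" "t < c"
      have "k * (c - t) \<le> g t - f t"
        using slope[of t c] gm[of t c] t False \<rho> bnd by (auto simp: c_def)
      then have "(k * (c - t))\<^sup>2 \<le> (g t - f t)\<^sup>2"
        using k t by (intro power_mono) auto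
      then show "(k * (t - c))\<^sup>2 \<le> (f t - g t)\<^sup>2"
        by (simp add: power_mult_distrib power2_commute)
    qed (use \<rho> bnd in \<open>auto simp: c_def\<close>)
    also have "\<dots> \<le> sq_dist f g"
      unfolding sq_dist_def using \<rho> bnd by (intro tame_integral_subset tm) (auto simp: c_def)
    finally show ?thesis .
  qed
  finally show ?thesis .
qed

lemma sq_dist_far_minimizer:
  assumes f: "convex_on {0..1} f" "tame f" and g: "convex_on {0..1} g" "tame g"
    and z: "z \<in> {0..1}" and y: "y \<in> {0..1}" and gy: "\<And>t. t \<in> {0..1} \<Longrightarrow> g y \<le> g t"
    and m: "m > 0" and r: "r > 0"
    and far: "\<And>t. t \<in> {0..1} \<Longrightarrow> r < \<bar>t - z\<bar> \<Longrightarrow> f z + m < f t"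
    and zy: "5 * r < \<bar>y - z\<bar>"
  shows "2 * m\<^sup>2 * r < sq_dist f g"
proof (cases "z < y")
  case True
  then show ?thesis using far zy by (intro sq_dist_far_minimizer_right[OF f g z y gy m r]) auto
next
  case False
  have "2 * m\<^sup>2 * r < sq_dist (\<lambda>t. f (1 - t)) (\<lambda>t. g (1 - t))"
  proof (rule sq_dist_far_minimizer_right)
    show "1 - z \<in> {0..1}" "1 - y \<in> {0..1}" using z y by auto
    show "g (1 - (1 - y)) \<le> g (1 - t)" if "t \<in> {0..1}" for t using gy[of "1 - t"] that by simp
    show "f (1 - (1 - z)) + m < f (1 - t)" if "t \<in> {0..1}" "1 - z + r < t" for t
      using far[of "1 - t"] that by simp
    show "1 - z + 5 * r < 1 - y" using False zy by simp
  qed (rule convex_on_flip[OF f(1)] tame_flip[OF f(2)] convex_on_flip[OF g(1)] tame_flip[OF g(2)] m r)+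
  then show ?thesis by (simp add: sq_dist_flip)
qed

text \<open>Let \<open>q\<close> be the last point where \<open>g\<close> stays below \<open>c - h / 2\<close>. There \<open>f - g\<close> is at least \<open>h / 2\<close>, and by
  convexity \<open>g\<close> has climbed above \<open>c + h / 4\<close> beyond \<open>y + 5/2 (q - y)\<close>; the gain on \<open>{y..q}\<close> pays for
  the uncontrolled stretch in between.\<close>

lemma sq_dist_dip_right:
  assumes g: "convex_on {0..1} g" "tame g" and f: "tame f" and y: "y \<in> {0..1}"
    and fc: "\<And>t. t \<in> {0..1} \<Longrightarrow> c \<le> f t" and h: "h > 0" and gy: "g y = c - h"
  shows "integral {y..1} (\<lambda>t. (max 0 (c + h / 4 - f t))\<^sup>2) \<le> integral {y..1} (\<lambda>t. (f t - g t)\<^sup>2)"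
proof -
  define Q where "Q = {t \<in> {y..1}. g t \<le> c - h / 2}"
  define q where "q = Sup Q"
  \<comment> \<open>A chord that starts at height c - h and is above c - h/2 after 2/5 of its run
    ends above c + h/4; hence the factor 5/2. Per unit length of \<open>{y..q}\<close> the stretch
    up to \<open>p\<close> then costs at most (h/4)^2 * 5/2 = 5/32 h^2, less than the gain
    (h/2)^2.\<close>
  define p where "p = min 1 (y + 5 / 2 * (q - y))"
  have yQ: "y \<in> Q" using y gy h by (auto simp: Q_def)
  have bdd: "bdd_above Q" by (auto simp: Q_def intro!: bdd_aboveI[of _ 1])
  have "q \<le> 1" unfolding q_def by (rule cSup_least) (use yQ in \<open>auto simp: Q_def\<close>)
  with cSup_upper[OF yQ bdd] have q: "y \<le> q" "q \<le> 1" by (simp_all add: q_def)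
  have "q \<le> y + 5 / 2 * (q - y)" using q by (simp add: field_simps)
  with q have p: "q \<le> p" "p \<le> 1" "p \<le> y + 5 / 2 * (q - y)"
    unfolding p_def by (auto intro: min.cobounded2)
  let ?A = "\<lambda>t. (max 0 (c + h / 4 - f t))\<^sup>2" and ?B = "\<lambda>t. (f t - g t)\<^sup>2"
  have tm: "tame ?A" "tame ?B" by (intro tame_intros f g)+
  \<comment> \<open>The supremum \<open>q\<close> can lie outside \<open>Q\<close> when
    \<open>g\<close> jumps up at 1, so the chord ends at some \<open>s\<close> in \<open>Q\<close>
    beyond \<open>t\<close> instead.\<close>
  have low: "g t \<le> c - h / 2" if t: "y < t" "t < q" for t
  proof -
    obtain s where s: "s \<in> Q" "t < s" using t less_cSup_iff[of Q t] yQ bdd by (auto simp: q_def)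
    have "g t * (s - y) \<le> g y * (s - t) + g s * (t - y)"
      using convex_three_points[OF g(1), of y s t] s t y by (auto simp: Q_def)
    also have "\<dots> \<le> (c - h / 2) * (s - t) + (c - h / 2) * (t - y)"
      using s t gy h by (intro add_mono mult_right_mono) (auto simp: Q_def)
    also have "\<dots> = (c - h / 2) * (s - y)" by (simp add: right_diff_distrib)
    finally have "g t * (s - y) \<le> (c - h / 2) * (s - y)" .
    then show ?thesis using s t by auto
  qed
  have high: "c + h / 4 \<le> g t" if t: "y + 5 / 2 * (q - y) < t" "t < 1" for t
  proof -
    define s where "s = y + 2 / 5 * (t - y)"
    have s: "q < s" "y < s" "s < t" using t q by (simp_all add: s_def field_simps)
    have "s \<notin> Q" using s cSup_upper[of s Q] bdd by (auto simp: q_def)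
    then have gs: "c - h / 2 < g s" using s t by (auto simp: Q_def)
    have "g s * (t - y) \<le> g y * (t - s) + g t * (s - y)"
      using convex_three_points[OF g(1), of y t s] s t y by auto
    also have "t - s = 3 / 5 * (t - y)" by (simp add: s_def field_simps)
    also have "s - y = 2 / 5 * (t - y)" by (simp add: s_def)
    finally have "g s * (t - y) \<le> (3 / 5 * g y + 2 / 5 * g t) * (t - y)" by (simp add: algebra_simps)
    then have "g s \<le> 3 / 5 * g y + 2 / 5 * g t" using s by simp
    then show ?thesis using gs gy by (simp add: field_simps)
  qed
  have bnd: "0 \<le> y" using y by simp
  have 1: "integral {y..p} ?A \<le> (h / 4)\<^sup>2 * (p - y)"
  proof (rule tame_integral_le[OF tm(1)])
    fix t assume "y < t" "t < p"
    then show "?A t \<le> (h / 4)\<^sup>2" using fc[of t] bnd p h by (intro power_mono max.boundedI) auto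
  qed (use bnd p q in auto)
  have 2: "(h / 2)\<^sup>2 * (q - y) \<le> integral {y..q} ?B"
  proof (rule tame_integral_ge[OF tm(2)])
    fix t assume t: "y < t" "t < q"
    then show "(h / 2)\<^sup>2 \<le> ?B t" using fc[of t] low[OF t] bnd q h by (intro power_mono) auto
  qed (use bnd q in auto)
  have 3: "integral {p..1} ?A \<le> integral {p..1} ?B"
  proof (rule tame_integral_mono[OF tm])
    fix t assume t: "p < t" "t < 1"
    then have gt: "c + h / 4 \<le> g t" by (intro high) (auto simp: p_def)
    show "?A t \<le> ?B t"
    proof (cases "f t \<le> c + h / 4")
      case True
      then have "(c + h / 4 - f t)\<^sup>2 \<le> (g t - f t)\<^sup>2" using gt by (intro power_mono) auto
      then show ?thesis using True by (simp add: power2_commute)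
    qed auto
  qed (use bnd q p in auto)
  have 4: "0 \<le> integral {q..p} ?B"
    using tame_integral_ge[of ?B q p 0] tm bnd q p by simp
  have "(h / 4)\<^sup>2 * (p - y) \<le> (h / 4)\<^sup>2 * (5 / 2 * (q - y))"
    by (rule mult_left_mono) (use p(3) in linarith, simp)
  also have "\<dots> \<le> (h / 2)\<^sup>2 * (q - y)"
  proof -
    have "0 \<le> h\<^sup>2 * (q - y)" using q by simp
    then show ?thesis by (simp add: power_divide field_simps)
  qed
  finally have 5: "(h / 4)\<^sup>2 * (p - y) \<le> (h / 2)\<^sup>2 * (q - y)" .
  have "integral {y..1} ?A = integral {y..p} ?A + integral {p..1} ?A"
    by (rule tame_integral_split[OF tm(1)]) (use bnd p q in auto)
  moreover have "integral {y..1} ?B = integral {y..q} ?B + integral {q..1} ?B"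
    by (rule tame_integral_split[OF tm(2)]) (use bnd p q in auto)
  moreover have "integral {q..1} ?B = integral {q..p} ?B + integral {p..1} ?B"
    by (rule tame_integral_split[OF tm(2)]) (use bnd p q in auto)
  ultimately show ?thesis using 1 2 3 4 5 by linarith
qed

text \<open>The quarter is the origin of the factor 4 in \<open>minimum_modulus\<close>: as far as
  distance is concerned, a dip of depth \<open>h\<close> below the floor counts like water of depth
  \<open>h / 4\<close> above it. The part left of \<open>y\<close> is obtained by
  reflection.\<close>

lemma sq_dist_dip:
  assumes g: "convex_on {0..1} g" "tame g" and f: "tame f" and y: "y \<in> {0..1}"
    and fc: "\<And>t. t \<in> {0..1} \<Longrightarrow> c \<le> f t" and h: "h > 0" and gy: "g y = c - h"
  shows "water_level f (c + h / 4) \<le> sq_dist f g"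
proof -
  let ?A = "\<lambda>t. (max 0 (c + h / 4 - f t))\<^sup>2" and ?B = "\<lambda>t. (f t - g t)\<^sup>2"
  have tm: "tame ?A" "tame ?B" by (intro tame_intros f g)+
  have "integral {y..1} ?A \<le> integral {y..1} ?B" by (rule sq_dist_dip_right[OF g f y fc h gy])
  moreover have "integral {1 - y..1} (\<lambda>t. ?A (1 - t)) \<le> integral {1 - y..1} (\<lambda>t. ?B (1 - t))"
  proof (rule sq_dist_dip_right)
    show "c \<le> f (1 - t)" if "t \<in> {0..1}" for t using fc[of "1 - t"] that by simp
  qed (use y h gy in \<open>auto intro: convex_on_flip[OF g(1)] tame_flip[OF g(2)] tame_flip[OF f]\<close>)
  then have "integral {0..y} ?A \<le> integral {0..y} ?B"
    using integral_flip[of "1 - y" 1 ?A] integral_flip[of "1 - y" 1 ?B] by simp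
  moreover have "integral {0..1} ?A = integral {0..y} ?A + integral {y..1} ?A"
    "integral {0..1} ?B = integral {0..y} ?B + integral {y..1} ?B"
    using y by (auto intro!: tame_integral_split tm)
  ultimately show ?thesis by (simp add: sq_dist_def water_level_def)
qed

section \<open>Dependence of the amount of water on its level\<close>

lemma max0_square_convex:
  fixes a b s :: real
  assumes "0 \<le> s" "s \<le> 1"
  shows "(max 0 ((1 - s) * a + s * b))\<^sup>2 \<le> (1 - s) * (max 0 a)\<^sup>2 + s * (max 0 b)\<^sup>2"
proof -
  define p q where "p = max 0 a" and "q = max 0 b"
  have "(1 - s) * a + s * b \<le> (1 - s) * p + s * q"
    using assms by (intro add_mono mult_left_mono) (auto simp: p_def q_def)
  moreover have "0 \<le> (1 - s) * p + s * q" using assms by (simp add: p_def q_def)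
  ultimately have "(max 0 ((1 - s) * a + s * b))\<^sup>2 \<le> ((1 - s) * p + s * q)\<^sup>2"
    by (intro power_mono) auto
  also have "\<dots> \<le> (1 - s) * p\<^sup>2 + s * q\<^sup>2"
  proof -
    have "(1 - s) * p\<^sup>2 + s * q\<^sup>2 - ((1 - s) * p + s * q)\<^sup>2 = s * (1 - s) * (p - q)\<^sup>2"
      by (simp add: power2_eq_square algebra_simps)
    moreover have "0 \<le> s * (1 - s) * (p - q)\<^sup>2" using assms by simp
    ultimately show ?thesis by linarith
  qed
  finally show ?thesis by (simp add: p_def q_def)
qed

lemma tame_water: "tame f \<Longrightarrow> tame (\<lambda>t. (max 0 (u - f t))\<^sup>2)"
  by (intro tame_intros)

text \<open>Convexity on the whole line yields continuity, which the intermediate value theorem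
  needs in \<open>water_level_surj\<close>.\<close>

lemma water_level_convex: assumes "tame f" shows "convex_on UNIV (water_level f)"
proof (rule convex_onI)
  fix s a b :: real assume s: "s > 0" "s < 1"
  let ?w = "\<lambda>u t. (max 0 (u - f t))\<^sup>2"
  have "water_level f ((1 - s) *\<^sub>R a + s *\<^sub>R b)
      \<le> integral {0..1} (\<lambda>t. (1 - s) * ?w a t + s * ?w b t)"
    unfolding water_level_def
  proof (rule tame_integral_mono)
    show "tame (\<lambda>t. (1 - s) * ?w a t + s * ?w b t)" by (intro tame_intros assms)
    show "?w ((1 - s) *\<^sub>R a + s *\<^sub>R b) t \<le> (1 - s) * ?w a t + s * ?w b t" for t
    proof -
      have "(1 - s) * a + s * b - f t = (1 - s) * (a - f t) + s * (b - f t)"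
        by (simp add: algebra_simps)
      then show ?thesis using max0_square_convex[of s "a - f t" "b - f t"] s by simp
    qed
  qed (auto intro: tame_water assms)
  also have "\<dots> = (1 - s) * water_level f a + s * water_level f b"
    unfolding water_level_def
    by (subst integral_add) (auto intro!: tame_integrable01 tame_mult tame_const tame_water assms)
  finally show "water_level f ((1 - s) *\<^sub>R a + s *\<^sub>R b) \<le> (1 - s) * water_level f a + s * water_level f b" .
qed simp

lemma water_level_eq_0:
  assumes "f \<in> convex_class" "u \<le> minimum f" shows "water_level f u = 0"
proof -
  have "water_level f u = integral {0..1 :: real} (\<lambda>_. 0 :: real)"
    unfolding water_level_def
  proof (rule Henstock_Kurzweil_Integration.integral_cong)
    show "(max 0 (u - f t))\<^sup>2 = 0" if "t \<in> {0..1}" for t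
      using convex_classD(3)[OF assms(1) that] assms(2) by simp
  qed
  then show ?thesis by simp
qed

text \<open>With \<phi> = f - M(f) \<ge> 0 one has x (m - \<phi>) \<le> x m - \<phi>: multiplying
  the height by x multiplies the depth at each wet point by at least x. This is the source of the
  linear growth of the moduli.\<close>

lemma water_level_scale:
  assumes f: "f \<in> convex_class" and x: "1 \<le> x" and m: "0 \<le> m"
  shows "x\<^sup>2 * water_level f (minimum f + m) \<le> water_level f (minimum f + x * m)"
proof -
  have tf: "tame f" by (rule convex_class_tame[OF f])
  have "x\<^sup>2 * water_level f (minimum f + m)
      = integral {0..1} (\<lambda>t. x\<^sup>2 * (max 0 (minimum f + m - f t))\<^sup>2)"
    by (simp add: water_level_def)
  also have "\<dots> \<le> water_level f (minimum f + x * m)"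
    unfolding water_level_def
  proof (rule tame_integral_mono)
    show "tame (\<lambda>t. x\<^sup>2 * (max 0 (minimum f + m - f t))\<^sup>2)" by (intro tame_intros tf)
    fix t :: real assume t: "0 < t" "t < 1"
    have "x * (minimum f + m - f t) \<le> minimum f + x * m - f t"
    proof -
      have "(x - 1) * (minimum f - f t) \<le> 0"
        using convex_classD(3)[OF f, of t] t x by (intro mult_nonneg_nonpos) auto
      then show ?thesis by (simp add: algebra_simps)
    qed
    then have "x * max 0 (minimum f + m - f t) \<le> max 0 (minimum f + x * m - f t)"
      using x by (auto simp: max_def)
    then have "(x * max 0 (minimum f + m - f t))\<^sup>2 \<le> (max 0 (minimum f + x * m - f t))\<^sup>2"
      using x by (intro power_mono) auto
    then show "x\<^sup>2 * (max 0 (minimum f + m - f t))\<^sup>2 \<le> (max 0 (minimum f + x * m - f t))\<^sup>2"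
      by (simp add: power_mult_distrib)
  qed (auto intro: tame_water tf)
  finally show ?thesis .
qed

text \<open>Positivity puts \<open>u\<close> strictly above the minimum, so passing to
  \<open>v\<close> is a scaling by some x > 1 and gains the factor x^2.\<close>

lemma water_level_strict_mono:
  assumes f: "f \<in> convex_class" and uv: "u < v" and pos: "0 < water_level f u"
  shows "water_level f u < water_level f v"
proof -
  define m where "m = u - minimum f"
  have m: "0 < m"
    using water_level_eq_0[OF f, of u] pos by (simp add: m_def) (meson not_le less_irrefl)
  define x where "x = (v - minimum f) / m"
  have x: "1 < x" "minimum f + x * m = v" "minimum f + m = u" using m uv by (auto simp: x_def m_def)
  have "1 < x\<^sup>2" using x by (simp add: one_less_power)
  then have "water_level f u < x\<^sup>2 * water_level f u" using pos by simp
  also have "\<dots> \<le> water_level f v"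
    using water_level_scale[OF f, of x m] x m by simp
  finally show ?thesis .
qed

lemma water_level_surj:
  assumes f: "f \<in> convex_class" and d: "0 < \<delta>"
  obtains m where "0 < m" "water_level f (minimum f + m) = \<delta>\<^sup>2"
proof -
  have tf: "tame f" by (rule convex_class_tame[OF f])
  obtain K where K: "K > 0" "\<And>t. t \<in> {0..1} \<Longrightarrow> \<bar>f t\<bar> \<le> K"
    using tame_boundE[OF tf] by blast
  have "continuous_on UNIV (water_level f)"
    by (rule convex_on_continuous[OF open_UNIV water_level_convex[OF tf]])
  \<comment> \<open>\<open>K\<close> bounds the absolute value of \<open>f\<close>, so at level
    \<open>K + \<delta>\<close> the depth is at least \<open>\<delta>\<close> everywhere.\<close>
  moreover have "\<delta>\<^sup>2 * (1 - 0) \<le> water_level f (K + \<delta>)"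
    unfolding water_level_def
  proof (rule tame_integral_ge[OF tame_water[OF tf]])
    show "\<delta>\<^sup>2 \<le> (max 0 (K + \<delta> - f t))\<^sup>2" if "0 < t" "t < 1" for t
      using K(2)[of t] that d by (intro power_mono) auto
  qed auto
  moreover have "minimum f \<le> K + \<delta>"
    using K(2)[of 0] convex_classD(3)[OF f, of 0] d by auto
  ultimately obtain u where u: "minimum f \<le> u" "u \<le> K + \<delta>" "water_level f u = \<delta>\<^sup>2"
    using IVT'[of "water_level f" "minimum f" "\<delta>\<^sup>2" "K + \<delta>"] water_level_eq_0[OF f order_refl]
    by (auto intro: continuous_on_subset)
  have "u \<noteq> minimum f" using u(3) water_level_eq_0[OF f, of u] d by auto
  then show ?thesis using u by (intro that[of "u - minimum f"]) auto
qed

text \<open>Between the minimizer and \<open>b\<close> the graph lies below its chord, so the depth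
  is at least that of a wedge falling from \<open>m\<close> to 0. The squared wedge integrates to
  one third of m^2 times its length.\<close>

lemma sublevel_integral_lower:
  assumes f: "f \<in> convex_class" and b: "b \<in> {0..1}" "f b \<le> minimum f + m" and m: "0 < m"
  shows "m\<^sup>2 * \<bar>b - minimizer f\<bar> / 3 \<le> water_level f (minimum f + m)"
proof -
  let ?z = "minimizer f" and ?c = "minimum f"
  have z: "?z \<in> {0..1}" "f ?z = ?c" using convex_classD(2)[OF f] by (auto simp: minimum_def)
  have cf: "convex_on {0..1} f" and tf: "tame f" using convex_classD[OF f] convex_class_tame[OF f] by auto
  let ?w = "\<lambda>t. (max 0 (?c + m - f t))\<^sup>2"
  have sub: "integral {a..a'} ?w \<le> water_level f (?c + m)" if "0 \<le> a" "a' \<le> 1" for a a'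
    unfolding water_level_def using that by (intro tame_integral_subset tame_water tf) auto
  define k where "k = m / (b - ?z)"
  consider "b = ?z" | "?z < b" | "b < ?z" by linarith
  then show ?thesis
  proof cases
    case 1
    then show ?thesis using sub[of 0 0] by simp
  next
    case 2
    have "m\<^sup>2 * \<bar>b - ?z\<bar> / 3 = k\<^sup>2 * ((b - b) ^ 3 - (?z - b) ^ 3) / 3"
      using 2 by (simp add: k_def power3_eq_cube power2_eq_square divide_simps) (simp add: algebra_simps)
    also have "\<dots> = integral {?z..b} (\<lambda>t. (k * (t - b))\<^sup>2)"
      using 2 by (subst integral_square_linear) auto
    also have "\<dots> \<le> integral {?z..b} ?w"
    proof (rule tame_integral_mono)
      fix t assume t: "?z < t" "t < b"
      have "f t * (b - ?z) \<le> ?c * (b - t) + f b * (t - ?z)"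
        using convex_three_points[OF cf z(1) b(1), of t] t z by simp
      also have "f b * (t - ?z) \<le> (?c + m) * (t - ?z)" using b t by (intro mult_right_mono) auto
      finally have "m * (b - t) \<le> (?c + m - f t) * (b - ?z)" by (simp add: algebra_simps)
      then have "k * (b - t) \<le> ?c + m - f t" using 2 by (simp add: k_def field_simps)
      moreover have "0 \<le> k * (b - t)" using m 2 t by (simp add: k_def)
      ultimately have "(k * (b - t))\<^sup>2 \<le> ?w t" by (intro power_mono) auto
      then show "(k * (t - b))\<^sup>2 \<le> ?w t" by (simp add: power_mult_distrib power2_commute)
    qed (use z b in \<open>auto intro!: tame_intros tf\<close>)
    also have "\<dots> \<le> water_level f (?c + m)" using z b by (intro sub) auto
    finally show ?thesis .
  next
    case 3
    have "m\<^sup>2 * \<bar>b - ?z\<bar> / 3 = k\<^sup>2 * ((?z - b) ^ 3 - (b - b) ^ 3) / 3"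
      using 3 by (simp add: k_def power3_eq_cube power2_eq_square divide_simps) (simp add: algebra_simps)
    also have "\<dots> = integral {b..?z} (\<lambda>t. (k * (t - b))\<^sup>2)"
      using 3 by (subst integral_square_linear) auto
    also have "\<dots> \<le> integral {b..?z} ?w"
    proof (rule tame_integral_mono)
      fix t assume t: "b < t" "t < ?z"
      have "f t * (?z - b) \<le> f b * (?z - t) + ?c * (t - b)"
        using convex_three_points[OF cf b(1) z(1), of t] t z by simp
      also have "f b * (?z - t) \<le> (?c + m) * (?z - t)" using b t by (intro mult_right_mono) auto
      finally have "m * (t - b) \<le> (?c + m - f t) * (?z - b)" by (simp add: algebra_simps)
      then have "(- k) * (t - b) \<le> ?c + m - f t" using 3 by (simp add: k_def field_simps)
      moreover have "0 \<le> (- k) * (t - b)" using m 3 t by (simp add: k_def divide_nonneg_neg mult_nonpos_nonneg)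
      ultimately have "((- k) * (t - b))\<^sup>2 \<le> ?w t" by (intro power_mono) auto
      then show "(k * (t - b))\<^sup>2 \<le> ?w t" by (simp add: power_mult_distrib)
    qed (use z b in \<open>auto intro!: tame_intros tf\<close>)
    also have "\<dots> \<le> water_level f (?c + m)" using z b by (intro sub) auto
    finally show ?thesis .
  qed
qed

lemma sublevel_integral_upper:
  assumes f: "f \<in> convex_class" and m: "0 < m" and r: "0 \<le> r"
    and sub: "\<And>t. t \<in> {0..1} \<Longrightarrow> f t \<le> minimum f + m \<Longrightarrow> \<bar>t - minimizer f\<bar> \<le> r"
  shows "water_level f (minimum f + m) \<le> 2 * m\<^sup>2 * r"
proof -
  let ?z = "minimizer f" and ?c = "minimum f"
  have z: "?z \<in> {0..1}" using convex_classD(2)[OF f] .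
  have tf: "tame f" by (rule convex_class_tame[OF f])
  let ?w = "\<lambda>t. (max 0 (?c + m - f t))\<^sup>2"
  have tw: "tame ?w" by (intro tame_water tf)
  define a where "a = max 0 (?z - r)"
  define b where "b = min 1 (?z + r)"
  have ab: "0 \<le> a" "a \<le> b" "b \<le> 1" "b - a \<le> 2 * r" using z r by (auto simp: a_def b_def)
  have zero: "?w t \<le> 0" if "t \<in> {0..1}" "r < \<bar>t - ?z\<bar>" for t
    using sub[OF that(1)] that(2) by (auto simp: max_def)
  have "integral {0..a} ?w \<le> 0 * (a - 0)"
  proof (rule tame_integral_le[OF tw])
    show "?w t \<le> 0" if "0 < t" "t < a" for t using that ab by (intro zero) (auto simp: a_def)
  qed (use ab in auto)
  moreover have "integral {b..1} ?w \<le> 0 * (1 - b)"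
  proof (rule tame_integral_le[OF tw])
    show "?w t \<le> 0" if "b < t" "t < 1" for t using that ab by (intro zero) (auto simp: b_def)
  qed (use ab in auto)
  moreover have "integral {a..b} ?w \<le> m\<^sup>2 * (b - a)"
  proof (rule tame_integral_le[OF tw])
    fix t assume "a < t" "t < b"
    then show "?w t \<le> m\<^sup>2" using convex_classD(3)[OF f, of t] ab m by (intro power_mono max.boundedI) auto
  qed (use ab in auto)
  moreover have "m\<^sup>2 * (b - a) \<le> m\<^sup>2 * (2 * r)" using ab by (intro mult_left_mono) auto
  moreover have "water_level f (?c + m) = integral {0..a} ?w + (integral {a..b} ?w + integral {b..1} ?w)"
    unfolding water_level_def
    using tame_integral_split[OF tw, of 0 a 1] tame_integral_split[OF tw, of a b 1] ab by simp
  ultimately show ?thesis by simp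
qed

text \<open>The last conclusion says that \<open>r\<close> is the least bound rather than an
  attained distance: if \<open>f\<close> jumps at an endpoint, the sublevel set need not be closed
  there. Positivity of \<open>r\<close> is read off from the inequality \<delta>^2 \<le> 2 m^2
  r.\<close>

lemma water_level_geometry:
  assumes f: "f \<in> convex_class" and d: "0 < \<delta>"
  obtains m r where "0 < m" "0 < r" "water_level f (minimum f + m) = \<delta>\<^sup>2"
    "\<delta>\<^sup>2 \<le> 2 * m\<^sup>2 * r" "m\<^sup>2 * r \<le> 3 * \<delta>\<^sup>2"
    "\<forall>t\<in>{0..1}. f t \<le> minimum f + m \<longrightarrow> \<bar>t - minimizer f\<bar> \<le> r"
    "\<forall>B. (\<forall>t\<in>{0..1}. f t \<le> minimum f + m \<longrightarrow> \<bar>t - minimizer f\<bar> \<le> B) \<longrightarrow> r \<le> B"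
proof -
  obtain m where m: "0 < m" "water_level f (minimum f + m) = \<delta>\<^sup>2"
    using water_level_surj[OF f d] by blast
  let ?z = "minimizer f" and ?c = "minimum f"
  have z: "?z \<in> {0..1}" using convex_classD(2)[OF f] .
  define S where "S = {t \<in> {0..1}. f t \<le> ?c + m}"
  define r where "r = (SUP t\<in>S. \<bar>t - ?z\<bar>)"
  have zS: "?z \<in> S" using z m by (auto simp: S_def minimum_def)
  have bdd: "bdd_above ((\<lambda>t. \<bar>t - ?z\<bar>) ` S)"
    using z by (intro bdd_aboveI[of _ 1]) (auto simp: S_def abs_if)
  have upper: "\<bar>t - ?z\<bar> \<le> r" if "t \<in> S" for t
    unfolding r_def using bdd that by (rule cSUP_upper2) auto
  have least: "r \<le> B" if "\<And>t. t \<in> S \<Longrightarrow> \<bar>t - ?z\<bar> \<le> B" for B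
    unfolding r_def using zS that by (intro cSUP_least) auto
  have r0: "0 \<le> r" using upper[OF zS] by simp
  have 1: "\<delta>\<^sup>2 \<le> 2 * m\<^sup>2 * r"
    using sublevel_integral_upper[OF f m(1) r0] upper m(2) by (auto simp: S_def)
  have "r \<noteq> 0" using 1 d by auto
  have 2: "m\<^sup>2 * r \<le> 3 * \<delta>\<^sup>2"
  proof -
    have "r \<le> 3 * \<delta>\<^sup>2 / m\<^sup>2"
    proof (rule least)
      fix t assume "t \<in> S"
      then have "m\<^sup>2 * \<bar>t - ?z\<bar> / 3 \<le> \<delta>\<^sup>2"
        using sublevel_integral_lower[OF f, of t m] m by (auto simp: S_def)
      then show "\<bar>t - ?z\<bar> \<le> 3 * \<delta>\<^sup>2 / m\<^sup>2" using m by (simp add: field_simps)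
    qed
    then show ?thesis using m by (simp add: field_simps)
  qed
  show ?thesis
    using \<open>r \<noteq> 0\<close> r0 m 1 2 upper least by (intro that[of m r]) (auto simp: S_def)
qed

text \<open>Both directions become statements about water levels, which \<open>up\<close> caps at
  M(f) + x m. A raised minimum of \<open>g\<close> lifts \<open>g\<close> above that level of water
  in \<open>f\<close>; a lowered minimum is a dip and is charged at a quarter of its depth.\<close>

lemma minimum_modulus:
  assumes f: "f \<in> convex_class" and g: "g \<in> convex_class" and m: "0 < m" and x: "1 \<le> x"
    and d: "0 < \<delta>" "water_level f (minimum f + m) = \<delta>\<^sup>2" and fg: "sq_dist f g \<le> (x * \<delta>)\<^sup>2"
  shows "\<bar>minimum g - minimum f\<bar> \<le> 4 * x * m"
proof -
  have tf: "tame f" and tg: "tame g" using convex_class_tame f g by auto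
  have up: "u \<le> minimum f + x * m" if "water_level f u \<le> sq_dist f g" for u
  proof (rule ccontr)
    assume "\<not> ?thesis"
    then have u: "minimum f + x * m < u" by simp
    have sc: "(x * \<delta>)\<^sup>2 \<le> water_level f (minimum f + x * m)"
      using water_level_scale[OF f x, of m] m d by (simp add: power_mult_distrib)
    have "0 < (x * \<delta>)\<^sup>2" using x d by simp
    then have "water_level f (minimum f + x * m) < water_level f u"
      using sc by (intro water_level_strict_mono[OF f u]) linarith
    then show False using that fg sc by linarith
  qed
  have "water_level f (minimum g) \<le> sq_dist f g"
    unfolding water_level_def sq_dist_def
  proof (rule tame_integral_mono[OF tame_water[OF tf]])
    show "tame (\<lambda>t. (f t - g t)\<^sup>2)" by (intro tame_intros tf tg)
    fix t :: real assume "0 < t" "t < 1"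
    then have "(max 0 (minimum g - f t))\<^sup>2 \<le> \<bar>g t - f t\<bar>\<^sup>2"
      using convex_classD(3)[OF g, of t] by (intro power_mono) auto
    then show "(max 0 (minimum g - f t))\<^sup>2 \<le> (f t - g t)\<^sup>2" by (simp add: power2_commute)
  qed auto
  from up[OF this] have 1: "minimum g \<le> minimum f + x * m" .
  have 2: "minimum f - minimum g \<le> 4 * x * m" if "minimum g < minimum f"
  proof -
    have "water_level f (minimum f + (minimum f - minimum g) / 4) \<le> sq_dist f g"
      using that
      by (intro sq_dist_dip[OF convex_classD(1)[OF g] tg tf convex_classD(2)[OF g]] convex_classD(3)[OF f])
        (simp_all add: minimum_def)
    from up[OF this] show ?thesis by simp
  qed
  have "0 < x * m" using x m by simp
  then show ?thesis using 1 2 by linarith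
qed

text \<open>Dilate the picture by \<open>x\<close> about the minimizer: by convexity
  \<open>f\<close> exceeds its minimum by more than \<open>x * m\<close> outside radius
  \<open>x * r\<close>. A minimizer further than \<open>5 * x * r\<close> would then cost more than
  2 x^3 m^2 r, while only x^2 \<delta>^2 \<le> 2 x^2 m^2 r is available.\<close>

lemma minimizer_modulus:
  assumes f: "f \<in> convex_class" and g: "g \<in> convex_class" and m: "0 < m" and r: "0 < r" and x: "1 \<le> x"
    and d: "\<delta>\<^sup>2 \<le> 2 * m\<^sup>2 * r" and fg: "sq_dist f g \<le> (x * \<delta>)\<^sup>2"
    and sub: "\<And>t. t \<in> {0..1} \<Longrightarrow> f t \<le> minimum f + m \<Longrightarrow> \<bar>t - minimizer f\<bar> \<le> r"
  shows "\<bar>minimizer g - minimizer f\<bar> \<le> 5 * x * r"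
proof (rule ccontr)
  assume "\<not> ?thesis"
  then have far: "5 * (x * r) < \<bar>minimizer g - minimizer f\<bar>" by simp
  let ?z = "minimizer f"
  have z: "?z \<in> {0..1}" using convex_classD(2)[OF f] .
  have "2 * (x * m)\<^sup>2 * (x * r) < sq_dist f g"
  proof (rule sq_dist_far_minimizer[OF convex_classD(1)[OF f] convex_class_tame[OF f]
        convex_classD(1)[OF g] convex_class_tame[OF g] z convex_classD(2)[OF g] _ _ _ _ far])
    show "g (minimizer g) \<le> g t" if "t \<in> {0..1}" for t
      using convex_classD(3)[OF g that] by (simp add: minimum_def)
    show "0 < x * m" "0 < x * r" using x m r by auto
    fix t :: real assume t: "t \<in> {0..1}" "x * r < \<bar>t - ?z\<bar>"
    have x0: "0 < x" using x by simp
    \<comment> \<open>The contraction of \<open>t\<close> towards the minimizer by the factor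
      \<open>x\<close>. It lies outside radius \<open>r\<close>, where \<open>sub\<close> applies,
      and convexity carries the gain back to \<open>t\<close>.\<close>
    define s where "s = ?z + (t - ?z) / x"
    have sz: "\<bar>s - ?z\<bar> = \<bar>t - ?z\<bar> / x" using x0 by (simp add: s_def)
    have lam: "s = (1 - 1 / x) * ?z + (1 / x) * t" using x0 by (simp add: s_def field_simps)
    have "(1 - 1 / x) *\<^sub>R ?z + (1 / x) *\<^sub>R t \<in> {0..1}"
      using x x0 z t by (intro convexD_alt) auto
    then have s01: "s \<in> {0..1}" by (simp add: lam)
    have "r < \<bar>s - ?z\<bar>" using t x0 by (simp add: sz field_simps)
    then have "minimum f + m < f s" using sub[OF s01] by force
    also have "f s \<le> (1 - 1 / x) * f ?z + 1 / x * f t"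
      using convex_onD[OF convex_classD(1)[OF f], of "1 / x" ?z t] x x0 z t by (simp add: lam)
    finally have "m < (f t - f ?z) / x" using x0 by (simp add: minimum_def field_simps)
    then show "f ?z + x * m < f t" using x0 by (simp add: field_simps)
  qed
  moreover have "(x * \<delta>)\<^sup>2 \<le> x\<^sup>2 * (2 * m\<^sup>2 * r)" using d by (simp add: power_mult_distrib mult_left_mono)
  moreover have "x\<^sup>2 * (2 * m\<^sup>2 * r) * 1 \<le> x\<^sup>2 * (2 * m\<^sup>2 * r) * x"
    using x r by (intro mult_left_mono) auto
  ultimately show False using fg by (simp add: power_mult_distrib algebra_simps)
qed

text \<open>The cone of slope \<open>\<eta>\<close> with vertex \<open>b\<close> singles out one
  minimizer on the flat bottom of max f u. It adds at most \<open>\<eta>\<close> to a depth that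
  never exceeds \<open>m\<close>, which bounds the extra cost by 2 \<eta> m + \<eta>^2.\<close>

lemma perturbation:
  assumes f: "f \<in> convex_class" and b: "b \<in> {0..1}" "f b \<le> minimum f + m"
    and m: "0 < m" and e: "0 < \<eta>"
  obtains g where "g \<in> convex_class" "minimizer g = b" "minimum g = minimum f + m"
    "sq_dist f g \<le> water_level f (minimum f + m) + 2 * \<eta> * m + \<eta>\<^sup>2"
proof -
  have tf: "tame f" by (rule convex_class_tame[OF f])
  define u where "u = minimum f + m"
  define g where "g = (\<lambda>t. max (f t) (u + \<eta> * dist b t))"
  have cg: "convex_on {0..1} g"
    unfolding g_def using e
    by (intro convex_on_max convex_classD(1)[OF f] convex_on_add convex_on_cmul convex_on_dist)
      (auto simp: convex_on_const)
  have gb: "g b = u" using b by (simp add: g_def u_def)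
  have gt: "g b < g t" if "t \<noteq> b" for t
    using that e unfolding gb by (simp add: g_def less_max_iff_disj)
  note g = convex_classI[OF cg b(1) gt]
  have "sq_dist f g \<le> integral {0..1} (\<lambda>t. (max 0 (u - f t))\<^sup>2 + (2 * \<eta> * m + \<eta>\<^sup>2))"
    unfolding sq_dist_def
  proof (rule tame_integral_mono)
    show "tame (\<lambda>t. (f t - g t)\<^sup>2)" using convex_class_tame[OF g(1)] by (intro tame_intros tf)
    show "tame (\<lambda>t. (max 0 (u - f t))\<^sup>2 + (2 * \<eta> * m + \<eta>\<^sup>2))" by (intro tame_intros tf)
    fix t :: real assume t: "0 < t" "t < 1"
    define p where "p = max 0 (u - f t)"
    have p: "0 \<le> p" "p \<le> m" using convex_classD(3)[OF f, of t] t m by (auto simp: p_def u_def)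
    have "\<eta> * dist b t \<le> \<eta> * 1" using t b e by (intro mult_left_mono) (auto simp: dist_real_def)
    moreover have "u - f t \<le> p" by (simp add: p_def)
    ultimately have "g t \<le> f t + p + \<eta>"
      unfolding g_def using p e by (intro max.boundedI) linarith+
    then have "g t - f t \<le> p + \<eta>" by simp
    moreover have "0 \<le> g t - f t" by (simp add: g_def)
    ultimately have "(g t - f t)\<^sup>2 \<le> (p + \<eta>)\<^sup>2" by (intro power_mono) auto
    also have "\<dots> = p\<^sup>2 + (2 * \<eta> * p + \<eta>\<^sup>2)" by (simp add: power2_sum)
    also have "\<dots> \<le> p\<^sup>2 + (2 * \<eta> * m + \<eta>\<^sup>2)" using p e by simp
    finally show "(f t - g t)\<^sup>2 \<le> (max 0 (u - f t))\<^sup>2 + (2 * \<eta> * m + \<eta>\<^sup>2)"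
      by (simp add: p_def power2_commute)
  qed auto
  also have "\<dots> = water_level f u + (2 * \<eta> * m + \<eta>\<^sup>2)"
    unfolding water_level_def
    by (subst integral_add) (auto intro!: tame_integrable01 tame_water tame_const tf)
  finally show ?thesis
    using g gb by (intro that[of g]) (auto simp: minimum_def u_def)
qed

section \<open>The standard normal distribution\<close>

interpretation std_normal: real_distribution std_normal_distribution
  by (rule real_dist_normal_dist)

lemma std_normal_cdf_eq: "std_normal_cdf x = measure std_normal_distribution {..x}"
  by (simp add: std_normal_cdf_def cdf_def)

lemma std_normal_cdf_mono: "x \<le> y \<Longrightarrow> std_normal_cdf x \<le> std_normal_cdf y"
  unfolding std_normal_cdf_def by (rule std_normal.cdf_nondecreasing)

lemma std_normal_cdf_nonneg: "0 \<le> std_normal_cdf x"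
  by (simp add: std_normal_cdf_eq)

text \<open>0.4 is a rational bound for the peak 1 / sqrt (2 pi) of the density, about 0.399.
  Together with \<Phi>(0) = 1/2 it gives \<Phi>(0.5) \<le> 0.7 and \<Phi>(-0.5) \<ge> 0.3.\<close>

lemma std_normal_measure_Ioc:
  assumes "a \<le> b" shows "measure std_normal_distribution {a<..b} \<le> 0.4 * (b - a)"
proof -
  have d: "std_normal_density x \<le> 0.4" for x
  proof -
    have "(2.5 :: real)\<^sup>2 \<le> 2 * pi" using pi_approx(1) by (simp add: power2_eq_square)
    then have "2.5 \<le> sqrt (2 * pi)" by (rule real_le_rsqrt)
    then have "1 / sqrt (2 * pi) \<le> 1 / 2.5" by (intro divide_left_mono) auto
    moreover have "exp (- x\<^sup>2 / 2) \<le> 1" by simp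
    ultimately have "1 / sqrt (2 * pi) * exp (- x\<^sup>2 / 2) \<le> 0.4 * 1" by (intro mult_mono) auto
    then show ?thesis by (simp add: std_normal_density_def)
  qed
  have "emeasure std_normal_distribution {a<..b} = (\<integral>\<^sup>+ x\<in>{a<..b}. ennreal (std_normal_density x) \<partial>lborel)"
    by (subst emeasure_density) auto
  also have "\<dots> \<le> (\<integral>\<^sup>+ x\<in>{a<..b}. ennreal 0.4 \<partial>lborel)"
    by (intro nn_integral_mono mult_right_mono ennreal_leI d) auto
  also have "\<dots> = ennreal (0.4 * (b - a))"
    using assms by (subst nn_integral_cmult_indicator) (auto simp flip: ennreal_mult)
  finally show ?thesis
    using assms by (simp add: std_normal.emeasure_eq_measure del: ennreal_0)
qed

lemma std_normal_cdf_lipschitz: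
  assumes "a \<le> b" shows "std_normal_cdf b - std_normal_cdf a \<le> 0.4 * (b - a)"
proof (cases "a = b")
  case False
  then show ?thesis
    using std_normal.cdf_diff_eq[of a b] std_normal_measure_Ioc[of a b] assms
    by (simp add: std_normal_cdf_def)
qed simp

lemma std_normal_singleton: "measure std_normal_distribution {x} = 0"
proof -
  have "emeasure std_normal_distribution {x} = 0"
    by (subst emeasure_density) (auto simp: nn_integral_0_iff_AE intro!: AE_I'[of "{x}"])
  then show ?thesis by (simp add: measure_def)
qed

lemma std_normal_cdf_cont: "continuous_on UNIV std_normal_cdf"
  unfolding std_normal_cdf_def
  by (intro continuous_at_imp_continuous_on ballI) (simp add: std_normal.isCont_cdf std_normal_singleton)

lemma distributed_std_normal: "distributed std_normal_distribution lborel (\<lambda>x. x) std_normal_density"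
  unfolding distributed_def by (auto intro!: distr_cong simp: distr_id2 cong: distr_cong)

context prob_space
begin

lemma normal_le:
  assumes X: "distributed M lborel X (normal_density \<mu> \<sigma>)" and s: "0 < \<sigma>"
  shows "measure M {\<omega>\<in>space M. X \<omega> \<le> x} = std_normal_cdf ((x - \<mu>) / \<sigma>)"
proof -
  let ?Y = "\<lambda>\<omega>. (X \<omega> - \<mu>) / \<sigma>"
  have Y: "distributed M lborel ?Y std_normal_density"
    using X normal_standard_normal_convert[OF s, of X \<mu>] by simp
  then have d: "distr M lborel ?Y = std_normal_distribution" and m: "?Y \<in> measurable M lborel"
    by (auto simp: distributed_def)
  have "std_normal_cdf ((x - \<mu>) / \<sigma>) = measure M (?Y -` {..(x - \<mu>) / \<sigma>} \<inter> space M)"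
    unfolding std_normal_cdf_eq d[symmetric] using m by (subst measure_distr) auto
  also have "?Y -` {..(x - \<mu>) / \<sigma>} \<inter> space M = {\<omega>\<in>space M. X \<omega> \<le> x}"
    using s by (auto simp: divide_le_cancel)
  finally show ?thesis by simp
qed

lemma normal_ge:
  assumes X: "distributed M lborel X (normal_density \<mu> \<sigma>)" and s: "0 < \<sigma>"
  shows "measure M {\<omega>\<in>space M. x \<le> X \<omega>} = std_normal_cdf ((\<mu> - x) / \<sigma>)"
proof -
  have "distributed M lborel (\<lambda>\<omega>. 0 + (-1) * X \<omega>) (normal_density (0 + (-1) * \<mu>) (\<bar>-1\<bar> * \<sigma>))"
    using X s by (rule normal_density_affine) simp
  then have "distributed M lborel (\<lambda>\<omega>. - X \<omega>) (normal_density (- \<mu>) \<sigma>)" by simp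
  from normal_le[OF this s, of "- x"] show ?thesis by simp
qed

end

lemma std_normal_cdf_minus: "std_normal_cdf (- x) = 1 - std_normal_cdf x"
proof -
  have "std_normal_cdf (- x) = measure std_normal_distribution {x..}"
    using std_normal.normal_ge[OF distributed_std_normal, of x] by (simp add: atLeast_def)
  also have "{x..} = {x} \<union> {x<..}" by auto
  also have "measure std_normal_distribution \<dots> = measure std_normal_distribution {x<..}"
    by (subst std_normal.finite_measure_Union) (auto simp: std_normal_singleton)
  also have "{x<..} = space std_normal_distribution - {..x}" by auto
  also have "measure std_normal_distribution \<dots> = 1 - std_normal_cdf x"
    by (subst std_normal.prob_compl) (auto simp: std_normal_cdf_eq)
  finally show ?thesis .
qed

lemma std_normal_cdf_0: "std_normal_cdf 0 = 1 / 2"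
  using std_normal_cdf_minus[of 0] by simp

text \<open>Markov's inequality for the absolute value, whose mean sqrt (2 / pi) is below 0.8, with
  the two symmetric tails shared equally. The rate 1/t is just enough against linearly growing
  moduli.\<close>

lemma std_normal_cdf_tail:
  assumes t: "0 < t" shows "t * std_normal_cdf (- t) \<le> 0.4"
proof -
  let ?N = std_normal_distribution
  have m: "(LINT x|?N. \<bar>x\<bar>) = sqrt (2 / pi)"
    using std_normal_distribution_odd_moments_abs(1)[of 0] by simp
  have int: "integrable ?N (\<lambda>x. \<bar>x\<bar>)"
    using integrable_abs[OF integrable_std_normal_distribution_moment[of 1]] by simp
  have "measure ?N {x\<in>space ?N. t \<le> \<bar>x\<bar>} \<le> (LINT x|?N. \<bar>x\<bar>) / t"
    by (rule integral_Markov_inequality_measure[where A = "{}"]) (use t int in auto)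
  moreover have "measure ?N {x\<in>space ?N. t \<le> \<bar>x\<bar>} = 2 * std_normal_cdf (- t)"
  proof -
    have "{x\<in>space ?N. t \<le> \<bar>x\<bar>} = {..- t} \<union> {t..}" by auto
    then have "measure ?N {x\<in>space ?N. t \<le> \<bar>x\<bar>} = measure ?N {..- t} + measure ?N {t..}"
      using t by (simp only:) (subst std_normal.finite_measure_Union, auto)
    moreover have "measure ?N {t..} = std_normal_cdf (- t)"
      using std_normal.normal_ge[OF distributed_std_normal, of t] by (simp add: atLeast_def)
    ultimately show ?thesis by (simp add: std_normal_cdf_eq)
  qed
  moreover have "sqrt (2 / pi) \<le> 0.8"
  proof -
    have "2 / pi \<le> 0.8\<^sup>2" using pi_approx(1) by (simp add: power2_eq_square field_simps)
    then show ?thesis by (intro real_le_lsqrt) auto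
  qed
  ultimately have "2 * std_normal_cdf (- t) \<le> 0.8 / t"
    using m t by (smt (verit) divide_right_mono)
  then show ?thesis using t by (simp add: field_simps)
qed

text \<open>\<open>inv\<close> yields a genuine preimage only for attained values, so attainment
  comes first, by the intermediate value theorem. The bound 0.5 uses \<alpha> < 0.3 and the estimate
  \<Phi>(0.5) \<le> 0.7; it later settles the constant 3^7.\<close>

lemma z_quantile:
  assumes "0 < \<alpha>" "\<alpha> < 0.3"
  shows "std_normal_cdf (z_quantile \<alpha>) = 1 - \<alpha>" "std_normal_cdf (- z_quantile \<alpha>) = \<alpha>"
    "0.5 < z_quantile \<alpha>"
proof -
  have top: "(std_normal_cdf \<longlongrightarrow> 1) at_top" and bot: "(std_normal_cdf \<longlongrightarrow> 0) at_bot"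
    unfolding std_normal_cdf_def by (rule std_normal.cdf_lim_at_top_prob std_normal.cdf_lim_at_bot)+
  have "eventually (\<lambda>x. 1 - \<alpha> < std_normal_cdf x) at_top"
    by (rule order_tendstoD(1)[OF top]) (use assms in simp)
  then obtain b where b: "1 - \<alpha> < std_normal_cdf b" by (metis eventually_at_top_linorder order_refl)
  have "eventually (\<lambda>x. std_normal_cdf x < 1 - \<alpha>) at_bot"
    by (rule order_tendstoD(2)[OF bot]) (use assms in simp)
  then obtain a where a: "std_normal_cdf a < 1 - \<alpha>" by (metis eventually_at_bot_linorder order_refl)
  have "a \<le> b" using a b std_normal_cdf_mono[of b a] by linarith
  then obtain x where "std_normal_cdf x = 1 - \<alpha>"
    using IVT'[of std_normal_cdf a "1 - \<alpha>" b] a b std_normal_cdf_cont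
    by (auto intro: continuous_on_subset)
  then show eq: "std_normal_cdf (z_quantile \<alpha>) = 1 - \<alpha>"
    unfolding z_quantile_def by (intro f_inv_into_f) (metis rangeI)
  then show "std_normal_cdf (- z_quantile \<alpha>) = \<alpha>" by (simp add: std_normal_cdf_minus)
  have "std_normal_cdf 0.5 \<le> 0.7"
    using std_normal_cdf_lipschitz[of 0 "0.5"] by (simp add: std_normal_cdf_0)
  then have "std_normal_cdf 0.5 < std_normal_cdf (z_quantile \<alpha>)" using eq assms by simp
  then show "0.5 < z_quantile \<alpha>" using std_normal_cdf_mono by (meson not_le)
qed

lemma std_normal_cdf_le_1: "std_normal_cdf x \<le> 1"
  by (simp add: std_normal_cdf_eq)

section \<open>The white noise model and its Gaussian increments\<close>

locale white_noise_model =
  fixes M :: "'a measure" and W :: "real \<Rightarrow> 'a \<Rightarrow> real" and \<epsilon> :: real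
  assumes BM: "standard_brownian_motion M W" and eps: "0 < \<epsilon>"
begin

sublocale prob_space M
  using BM by (simp add: standard_brownian_motion_def)

lemma W_measurable [measurable]: "t \<in> {0..1} \<Longrightarrow> W t \<in> borel_measurable M"
  using BM by (simp add: standard_brownian_motion_def)

lemma observation_measurable [measurable]: "observation W \<epsilon> f \<in> measurable M path_space"
  unfolding observation_def by (rule measurable_restrict) measurable

lemma weighted_increments_normal:
  fixes n :: nat and t c :: "nat \<Rightarrow> real"
  assumes t: "\<And>i. i \<le> n \<Longrightarrow> t i \<in> {0..1}" "\<And>i. i < n \<Longrightarrow> t i < t (Suc i)"
    and V: "V = (\<Sum>i<n. (c i)\<^sup>2 * (t (Suc i) - t i))" "0 < V"
  shows "distributed M lborel (\<lambda>\<omega>. \<Sum>i<n. c i * (W (t (Suc i)) \<omega> - W (t i) \<omega>)) (normal_density 0 (sqrt V))"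
proof -
  define D where "D = (\<lambda>i \<omega>. W (t (Suc i)) \<omega> - W (t i) \<omega>)"
  \<comment> \<open>Zero coefficients are dropped because \<open>sum_indep_normal\<close> asks for
    positive standard deviations.\<close>
  define I where "I = {i. i < n \<and> c i \<noteq> 0}"
  have I: "finite I" "I \<subseteq> {..<n}" by (auto simp: I_def)
  have Vsum: "V = (\<Sum>i\<in>I. (c i)\<^sup>2 * (t (Suc i) - t i))"
    unfolding V by (rule sum.mono_neutral_right) (auto simp: I_def)
  have "I \<noteq> {}" using Vsum V(2) by auto
  have "indep_vars (\<lambda>_. borel) D {..<n}"
    using BM t unfolding standard_brownian_motion_def D_def by blast
  then have "indep_vars (\<lambda>_. borel) (\<lambda>i \<omega>. c i * D i \<omega>) I"
    by (intro indep_vars_compose2[where Y = "\<lambda>i x. c i * x"] indep_vars_subset[OF _ I(2)]) auto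
  moreover have "distributed M lborel (\<lambda>\<omega>. c i * D i \<omega>) (normal_density 0 (\<bar>c i\<bar> * sqrt (t (Suc i) - t i)))"
    if "i \<in> I" for i
  proof -
    have i: "i < n" "c i \<noteq> 0" using that by (auto simp: I_def)
    have "distributed M lborel (D i) (normal_density 0 (sqrt (t (Suc i) - t i)))"
      using BM t(1)[of i] t(1)[of "Suc i"] t(2)[of i] i unfolding standard_brownian_motion_def D_def by auto
    from normal_density_affine[OF this _ i(2), of 0] t(2)[OF i(1)] show ?thesis by simp
  qed
  moreover have "0 < \<bar>c i\<bar> * sqrt (t (Suc i) - t i)" if "i \<in> I" for i
    using that t(2)[of i] by (auto simp: I_def)
  ultimately have "distributed M lborel (\<lambda>\<omega>. \<Sum>i\<in>I. c i * D i \<omega>)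
      (normal_density (\<Sum>i\<in>I. 0) (sqrt (\<Sum>i\<in>I. (\<bar>c i\<bar> * sqrt (t (Suc i) - t i))\<^sup>2)))"
    using I(1) \<open>I \<noteq> {}\<close> by (intro sum_indep_normal) auto
  moreover have "(\<Sum>i\<in>I. (\<bar>c i\<bar> * sqrt (t (Suc i) - t i))\<^sup>2) = V"
    unfolding Vsum using t(2) by (intro sum.cong) (auto simp: power_mult_distrib I_def less_imp_le)
  moreover have "(\<Sum>i\<in>I. c i * D i \<omega>) = (\<Sum>i<n. c i * D i \<omega>)" for \<omega>
    by (rule sum.mono_neutral_left) (auto simp: I_def)
  ultimately show ?thesis by (simp add: D_def)
qed

end

section \<open>Affinity of two shifted path laws\<close>

text \<open>The Neyman-Pearson lemma: the sum integrates \<open>p\<close> on the set and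
  \<open>q\<close> off it, and \<open>T\<close> picks the smaller of the two at every point.\<close>

lemma density_affinity_minimal:
  assumes [measurable]: "p \<in> borel_measurable N" "q \<in> borel_measurable N" "B \<in> sets N"
  defines "T \<equiv> {x\<in>space N. p x \<le> q x}"
  shows "emeasure (density N p) T + emeasure (density N q) (space N - T)
    \<le> emeasure (density N p) B + emeasure (density N q) (space N - B)"
proof -
  have [measurable]: "T \<in> sets N" unfolding T_def by measurable
  have e: "emeasure (density N p) A + emeasure (density N q) (space N - A)
      = (\<integral>\<^sup>+ x. p x * indicator A x + q x * indicator (space N - A) x \<partial>N)" if [measurable]: "A \<in> sets N" for A
    by (simp add: emeasure_density nn_integral_add)
  have "(\<integral>\<^sup>+ x. p x * indicator T x + q x * indicator (space N - T) x \<partial>N)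
      \<le> (\<integral>\<^sup>+ x. p x * indicator B x + q x * indicator (space N - B) x \<partial>N)"
    by (rule nn_integral_mono) (auto simp: T_def indicator_def)
  then show ?thesis by (simp add: e)
qed

text \<open>Makes the likelihood of a vector of independent increments explicit. It suffices to
  check boxes, where the integral factorises.\<close>

lemma PiM_density_lborel:
  fixes d :: "'i \<Rightarrow> real \<Rightarrow> ennreal"
  assumes I: "finite I" and d[measurable]: "\<And>i. d i \<in> borel_measurable borel"
    and p: "\<And>i. prob_space (density lborel (d i))"
  shows "PiM I (\<lambda>i. density lborel (d i)) = density (PiM I (\<lambda>_. lborel)) (\<lambda>x. \<Prod>i\<in>I. d i (x i))"
proof -
  interpret L: product_sigma_finite "\<lambda>_::'i. lborel :: real measure"
    by standard
  interpret D: product_sigma_finite "\<lambda>i. density lborel (d i)"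
    using p by (auto simp: product_sigma_finite_def intro!: finite_measure.sigma_finite_measure prob_space.axioms(1))
  have "density (PiM I (\<lambda>_. lborel)) (\<lambda>x. \<Prod>i\<in>I. d i (x i)) = PiM I (\<lambda>i. density lborel (d i))"
  proof (rule D.PiM_eqI[OF I])
    show "sets (density (PiM I (\<lambda>_. lborel)) (\<lambda>x. \<Prod>i\<in>I. d i (x i))) = sets (PiM I (\<lambda>i. density lborel (d i)))"
      by (simp cong: sets_PiM_cong)
    fix A assume "\<And>i. i \<in> I \<Longrightarrow> A i \<in> sets (density lborel (d i))"
    then have A[measurable]: "\<And>i. i \<in> I \<Longrightarrow> A i \<in> sets borel" by simp
    have "emeasure (density (PiM I (\<lambda>_. lborel)) (\<lambda>x. \<Prod>i\<in>I. d i (x i))) (Pi\<^sub>E I A)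
        = (\<integral>\<^sup>+ x. (\<Prod>i\<in>I. d i (x i)) * indicator (Pi\<^sub>E I A) x \<partial>PiM I (\<lambda>_. lborel))"
      using I by (intro emeasure_density) (auto intro!: sets_PiM_I_finite)
    also have "\<dots> = (\<integral>\<^sup>+ x. (\<Prod>i\<in>I. d i (x i) * indicator (A i) (x i)) \<partial>PiM I (\<lambda>_. lborel))"
    proof (rule nn_integral_cong)
      fix x assume "x \<in> space (PiM I (\<lambda>_. lborel :: real measure))"
      then have "indicator (Pi\<^sub>E I A) x = (\<Prod>i\<in>I. indicator (A i) (x i) :: ennreal)"
        using I by (auto simp: indicator_def space_PiM PiE_iff prod_zero_iff)
      then show "(\<Prod>i\<in>I. d i (x i)) * indicator (Pi\<^sub>E I A) x = (\<Prod>i\<in>I. d i (x i) * indicator (A i) (x i))"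
        by (simp add: prod.distrib)
    qed
    also have "\<dots> = (\<Prod>i\<in>I. \<integral>\<^sup>+ x. d i x * indicator (A i) x \<partial>lborel)"
      using I by (intro L.product_nn_integral_prod) auto
    also have "\<dots> = (\<Prod>i\<in>I. emeasure (density lborel (d i)) (A i))"
      by (intro prod.cong) (auto simp: emeasure_density)
    finally show "emeasure (density (PiM I (\<lambda>_. lborel)) (\<lambda>x. \<Prod>i\<in>I. d i (x i))) (Pi\<^sub>E I A)
        = (\<Prod>i\<in>I. emeasure (density lborel (d i)) (A i))" .
  qed
  then show ?thesis by simp
qed

text \<open>With equal variances the normalising constants cancel, so comparing likelihoods means
  comparing weighted squared distances to the two means.\<close>

lemma prod_normal_density_le_iff:
  fixes n :: nat and a b v :: "nat \<Rightarrow> real"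
  assumes s: "\<And>i. i < n \<Longrightarrow> 0 < \<sigma> i"
  shows "(\<Prod>i<n. ennreal (normal_density (a i) (\<sigma> i) (v i))) \<le> (\<Prod>i<n. ennreal (normal_density (b i) (\<sigma> i) (v i)))
    \<longleftrightarrow> (\<Sum>i<n. (v i - b i)\<^sup>2 / (\<sigma> i)\<^sup>2) \<le> (\<Sum>i<n. (v i - a i)\<^sup>2 / (\<sigma> i)\<^sup>2)"
proof -
  define C where "C = (\<Prod>i<n. 1 / sqrt (2 * pi * (\<sigma> i)\<^sup>2))"
  have C: "C > 0" unfolding C_def using s by (intro prod_pos) (auto intro!: mult_pos_pos dest: s)
  have e: "(\<Prod>i<n. ennreal (normal_density (a i) (\<sigma> i) (v i)))
      = ennreal (C * exp (- (\<Sum>i<n. (v i - a i)\<^sup>2 / (\<sigma> i)\<^sup>2) / 2))" for a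
  proof -
    have "- (\<Sum>i<n. (v i - a i)\<^sup>2 / (\<sigma> i)\<^sup>2) / 2 = (\<Sum>i<n. - (v i - a i)\<^sup>2 / (2 * (\<sigma> i)\<^sup>2))"
      by (simp add: sum_divide_distrib sum_negf mult.commute)
    moreover have "(\<Prod>i<n. normal_density (a i) (\<sigma> i) (v i))
        = C * exp (\<Sum>i<n. - (v i - a i)\<^sup>2 / (2 * (\<sigma> i)\<^sup>2))"
      unfolding normal_density_def prod.distrib C_def by (simp only: exp_sum[OF finite_lessThan])
    ultimately show ?thesis by (subst prod_ennreal) simp_all
  qed
  show ?thesis unfolding e using C by (subst ennreal_le_iff) auto
qed

section \<open>The Neyman-Pearson bound for finitely many increments\<close>

context white_noise_model
begin

text \<open>The optimal set compares the two likelihoods, and this comparison is a threshold for one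
  linear statistic \<open>G\<close> of standard deviation \<open>x\<close>. The threshold is x^2 / 2
  under \<open>a\<close> and - x^2 / 2 under \<open>b\<close>, so either error equals \<Phi>(-x /
  2).\<close>

lemma increments_affinity:
  fixes n :: nat and t a b :: "nat \<Rightarrow> real"
  assumes t: "\<And>i. i \<le> n \<Longrightarrow> t i \<in> {0..1}" "\<And>i. i < n \<Longrightarrow> t i < t (Suc i)"
    and B: "B \<in> sets (PiM {..<n} (\<lambda>_. borel))"
    and x: "0 \<le> x" "x\<^sup>2 = (\<Sum>i<n. (b i - a i)\<^sup>2 / (\<epsilon>\<^sup>2 * (t (Suc i) - t i)))"
  defines "Y \<equiv> \<lambda>a \<omega>. \<lambda>i\<in>{..<n}. a i + \<epsilon> * (W (t (Suc i)) \<omega> - W (t i) \<omega>)"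
  shows "2 * std_normal_cdf (- x / 2) \<le> measure M {\<omega>\<in>space M. Y a \<omega> \<in> B} + measure M {\<omega>\<in>space M. Y b \<omega> \<notin> B}"
proof -
  define D where "D = (\<lambda>i \<omega>. W (t (Suc i)) \<omega> - W (t i) \<omega>)"
  define \<sigma> where "\<sigma> = (\<lambda>i. \<epsilon> * sqrt (t (Suc i) - t i))"
  have \<sigma>: "0 < \<sigma> i" "(\<sigma> i)\<^sup>2 = \<epsilon>\<^sup>2 * (t (Suc i) - t i)" if "i < n" for i
    using t(2)[OF that] eps by (auto simp: \<sigma>_def power_mult_distrib)
  let ?P = "PiM {..<n} (\<lambda>_. borel :: real measure)"
  have Dm[measurable]: "D i \<in> borel_measurable M" if "i < n" for i
    unfolding D_def using t(1)[of i] t(1)[of "Suc i"] that by (intro borel_measurable_diff W_measurable) auto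
  have Ym[measurable]: "Y a \<in> measurable M ?P" for a
    unfolding Y_def D_def[symmetric, THEN fun_cong, THEN fun_cong] by (intro measurable_restrict) auto
  have BY[measurable]: "{\<omega>\<in>space M. Y a \<omega> \<in> A} \<in> events" if "A \<in> sets ?P" for a A
    using measurable_sets[OF Ym that] by (auto simp: vimage_def Int_def conj_commute)
  have compl: "measure M {\<omega>\<in>space M. Y b \<omega> \<notin> A} = 1 - measure M {\<omega>\<in>space M. Y b \<omega> \<in> A}"
    if "A \<in> sets ?P" for A
    by (rule prob_neg) (rule BY[OF that])
  show ?thesis
  proof (cases "x = 0")
    \<comment> \<open>Here \<open>G\<close> would be degenerate and have no normal density. The two
      laws coincide instead, and the bound is 2 \<Phi>(0) = 1.\<close>
    case True
    have "(b i - a i)\<^sup>2 / (\<epsilon>\<^sup>2 * (t (Suc i) - t i)) = 0" if "i < n" for i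
      using x(2) True that t(2) by (subst (asm) eq_commute, simp) (subst (asm) sum_nonneg_eq_0_iff, auto intro!: divide_nonneg_nonneg mult_nonneg_nonneg simp: less_imp_le)
    then have "b i = a i" if "i < n" for i using that t(2)[OF that] eps by fastforce
    then have "Y b = Y a" unfolding Y_def by (intro ext restrict_ext) auto
    then show ?thesis using True compl[OF B] by (simp add: std_normal_cdf_0)
  next
    case False
    then have x0: "0 < x" using x by simp
    then have "0 < (\<Sum>i<n. (b i - a i)\<^sup>2 / (\<epsilon>\<^sup>2 * (t (Suc i) - t i)))" using x(2) by (metis zero_less_power)
    then have n: "{..<n} \<noteq> {}" by auto
    have law: "distr M ?P (Y a) = PiM {..<n} (\<lambda>i. density lborel (normal_density (a i) (\<sigma> i)))" for a
    proof -
      have ind: "indep_vars (\<lambda>_. borel) D {..<n}"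
        using BM t unfolding standard_brownian_motion_def D_def by blast
      have "indep_vars (\<lambda>_. borel) (\<lambda>i \<omega>. a i + \<epsilon> * D i \<omega>) {..<n}"
        by (rule indep_vars_compose2[OF ind, where Y = "\<lambda>i x. a i + \<epsilon> * x"]) simp
      then have "distr M ?P (Y a) = PiM {..<n} (\<lambda>i. distr M borel (\<lambda>\<omega>. a i + \<epsilon> * D i \<omega>))"
        unfolding Y_def D_def using n
        by (subst (asm) indep_vars_iff_distr_eq_PiM') (auto simp: D_def[symmetric, THEN fun_cong, THEN fun_cong])
      also have "\<dots> = PiM {..<n} (\<lambda>i. density lborel (normal_density (a i) (\<sigma> i)))"
      proof (rule PiM_cong)
        fix i assume "i \<in> {..<n}"
        then have i: "i < n" by simp
        have "distributed M lborel (D i) (normal_density 0 (sqrt (t (Suc i) - t i)))"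
          using BM t(1)[of i] t(1)[of "Suc i"] t(2)[of i] i unfolding standard_brownian_motion_def D_def by auto
        from normal_density_affine[OF this, of \<epsilon> "a i"] t(2)[OF i] eps
        have "distributed M lborel (\<lambda>\<omega>. a i + \<epsilon> * D i \<omega>) (normal_density (a i) (\<sigma> i))"
          by (simp add: \<sigma>_def)
        then have "distr M lborel (\<lambda>\<omega>. a i + \<epsilon> * D i \<omega>) = density lborel (normal_density (a i) (\<sigma> i))"
          by (simp add: distributed_def)
        then show "distr M borel (\<lambda>\<omega>. a i + \<epsilon> * D i \<omega>) = density lborel (normal_density (a i) (\<sigma> i))"
          by (simp cong: distr_cong)
      qed simp
      finally show ?thesis .
    qed
    let ?L = "PiM {..<n} (\<lambda>_. lborel :: real measure)"
    define p where "p = (\<lambda>a v. \<Prod>i<n. ennreal (normal_density (a i) (\<sigma> i) (v i)))"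
    have pm[measurable]: "p a \<in> borel_measurable ?L" for a
      unfolding p_def by measurable
    \<comment> \<open>\<open>PiM_density_lborel\<close> wants a probability density at every index,
      so \<open>\<sigma>\<close> is continued by 1 outside the index set.\<close>
    define \<tau> where "\<tau> = (\<lambda>i. if i < n then \<sigma> i else 1)"
    have \<tau>: "0 < \<tau> i" for i using \<sigma> by (simp add: \<tau>_def)
    have law': "distr M ?P (Y a) = density ?L (p a)" for a
    proof -
      have "PiM {..<n} (\<lambda>i. density lborel (normal_density (a i) (\<sigma> i)))
          = PiM {..<n} (\<lambda>i. density lborel (normal_density (a i) (\<tau> i)))"
        by (rule PiM_cong) (auto simp: \<tau>_def)
      also have "\<dots> = density ?L (\<lambda>v. \<Prod>i<n. ennreal (normal_density (a i) (\<tau> i) (v i)))"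
        by (rule PiM_density_lborel) (auto intro!: prob_space_normal_density \<tau>)
      also have "\<dots> = density ?L (p a)"
        unfolding p_def by (intro arg_cong[where f = "density ?L"] ext prod.cong) (auto simp: \<tau>_def)
      finally show ?thesis using law by simp
    qed
    have sets_eq: "sets ?L = sets ?P" by (rule sets_PiM_cong) auto
    have em: "emeasure (density ?L (p a)) A = measure M {\<omega>\<in>space M. Y a \<omega> \<in> A}" if "A \<in> sets ?P" for a A
    proof -
      have "emeasure (density ?L (p a)) A = emeasure M (Y a -` A \<inter> space M)"
        unfolding law'[symmetric] by (rule emeasure_distr[OF Ym that])
      also have "Y a -` A \<inter> space M = {\<omega>\<in>space M. Y a \<omega> \<in> A}" by auto
      finally show ?thesis by (simp add: emeasure_eq_measure)
    qed
    define T where "T = {v\<in>space ?L. p a v \<le> p b v}"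
    have T: "T \<in> sets ?P" unfolding T_def sets_eq[symmetric] by measurable
    have Yspace: "Y a \<omega> \<in> space ?L" for a \<omega> by (simp add: Y_def space_PiM)
    have inB: "{\<omega>\<in>space M. Y b \<omega> \<in> space ?L - A} = {\<omega>\<in>space M. Y b \<omega> \<notin> A}" for A
      using Yspace by auto
    have sp: "space ?L - A \<in> sets ?P" if "A \<in> sets ?P" for A
      using that sets.compl_sets[of A ?L] sets_eq by simp
    have key: "measure M {\<omega>\<in>space M. Y a \<omega> \<in> T} + measure M {\<omega>\<in>space M. Y b \<omega> \<notin> T}
        \<le> measure M {\<omega>\<in>space M. Y a \<omega> \<in> B} + measure M {\<omega>\<in>space M. Y b \<omega> \<notin> B}"
      using density_affinity_minimal[OF pm pm, of B a b] B sets_eq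
      unfolding T_def[symmetric]
      by (simp add: em T sp inB Yspace flip: ennreal_plus)
    \<comment> \<open>The coefficients of the linear part of the log-likelihood ratio; with them the
      variance of \<open>G\<close> is exactly x^2.\<close>
    define c where "c = (\<lambda>i. (b i - a i) / (\<epsilon> * (t (Suc i) - t i)))"
    define G where "G = (\<lambda>\<omega>. \<Sum>i<n. c i * D i \<omega>)"
    have G: "distributed M lborel G (normal_density 0 (sqrt (x\<^sup>2)))"
      unfolding G_def D_def
    proof (rule weighted_increments_normal[where t = t and n = n and c = c])
      show "x\<^sup>2 = (\<Sum>i<n. (c i)\<^sup>2 * (t (Suc i) - t i))"
        unfolding x(2) using t(2) eps
        by (intro sum.cong) (auto simp: c_def power_divide power_mult_distrib power2_eq_square)
      show "0 < x\<^sup>2" using x0 by simp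
    qed (use t in auto)
    have Gm[measurable]: "G \<in> borel_measurable M" using G by (simp add: distributed_def)
    \<comment> \<open>One expansion serves both laws: \<open>k = -1\<close> when the mean is
      \<open>a\<close>, \<open>k = 1\<close> when it is \<open>b\<close>.\<close>
    have cross: "(\<Sum>i<n. (\<epsilon> * D i \<omega> + k * (b i - a i))\<^sup>2 / (\<sigma> i)\<^sup>2)
        = (\<Sum>i<n. (\<epsilon> * D i \<omega>)\<^sup>2 / (\<sigma> i)\<^sup>2) + 2 * k * G \<omega> + k\<^sup>2 * x\<^sup>2" for \<omega> k
    proof -
      have "(\<epsilon> * D i \<omega> + k * (b i - a i))\<^sup>2 / (\<sigma> i)\<^sup>2
          = (\<epsilon> * D i \<omega>)\<^sup>2 / (\<sigma> i)\<^sup>2 + 2 * k * (c i * D i \<omega>)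
            + k\<^sup>2 * ((b i - a i)\<^sup>2 / (\<epsilon>\<^sup>2 * (t (Suc i) - t i)))" if "i < n" for i
      proof -
        define w where "w = t (Suc i) - t i"
        have w: "0 < w" "(\<sigma> i)\<^sup>2 = \<epsilon>\<^sup>2 * w" "c i = (b i - a i) / (\<epsilon> * w)"
          using t(2)[OF that] \<sigma>(2)[OF that] by (auto simp: w_def c_def)
        show ?thesis
          unfolding w_def[symmetric] w(2,3) using w(1) eps
          by (simp add: field_simps power2_eq_square)
      qed
      then show ?thesis
        unfolding G_def x(2) sum_distrib_left by (simp add: sum.distrib)
    qed
    have Ya: "Y a \<omega> \<in> T \<longleftrightarrow> x\<^sup>2 / 2 \<le> G \<omega>" for \<omega>
    proof -
      have "Y a \<omega> \<in> T \<longleftrightarrow> (\<Sum>i<n. (Y a \<omega> i - b i)\<^sup>2 / (\<sigma> i)\<^sup>2) \<le> (\<Sum>i<n. (Y a \<omega> i - a i)\<^sup>2 / (\<sigma> i)\<^sup>2)"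
        using Yspace[of a \<omega>] prod_normal_density_le_iff[of n \<sigma> a "Y a \<omega>" b] \<sigma>(1) by (simp add: T_def p_def)
      also have "(\<Sum>i<n. (Y a \<omega> i - b i)\<^sup>2 / (\<sigma> i)\<^sup>2) = (\<Sum>i<n. (\<epsilon> * D i \<omega> + (-1) * (b i - a i))\<^sup>2 / (\<sigma> i)\<^sup>2)"
        by (intro sum.cong) (auto simp: Y_def D_def algebra_simps)
      also have "\<dots> = (\<Sum>i<n. (\<epsilon> * D i \<omega>)\<^sup>2 / (\<sigma> i)\<^sup>2) + 2 * (-1) * G \<omega> + (-1)\<^sup>2 * x\<^sup>2"
        by (rule cross)
      also have "(\<Sum>i<n. (Y a \<omega> i - a i)\<^sup>2 / (\<sigma> i)\<^sup>2) = (\<Sum>i<n. (\<epsilon> * D i \<omega>)\<^sup>2 / (\<sigma> i)\<^sup>2)"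
        by (intro sum.cong) (auto simp: Y_def D_def)
      finally show ?thesis by auto
    qed
    have Yb: "Y b \<omega> \<in> T \<longleftrightarrow> - (x\<^sup>2 / 2) \<le> G \<omega>" for \<omega>
    proof -
      have "Y b \<omega> \<in> T \<longleftrightarrow> (\<Sum>i<n. (Y b \<omega> i - b i)\<^sup>2 / (\<sigma> i)\<^sup>2) \<le> (\<Sum>i<n. (Y b \<omega> i - a i)\<^sup>2 / (\<sigma> i)\<^sup>2)"
        using Yspace[of b \<omega>] prod_normal_density_le_iff[of n \<sigma> a "Y b \<omega>" b] \<sigma>(1) by (simp add: T_def p_def)
      also have "(\<Sum>i<n. (Y b \<omega> i - a i)\<^sup>2 / (\<sigma> i)\<^sup>2) = (\<Sum>i<n. (\<epsilon> * D i \<omega> + 1 * (b i - a i))\<^sup>2 / (\<sigma> i)\<^sup>2)"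
        by (intro sum.cong) (auto simp: Y_def D_def algebra_simps)
      also have "\<dots> = (\<Sum>i<n. (\<epsilon> * D i \<omega>)\<^sup>2 / (\<sigma> i)\<^sup>2) + 2 * 1 * G \<omega> + 1\<^sup>2 * x\<^sup>2"
        by (rule cross)
      also have "(\<Sum>i<n. (Y b \<omega> i - b i)\<^sup>2 / (\<sigma> i)\<^sup>2) = (\<Sum>i<n. (\<epsilon> * D i \<omega>)\<^sup>2 / (\<sigma> i)\<^sup>2)"
        by (intro sum.cong) (auto simp: Y_def D_def)
      finally show ?thesis by auto
    qed
    have sx: "sqrt (x\<^sup>2) = x" "0 < sqrt (x\<^sup>2)" using x0 by auto
    have "measure M {\<omega>\<in>space M. Y a \<omega> \<in> T} = std_normal_cdf (- x / 2)"
      using normal_ge[OF G sx(2), of "x\<^sup>2 / 2"] x0 by (simp add: Ya sx(1) power2_eq_square)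
    moreover have "measure M {\<omega>\<in>space M. Y b \<omega> \<in> T} = std_normal_cdf (x / 2)"
      using normal_ge[OF G sx(2), of "- (x\<^sup>2 / 2)"] x0 by (simp add: Yb sx(1) power2_eq_square)
    moreover have "measure M {\<omega>\<in>space M. Y b \<omega> \<notin> T} = std_normal_cdf (- x / 2)"
      unfolding compl[OF T] using std_normal_cdf_minus[of "x / 2"] calculation(2) by simp
    ultimately show ?thesis using key by simp
  qed
qed

end

text \<open>Expand the nonnegative integral of (h - c)^2 with \<open>c\<close> the mean of
  \<open>h\<close>. Applied cell by cell, this shows that finitely many increments see no more than
  the full distance of the drifts.\<close>

lemma tame_cauchy_schwarz:
  assumes h: "tame h" and ab: "0 \<le> a" "a < b" "b \<le> 1"
  shows "(integral {a..b} h)\<^sup>2 / (b - a) \<le> integral {a..b} (\<lambda>t. (h t)\<^sup>2)"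
proof -
  define I J c where "I = integral {a..b} h" and "J = integral {a..b} (\<lambda>t. (h t)\<^sup>2)" and "c = I / (b - a)"
  have i: "h integrable_on {a..b}" "(\<lambda>t. (h t)\<^sup>2) integrable_on {a..b}"
    using ab by (auto intro!: tame_integrable tame_power2 h)
  have "0 * (b - a) \<le> integral {a..b} (\<lambda>t. (h t - c)\<^sup>2)"
    by (rule tame_integral_ge) (use ab in \<open>auto intro!: tame_power2 tame_diff tame_const h\<close>)
  also have "(\<lambda>t. (h t - c)\<^sup>2) = (\<lambda>t. (h t)\<^sup>2 - 2 * c * h t + c\<^sup>2)"
    by (auto simp: power2_diff)
  also have "integral {a..b} \<dots> = J - 2 * c * I + c\<^sup>2 * (b - a)"
  proof (rule integral_unique)
    have "(h has_integral I) {a..b}" "((\<lambda>t. (h t)\<^sup>2) has_integral J) {a..b}"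
      using i by (auto simp: I_def J_def)
    moreover have "((\<lambda>_. c\<^sup>2) has_integral c\<^sup>2 * (b - a)) {a..b}"
      using has_integral_const_real[of "c\<^sup>2" a b] ab by (simp add: mult.commute)
    ultimately show "((\<lambda>t. (h t)\<^sup>2 - 2 * c * h t + c\<^sup>2) has_integral J - 2 * c * I + c\<^sup>2 * (b - a)) {a..b}"
      by (intro has_integral_add has_integral_diff has_integral_mult_right)
  qed
  also have "\<dots> = J - I\<^sup>2 / (b - a)"
  proof -
    have "c * I = I\<^sup>2 / (b - a)" "c\<^sup>2 * (b - a) = I\<^sup>2 / (b - a)"
      using ab by (simp_all add: c_def power2_eq_square)
    then show ?thesis by simp
  qed
  finally show ?thesis by (simp add: I_def J_def)
qed

lemma sum_integral_cells:
  fixes t :: "nat \<Rightarrow> real"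
  assumes v: "tame v" and t: "\<And>i. i \<le> n \<Longrightarrow> t i \<in> {0..1}" "\<And>i. i < n \<Longrightarrow> t i < t (Suc i)" and k: "k \<le> n"
  shows "(\<Sum>i<k. integral {t i..t (Suc i)} v) = integral {t 0..t k} v"
  using k
proof (induction k)
  case (Suc k)
  have "t 0 \<le> t k" using Suc.prems
  proof (induction k)
    case (Suc j)
    then show ?case using t(2)[of j] by simp
  qed simp
  then show ?case
    using Suc t(1)[of 0] t(1)[of "Suc k"] t(2)[of k] tame_integral_split[OF v, of "t 0" "t k" "t (Suc k)"]
    by auto
qed simp

text \<open>The sets that can be approximated form a sigma-algebra. The point is that one set
  \<open>B\<close> serves both measures, since it has to replace \<open>A\<close> under both path
  laws at once.\<close>

lemma algebra_approximation:
  assumes N: "finite_measure N1" "finite_measure N2" and alg: "algebra \<Omega> \<A>"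
    and sets: "sets N1 = sigma_sets \<Omega> \<A>" "sets N2 = sigma_sets \<Omega> \<A>"
    and A: "A \<in> sigma_sets \<Omega> \<A>" and e: "0 < e"
  shows "\<exists>B\<in>\<A>. measure N1 (sym_diff A B) < e \<and> measure N2 (sym_diff A B) < e"
  using A e
proof (induction arbitrary: e rule: sigma_sets.induct)
  case (Basic a)
  then show ?case by (intro bexI[of _ a]) auto
next
  case Empty
  interpret algebra \<Omega> \<A> by fact
  show ?case using Empty by (intro bexI[of _ "{}"]) auto
next
  case (Compl a)
  interpret algebra \<Omega> \<A> by fact
  obtain B where B: "B \<in> \<A>" "measure N1 (sym_diff a B) < e" "measure N2 (sym_diff a B) < e"
    using Compl.IH[OF Compl.prems] by blast
  have "a \<subseteq> \<Omega>" "B \<subseteq> \<Omega>"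
    using sigma_sets_into_sp[OF space_closed Compl.hyps] B(1) sets_into_space by auto
  then have "sym_diff (\<Omega> - a) (\<Omega> - B) = sym_diff a B" by blast
  then show ?case using B by (intro bexI[of _ "\<Omega> - B"]) auto
next
  case (Union a)
  interpret algebra \<Omega> \<A> by fact
  have tail: "\<exists>n0. \<forall>n\<ge>n0. measure N ((\<Union>i. a i) - (\<Union>i<n. a i)) < e / 2"
    if fin: "finite_measure N" and N: "sets N = sigma_sets \<Omega> \<A>" for N
  proof -
    interpret finite_measure N by (rule fin)
    have m: "a i \<in> sets N" for i using Union.hyps N by simp
    have "(\<lambda>n. measure N (\<Union>i<n. a i)) \<longlonglongrightarrow> measure N (\<Union>n. \<Union>i<n. a i)"
      by (rule finite_Lim_measure_incseq) (use m in \<open>auto simp: incseq_def intro: less_le_trans\<close>)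
    also have "(\<Union>n. \<Union>i<n. a i) = (\<Union>i. a i)" by blast
    finally have "eventually (\<lambda>n. measure N (\<Union>i. a i) - e / 2 < measure N (\<Union>i<n. a i)) sequentially"
      using Union.prems by (intro order_tendstoD(1)) auto
    then obtain n0 where "\<And>n. n \<ge> n0 \<Longrightarrow> measure N (\<Union>i. a i) - e / 2 < measure N (\<Union>i<n. a i)"
      by (auto simp: eventually_sequentially)
    moreover have "measure N ((\<Union>i. a i) - (\<Union>i<n. a i)) = measure N (\<Union>i. a i) - measure N (\<Union>i<n. a i)" for n
      by (rule finite_measure_Diff) (use m in auto)
    ultimately show ?thesis by fastforce
  qed
  obtain n where n: "measure N1 ((\<Union>i. a i) - (\<Union>i<n. a i)) < e / 2"
      "measure N2 ((\<Union>i. a i) - (\<Union>i<n. a i)) < e / 2"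
    using tail[OF N(1) sets(1)] tail[OF N(2) sets(2)] by (meson nle_le)
  \<comment> \<open>Half of \<open>e\<close> pays for the sets beyond \<open>n\<close>; the other
    half is shared by the first \<open>n\<close> approximations, with \<open>n + 1\<close> in the
    denominator to allow \<open>n = 0\<close>.\<close>
  define d where "d = e / (2 * (real n + 1))"
  have d: "0 < d" "real n * d \<le> e / 2" using Union.prems by (auto simp: d_def field_simps)
  have "\<forall>i. \<exists>B\<in>\<A>. measure N1 (sym_diff (a i) B) < d \<and> measure N2 (sym_diff (a i) B) < d"
    using Union.IH d by blast
  then obtain B where B: "\<And>i. B i \<in> \<A>" "\<And>i. measure N1 (sym_diff (a i) (B i)) < d"
      "\<And>i. measure N2 (sym_diff (a i) (B i)) < d"
    by metis
  have bound: "measure N (sym_diff (\<Union>i. a i) (\<Union>i<n. B i)) < e"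
    if fin: "finite_measure N" and N: "sets N = sigma_sets \<Omega> \<A>"
      and t: "measure N ((\<Union>i. a i) - (\<Union>i<n. a i)) < e / 2"
      and s: "\<And>i. measure N (sym_diff (a i) (B i)) < d" for N
  proof -
    interpret finite_measure N by (rule fin)
    have m: "a i \<in> sets N" "B i \<in> sets N" for i using Union.hyps B(1) N by auto
    have "measure N (sym_diff (\<Union>i. a i) (\<Union>i<n. B i))
        \<le> measure N (((\<Union>i. a i) - (\<Union>i<n. a i)) \<union> (\<Union>i<n. sym_diff (a i) (B i)))"
      by (rule finite_measure_mono) (use m in \<open>auto\<close>)
    also have "\<dots> \<le> measure N ((\<Union>i. a i) - (\<Union>i<n. a i)) + measure N (\<Union>i<n. sym_diff (a i) (B i))"
      by (rule measure_subadditive) (use m in auto)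
    also have "measure N (\<Union>i<n. sym_diff (a i) (B i)) \<le> (\<Sum>i<n. measure N (sym_diff (a i) (B i)))"
      by (rule measure_subadditive_finite) (use m in auto)
    also have "\<dots> \<le> (\<Sum>i<n. d)" by (intro sum_mono less_imp_le s)
    finally show ?thesis using t d by simp
  qed
  show ?case
    using bound[OF N(1) sets(1) n(1) B(2)] bound[OF N(2) sets(2) n(2) B(3)] B(1)
    by (intro bexI[of _ "\<Union>i<n. B i"] conjI finite_UN) auto
qed

section \<open>From cylinder sets to all measurable sets of paths\<close>

context white_noise_model
begin

abbreviation law :: "(real \<Rightarrow> real) \<Rightarrow> (real \<Rightarrow> real) measure" where
  "law \<equiv> white_noise M W \<epsilon>"

lemma prob_space_law: "prob_space (law f)"
  unfolding white_noise_def by (rule prob_space_distr) measurable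

lemma sets_law [measurable_cong, simp]: "sets (law f) = sets path_space"
  by (simp add: white_noise_def)

lemma space_law [simp]: "space (law f) = space path_space"
  by (simp add: white_noise_def)

lemma measure_law:
  "A \<in> sets path_space \<Longrightarrow> measure (law f) A = measure M {\<omega>\<in>space M. observation W \<epsilon> f \<omega> \<in> A}"
  unfolding white_noise_def
  by (subst measure_distr) (auto simp: vimage_def Int_def conj_commute)

lemma observation_increment:
  assumes f: "tame f" and st: "0 \<le> s" "s \<le> t" "t \<le> 1"
  shows "observation W \<epsilon> f \<omega> t - observation W \<epsilon> f \<omega> s = integral {s..t} f + \<epsilon> * (W t \<omega> - W s \<omega>)"
  using tame_integral_split[OF f, of 0 s t] st by (simp add: observation_def algebra_simps)

lemma cylinder_affinity:
  assumes f: "tame f" and g: "tame g" and d: "0 \<le> d" "sq_dist f g \<le> d\<^sup>2"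
    and J: "finite J" "J \<subseteq> {0..1}" and X: "X \<in> sets (PiM J (\<lambda>_. borel))"
  defines "A \<equiv> prod_emb {0..1} (\<lambda>_. borel) J X"
  shows "2 * std_normal_cdf (- d / (2 * \<epsilon>)) \<le> measure (law f) A + measure (law g) (space path_space - A)"
proof -
  \<comment> \<open>The point 0 is added as a base, so that the value of the path at each point of
    \<open>J\<close> is a sum of increments.\<close>
  define L where "L = sorted_list_of_set (insert 0 J)"
  define n where "n = length L - 1"
  define t where "t = (\<lambda>i. L ! i)"
  have setL: "set L = insert 0 J" and dL: "sorted_wrt (<) L"
    unfolding L_def using J by (auto simp del: sorted_list_of_set_insert_remove)
  have len: "length L = Suc n"
    using setL by (cases L) (auto simp: n_def)
  have t01: "t i \<in> {0..1}" if "i \<le> n" for i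
    using nth_mem[of i L] that len setL J(2) by (auto simp: t_def)
  have tmono: "t i < t (Suc i)" if "i < n" for i
    using dL that len by (auto simp: t_def sorted_wrt_iff_nth_less)
  have t0: "t 0 = 0"
  proof -
    obtain i where i: "i \<le> n" "t i = 0" using setL len by (metis in_set_conv_nth insertI1 less_Suc_eq_le t_def)
    show ?thesis
    proof (cases "i = 0")
      case False
      then have "t 0 < t i" using dL i(1) len by (auto simp: t_def sorted_wrt_iff_nth_less)
      then show ?thesis using t01[of 0] i by auto
    qed (use i in simp)
  qed
  obtain idx where idx: "\<And>s. s \<in> J \<Longrightarrow> idx s \<le> n \<and> t (idx s) = s"
  proof -
    have "\<forall>s\<in>J. \<exists>k. k \<le> n \<and> t k = s"
      using setL len by (metis in_set_conv_nth insertI2 less_Suc_eq_le t_def)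
    then show ?thesis using that by metis
  qed
  define D where "D = (\<lambda>(h :: real \<Rightarrow> real) i. integral {t i..t (Suc i)} h)"
  define Y where "Y = (\<lambda>a \<omega>. \<lambda>i\<in>{..<n}. a i + \<epsilon> * (W (t (Suc i)) \<omega> - W (t i) \<omega>))"
  \<comment> \<open>Partial sums recover the coordinates in \<open>J\<close> from the increments, so
    the cylinder becomes an event \<open>B\<close> about increments.\<close>
  define \<psi> where "\<psi> = (\<lambda>v :: nat \<Rightarrow> real. \<lambda>s\<in>J. \<Sum>i<idx s. v i)"
  let ?P = "PiM {..<n} (\<lambda>_. borel :: real measure)"
  have \<psi>: "\<psi> \<in> measurable ?P (PiM J (\<lambda>_. borel))"
    unfolding \<psi>_def
  proof (rule measurable_restrict)
    fix s assume "s \<in> J"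
    then show "(\<lambda>v. \<Sum>i<idx s. v i) \<in> borel_measurable ?P"
      using idx[of s] by (intro borel_measurable_sum measurable_component_singleton) auto
  qed
  define B where "B = \<psi> -` X \<inter> space ?P"
  have B: "B \<in> sets ?P" unfolding B_def by (rule measurable_sets[OF \<psi> X])
  have Am: "A \<in> sets path_space" unfolding A_def using J X by (intro sets_PiM_I_countable measurable_prod_emb) auto
  have ev: "observation W \<epsilon> h \<omega> \<in> A \<longleftrightarrow> Y (D h) \<omega> \<in> B" if h: "tame h" and W0: "W 0 \<omega> = 0" for h \<omega>
  proof -
    have "\<psi> (Y (D h) \<omega>) = restrict (observation W \<epsilon> h \<omega>) J"
      unfolding \<psi>_def
    proof (rule restrict_ext)
      fix s assume s: "s \<in> J"
      have "(\<Sum>i<idx s. Y (D h) \<omega> i) = (\<Sum>i<idx s. observation W \<epsilon> h \<omega> (t (Suc i)) - observation W \<epsilon> h \<omega> (t i))"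
      proof (rule sum.cong)
        fix i assume "i \<in> {..<idx s}"
        then have i: "i < n" using idx[OF s] by simp
        then show "Y (D h) \<omega> i = observation W \<epsilon> h \<omega> (t (Suc i)) - observation W \<epsilon> h \<omega> (t i)"
          using observation_increment[OF h, of "t i" "t (Suc i)"] t01[of i] t01[of "Suc i"] tmono[OF i]
          by (simp add: Y_def D_def)
      qed simp
      also have "\<dots> = observation W \<epsilon> h \<omega> (t (idx s)) - observation W \<epsilon> h \<omega> (t 0)"
        by (rule sum_lessThan_telescope)
      also have "\<dots> = observation W \<epsilon> h \<omega> s"
        using idx[OF s] W0 by (simp add: t0 observation_def)
      finally show "(\<Sum>i<idx s. Y (D h) \<omega> i) = observation W \<epsilon> h \<omega> s" .
    qed
    moreover have "Y (D h) \<omega> \<in> space ?P" by (simp add: Y_def space_PiM)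
    ultimately show ?thesis
      by (auto simp: A_def B_def prod_emb_def observation_def)
  qed
  have AE0: "AE \<omega> in M. W 0 \<omega> = 0" using BM by (simp add: standard_brownian_motion_def)
  have Ym: "Y a \<in> measurable M ?P" for a
    unfolding Y_def
    by (intro measurable_restrict borel_measurable_add borel_measurable_times borel_measurable_diff
        borel_measurable_const W_measurable t01) auto
  have Yset: "{\<omega>\<in>space M. Y a \<omega> \<in> B} \<in> events" for a
    using measurable_sets[OF Ym B, of a] by (auto simp: vimage_def Int_def conj_commute)
  have Oset: "{\<omega>\<in>space M. observation W \<epsilon> h \<omega> \<in> A} \<in> events" for h
    using measurable_sets[OF observation_measurable Am, of h] by (auto simp: vimage_def Int_def conj_commute)
  \<comment> \<open>The two events agree only where the Brownian path starts at 0, that is, almost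
    surely.\<close>
  have eq: "measure M {\<omega>\<in>space M. observation W \<epsilon> h \<omega> \<in> A} = measure M {\<omega>\<in>space M. Y (D h) \<omega> \<in> B}"
    if "tame h" for h
    using AE0 ev[OF that] by (intro finite_measure_eq_AE Oset Yset) auto
  have 1: "measure (law f) A = measure M {\<omega>\<in>space M. Y (D f) \<omega> \<in> B}"
    using measure_law[OF Am] eq[OF f] by simp
  have "measure (law g) (space path_space - A) = 1 - measure M {\<omega>\<in>space M. Y (D g) \<omega> \<in> B}"
    using prob_space.prob_compl[OF prob_space_law, of A g] Am measure_law[OF Am] eq[OF g] by simp
  also have "\<dots> = measure M {\<omega>\<in>space M. Y (D g) \<omega> \<notin> B}"
    by (rule prob_neg[symmetric]) (rule Yset)
  finally have 2: "measure (law g) (space path_space - A) = measure M {\<omega>\<in>space M. Y (D g) \<omega> \<notin> B}" .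
  define V where "V = (\<Sum>i<n. (D g i - D f i)\<^sup>2 / (\<epsilon>\<^sup>2 * (t (Suc i) - t i)))"
  have V0: "0 \<le> V" unfolding V_def using tmono by (intro sum_nonneg) (auto simp: less_imp_le)
  have "V \<le> (d / \<epsilon>)\<^sup>2"
  proof -
    let ?h = "\<lambda>s. g s - f s"
    have th: "tame ?h" by (intro tame_intros f g)
    have th2: "tame (\<lambda>s. (?h s)\<^sup>2)" by (intro tame_intros f g)
    have "V \<le> (\<Sum>i<n. integral {t i..t (Suc i)} (\<lambda>s. (?h s)\<^sup>2) / \<epsilon>\<^sup>2)"
      unfolding V_def
    proof (rule sum_mono)
      fix i assume "i \<in> {..<n}"
      then have i: "i < n" by simp
      have "D g i - D f i = integral {t i..t (Suc i)} ?h"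
        unfolding D_def using t01[of i] t01[of "Suc i"] i
        by (intro integral_diff[symmetric] tame_integrable f g) auto
      then have "(D g i - D f i)\<^sup>2 / (t (Suc i) - t i) \<le> integral {t i..t (Suc i)} (\<lambda>s. (?h s)\<^sup>2)"
        using tame_cauchy_schwarz[OF th, of "t i" "t (Suc i)"] t01[of i] t01[of "Suc i"] tmono[OF i] i by simp
      then have "(D g i - D f i)\<^sup>2 / (t (Suc i) - t i) / \<epsilon>\<^sup>2 \<le> integral {t i..t (Suc i)} (\<lambda>s. (?h s)\<^sup>2) / \<epsilon>\<^sup>2"
        by (rule divide_right_mono) simp
      then show "(D g i - D f i)\<^sup>2 / (\<epsilon>\<^sup>2 * (t (Suc i) - t i)) \<le> integral {t i..t (Suc i)} (\<lambda>s. (?h s)\<^sup>2) / \<epsilon>\<^sup>2"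
        by (simp add: mult.commute)
    qed
    also have "\<dots> = integral {t 0..t n} (\<lambda>s. (?h s)\<^sup>2) / \<epsilon>\<^sup>2"
    proof -
      have "(\<Sum>i<n. integral {t i..t (Suc i)} (\<lambda>s. (?h s)\<^sup>2)) = integral {t 0..t n} (\<lambda>s. (?h s)\<^sup>2)"
      proof (rule sum_integral_cells[OF th2])
        show "t i \<in> {0..1}" if "i \<le> n" for i by (rule t01[OF that])
        show "t i < t (Suc i)" if "i < n" for i by (rule tmono[OF that])
      qed simp
      then show ?thesis by (simp flip: sum_divide_distrib)
    qed
    also have "integral {t 0..t n} (\<lambda>s. (?h s)\<^sup>2) \<le> integral {0..1} (\<lambda>s. (?h s)\<^sup>2)"
      using t01[of 0] t01[of n] by (intro tame_integral_subset th2) auto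
    also have "\<dots> = sq_dist f g" by (simp add: sq_dist_def power2_commute)
    also have "\<dots> \<le> d\<^sup>2" by (rule d)
    finally show ?thesis by (simp add: power_divide divide_right_mono)
  qed
  then have sV: "sqrt V \<le> d / \<epsilon>" using d eps by (intro real_le_lsqrt) auto
  have "2 * std_normal_cdf (- d / (2 * \<epsilon>)) \<le> 2 * std_normal_cdf (- sqrt V / 2)"
    using sV by (intro mult_left_mono std_normal_cdf_mono) (auto simp: field_simps)
  also have "\<dots> \<le> measure M {\<omega>\<in>space M. Y (D f) \<omega> \<in> B} + measure M {\<omega>\<in>space M. Y (D g) \<omega> \<notin> B}"
    unfolding Y_def
  proof (rule increments_affinity)
    show "t i \<in> {0..1}" if "i \<le> n" for i by (rule t01[OF that])
    show "t i < t (Suc i)" if "i < n" for i by (rule tmono[OF that])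
    show "(sqrt V)\<^sup>2 = (\<Sum>i<n. (D g i - D f i)\<^sup>2 / (\<epsilon>\<^sup>2 * (t (Suc i) - t i)))"
      using V0 by (simp add: V_def)
  qed (use B V0 in simp_all)
  finally show ?thesis by (simp add: 1 2)
qed

lemma path_affinity:
  assumes f: "tame f" and g: "tame g" and d: "0 \<le> d" "sq_dist f g \<le> d\<^sup>2" and A: "A \<in> sets path_space"
  shows "2 * std_normal_cdf (- d / (2 * \<epsilon>)) \<le> measure (law f) A + measure (law g) (space path_space - A)"
proof -
  interpret P: prob_space "law f" by (rule prob_space_law)
  interpret Q: prob_space "law g" by (rule prob_space_law)
  \<comment> \<open>The finite-dimensional marginals are assembled into a projective family to
    obtain \<open>generator\<close>, the algebra of cylinder sets that generates the path
    space.\<close>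
  interpret projective_family "{0..1}" "\<lambda>J. distr (law f) (PiM J (\<lambda>_. borel)) (\<lambda>y. restrict y J)"
      "\<lambda>_. borel :: real measure"
  proof (rule projective_family.intro)
    fix J H :: "real set" assume *: "J \<subseteq> H" "H \<subseteq> {0..1}"
    then have m: "(\<lambda>y. restrict y H) \<in> measurable (law f) (PiM H (\<lambda>_. borel))"
      unfolding measurable_cong_sets[OF sets_law refl] by (intro measurable_restrict_subset)
    show "distr (law f) (PiM J (\<lambda>_. borel)) (\<lambda>y. restrict y J)
        = distr (distr (law f) (PiM H (\<lambda>_. borel)) (\<lambda>y. restrict y H)) (PiM J (\<lambda>_. borel)) (\<lambda>f. restrict f J)"
      using * by (subst distr_distr[OF measurable_restrict_subset m]) (auto simp: comp_def restrict_restrict Int_absorb1)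
  next
    show "prob_space (distr (law f) (PiM J (\<lambda>_. borel)) (\<lambda>y. restrict y J))"
      if "finite J" "J \<subseteq> {0..1}" for J using that(2)
      by (intro P.prob_space_distr) (unfold measurable_cong_sets[OF sets_law refl], intro measurable_restrict_subset)
  qed
  have gen: "sets path_space = sigma_sets (space path_space) generator"
    by (rule sets_PiM_generator)
  show ?thesis
  proof (rule field_le_epsilon)
    fix e :: real assume e: "0 < e"
    then have "0 < e / 2" by simp
    then obtain B where B: "B \<in> generator" "measure (law f) (sym_diff A B) < e / 2"
        "measure (law g) (sym_diff A B) < e / 2"
      using algebra_approximation[OF P.finite_measure_axioms Q.finite_measure_axioms algebra_generator,
          of A "e / 2"] A gen by auto
    have Bm: "B \<in> sets path_space" using B(1) gen by auto
    have "2 * std_normal_cdf (- d / (2 * \<epsilon>)) \<le> measure (law f) B + measure (law g) (space path_space - B)"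
      using B(1)
    proof cases
      case (1 J X)
      then show ?thesis using cylinder_affinity[OF f g d 1(2,3,4)] by simp
    qed
    moreover have "measure (law f) B \<le> measure (law f) (A \<union> sym_diff A B)"
      by (rule P.finite_measure_mono) (use A Bm in auto)
    moreover have "measure (law f) (A \<union> sym_diff A B) \<le> measure (law f) A + measure (law f) (sym_diff A B)"
      by (rule measure_subadditive) (use A Bm in auto)
    moreover have "measure (law g) (space path_space - B)
        \<le> measure (law g) ((space path_space - A) \<union> sym_diff A B)"
      by (rule Q.finite_measure_mono) (use A Bm in auto)
    moreover have "measure (law g) ((space path_space - A) \<union> sym_diff A B)
        \<le> measure (law g) (space path_space - A) + measure (law g) (sym_diff A B)"
      by (rule measure_subadditive) (use A Bm in auto)
    ultimately show "2 * std_normal_cdf (- d / (2 * \<epsilon>))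
        \<le> measure (law f) A + measure (law g) (space path_space - A) + e"
      using B by linarith
  qed
qed

end

section \<open>The two-point problem\<close>

text \<open>Integrating the affinity over the events \<open>{s < T}\<close>, \<open>a \<le> s \<le> b\<close>, avoids the factor two
  lost when an estimator is first reduced to a test.\<close>

lemma two_point_risk:
  fixes a b c :: real
  assumes P: "prob_space P" "sets P = sets S" and Q: "prob_space Q" "sets Q = sets S"
    and aff: "\<And>A. A \<in> sets S \<Longrightarrow> c \<le> measure P A + measure Q (space S - A)"
    and T: "T \<in> borel_measurable S" and c: "0 \<le> c" and ab: "a \<le> b"
  shows "ennreal ((b - a) * c) \<le> (\<integral>\<^sup>+ y. ennreal \<bar>T y - a\<bar> \<partial>P) + (\<integral>\<^sup>+ y. ennreal \<bar>T y - b\<bar> \<partial>Q)"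
proof -
  interpret P: prob_space P by fact
  interpret Q: prob_space Q by fact
  interpret PL: pair_sigma_finite P lborel by standard
  interpret QL: pair_sigma_finite Q lborel by standard
  have sp: "space P = space S" "space Q = space S" using P(2) Q(2) by (auto dest: sets_eq_imp_space_eq)
  have TP[measurable]: "T \<in> borel_measurable P" "T \<in> borel_measurable Q"
    using T P(2) Q(2) by (auto cong: measurable_cong_sets)
  \<comment> \<open>For fixed \<open>y\<close>, the levels \<open>s\<close> in \<open>{a..b}\<close>
    with \<open>s < T y\<close> have total length at most the distance of \<open>T y\<close> from
    \<open>a\<close>, and those with \<open>T y \<le> s\<close> at most its distance from
    \<open>b\<close>. Exchanging the integrals turns the two risks into the probabilities of
    complementary events.\<close>
  define F where "F = (\<lambda>y s. indicator {a..b} s * (if s < T y then 1 else 0) :: ennreal)"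
  define G where "G = (\<lambda>y s. indicator {a..b} s * (if T y \<le> s then 1 else 0) :: ennreal)"
  have [measurable]: "case_prod F \<in> borel_measurable (P \<Otimes>\<^sub>M lborel)"
    "case_prod G \<in> borel_measurable (Q \<Otimes>\<^sub>M lborel)"
    unfolding F_def G_def by measurable
  have "(\<integral>\<^sup>+ s. F y s \<partial>lborel) \<le> ennreal \<bar>T y - a\<bar>" for y
  proof -
    have "(\<integral>\<^sup>+ s. F y s \<partial>lborel) \<le> (\<integral>\<^sup>+ s. indicator {a..max a (T y)} s \<partial>lborel)"
      by (rule nn_integral_mono) (auto simp: F_def indicator_def)
    also have "\<dots> = ennreal (max a (T y) - a)" by simp
    also have "\<dots> \<le> ennreal \<bar>T y - a\<bar>" by (rule ennreal_leI) auto
    finally show ?thesis .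
  qed
  then have "(\<integral>\<^sup>+ y. (\<integral>\<^sup>+ s. F y s \<partial>lborel) \<partial>P) \<le> (\<integral>\<^sup>+ y. ennreal \<bar>T y - a\<bar> \<partial>P)"
    by (intro nn_integral_mono)
  moreover have "(\<integral>\<^sup>+ y. (\<integral>\<^sup>+ s. F y s \<partial>lborel) \<partial>P) = (\<integral>\<^sup>+ s. (\<integral>\<^sup>+ y. F y s \<partial>P) \<partial>lborel)"
    by (rule PL.Fubini'[symmetric]) measurable
  ultimately have 1: "(\<integral>\<^sup>+ s. (\<integral>\<^sup>+ y. F y s \<partial>P) \<partial>lborel) \<le> (\<integral>\<^sup>+ y. ennreal \<bar>T y - a\<bar> \<partial>P)" by simp
  have "(\<integral>\<^sup>+ s. G y s \<partial>lborel) \<le> ennreal \<bar>T y - b\<bar>" for y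
  proof -
    have "(\<integral>\<^sup>+ s. G y s \<partial>lborel) \<le> (\<integral>\<^sup>+ s. indicator {min (T y) b..b} s \<partial>lborel)"
      by (rule nn_integral_mono) (auto simp: G_def indicator_def)
    also have "\<dots> = ennreal (b - min (T y) b)" by simp
    also have "\<dots> \<le> ennreal \<bar>T y - b\<bar>" by (rule ennreal_leI) auto
    finally show ?thesis .
  qed
  then have "(\<integral>\<^sup>+ y. (\<integral>\<^sup>+ s. G y s \<partial>lborel) \<partial>Q) \<le> (\<integral>\<^sup>+ y. ennreal \<bar>T y - b\<bar> \<partial>Q)"
    by (intro nn_integral_mono)
  moreover have "(\<integral>\<^sup>+ y. (\<integral>\<^sup>+ s. G y s \<partial>lborel) \<partial>Q) = (\<integral>\<^sup>+ s. (\<integral>\<^sup>+ y. G y s \<partial>Q) \<partial>lborel)"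
    by (rule QL.Fubini'[symmetric]) measurable
  ultimately have 2: "(\<integral>\<^sup>+ s. (\<integral>\<^sup>+ y. G y s \<partial>Q) \<partial>lborel) \<le> (\<integral>\<^sup>+ y. ennreal \<bar>T y - b\<bar> \<partial>Q)" by simp
  have slice: "ennreal c * indicator {a..b} s \<le> (\<integral>\<^sup>+ y. F y s \<partial>P) + (\<integral>\<^sup>+ y. G y s \<partial>Q)" for s
  proof (cases "s \<in> {a..b}")
    case True
    define A where "A = {y\<in>space S. s < T y}"
    have A: "A \<in> sets S" unfolding A_def using T by measurable
    have "(\<integral>\<^sup>+ y. F y s \<partial>P) = (\<integral>\<^sup>+ y. indicator A y \<partial>P)"
      by (rule nn_integral_cong) (use True sp in \<open>auto simp: F_def A_def indicator_def\<close>)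
    also have "\<dots> = ennreal (measure P A)" using A P(2) by (simp add: P.emeasure_eq_measure)
    finally have "(\<integral>\<^sup>+ y. F y s \<partial>P) = ennreal (measure P A)" .
    moreover have "(\<integral>\<^sup>+ y. G y s \<partial>Q) = (\<integral>\<^sup>+ y. indicator (space S - A) y \<partial>Q)"
      by (rule nn_integral_cong) (use True sp in \<open>auto simp: G_def A_def indicator_def\<close>)
    moreover have "\<dots> = ennreal (measure Q (space S - A))"
      using A Q(2) by (simp add: Q.emeasure_eq_measure)
    ultimately show ?thesis using aff[OF A] True by (simp flip: ennreal_plus)
  qed simp
  have "ennreal ((b - a) * c) = (\<integral>\<^sup>+ s. ennreal c * indicator {a..b} s \<partial>lborel)"
    using ab c by (simp add: nn_integral_cmult_indicator ennreal_mult mult.commute)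
  also have "\<dots> \<le> (\<integral>\<^sup>+ s. (\<integral>\<^sup>+ y. F y s \<partial>P) + (\<integral>\<^sup>+ y. G y s \<partial>Q) \<partial>lborel)"
    by (intro nn_integral_mono slice)
  also have "\<dots> = (\<integral>\<^sup>+ s. (\<integral>\<^sup>+ y. F y s \<partial>P) \<partial>lborel) + (\<integral>\<^sup>+ s. (\<integral>\<^sup>+ y. G y s \<partial>Q) \<partial>lborel)"
    by (rule nn_integral_add) (unfold F_def G_def, measurable)
  also have "\<dots> \<le> (\<integral>\<^sup>+ y. ennreal \<bar>T y - a\<bar> \<partial>P) + (\<integral>\<^sup>+ y. ennreal \<bar>T y - b\<bar> \<partial>Q)"
    by (intro add_mono 1 2)
  finally show ?thesis .
qed

lemma ennreal_half_le_max:
  fixes u v :: ennreal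
  assumes "ennreal (2 * k) \<le> u + v" "0 \<le> k" shows "ennreal k \<le> max u v"
proof -
  have "2 * ennreal k = ennreal (2 * k)" using assms(2) by (simp add: ennreal_mult)
  also have "\<dots> \<le> max u v + max u v" using assms(1) by (rule order_trans) (intro add_mono; simp)
  also have "\<dots> = 2 * max u v" by (simp add: mult_2)
  finally show ?thesis by (simp add: ennreal_mult_le_mult_iff)
qed

section \<open>Lower bounds for the benchmarks\<close>

context white_noise_model
begin

lemma estimation_benchmark_lower:
  assumes f: "f \<in> convex_class" and g: "g \<in> convex_class" and d: "0 \<le> d" "sq_dist f g \<le> d\<^sup>2"
  shows "ennreal (\<bar>\<theta> g - \<theta> f\<bar> * std_normal_cdf (- d / (2 * \<epsilon>))) \<le> estimation_benchmark law \<theta> f"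
  unfolding estimation_benchmark_def
proof (rule SUP_upper2[OF g], rule INF_greatest)
  fix T :: "(real \<Rightarrow> real) \<Rightarrow> real" assume T: "T \<in> borel_measurable path_space"
  let ?\<Phi> = "std_normal_cdf (- d / (2 * \<epsilon>))"
  have tf: "tame f" and tg: "tame g" using f g by (auto intro: convex_class_tame)
  have aff: "2 * ?\<Phi> \<le> measure (law f) A + measure (law g) (space path_space - A)"
    if "A \<in> sets path_space" for A
    by (rule path_affinity[OF tf tg d that])
  \<comment> \<open>\<open>two_point_risk\<close> orders its points as \<open>a \<le> b\<close>, so
    the laws must trade places when the target decreases. Complementing the event provides
    this.\<close>
  have aff': "2 * ?\<Phi> \<le> measure (law g) A + measure (law f) (space path_space - A)"
    if "A \<in> sets path_space" for A
  proof -
    have "space path_space - (space path_space - A) = A" using sets.sets_into_space[OF that] by auto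
    then show ?thesis using aff[of "space path_space - A"] that by (auto simp: sets.compl_sets)
  qed
  have "ennreal (\<bar>\<theta> g - \<theta> f\<bar> * (2 * ?\<Phi>))
      \<le> (\<integral>\<^sup>+ y. ennreal \<bar>T y - \<theta> f\<bar> \<partial>law f) + (\<integral>\<^sup>+ y. ennreal \<bar>T y - \<theta> g\<bar> \<partial>law g)"
  proof (cases "\<theta> f \<le> \<theta> g")
    case True
    then show ?thesis
      using two_point_risk[OF prob_space_law sets_law prob_space_law sets_law aff T _ True]
      by (simp add: std_normal_cdf_nonneg)
  next
    case False
    then show ?thesis
      using two_point_risk[OF prob_space_law sets_law prob_space_law sets_law aff' T, of "\<theta> g" "\<theta> f"]
      by (simp add: std_normal_cdf_nonneg add.commute)
  qed
  then have "ennreal (2 * (\<bar>\<theta> g - \<theta> f\<bar> * ?\<Phi>))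
      \<le> (\<integral>\<^sup>+ y. ennreal \<bar>T y - \<theta> f\<bar> \<partial>law f) + (\<integral>\<^sup>+ y. ennreal \<bar>T y - \<theta> g\<bar> \<partial>law g)"
    by (simp add: mult.left_commute)
  from ennreal_half_le_max[OF this]
  show "ennreal (\<bar>\<theta> g - \<theta> f\<bar> * ?\<Phi>) \<le> (MAX h\<in>{f, g}. \<integral>\<^sup>+ y. ennreal \<bar>T y - \<theta> h\<bar> \<partial>law h)"
    by (simp add: std_normal_cdf_nonneg)
qed

text \<open>An interval that contains both targets is at least as long as their difference. Coverage
  under \<open>g\<close> turns, through the affinity, into a lower bound for the
  \<open>f\<close>-probability of containing the wrong target; inclusion-exclusion with the coverage
  under \<open>f\<close> loses another \<alpha>.\<close>

lemma inference_benchmark_lower: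
  assumes f: "f \<in> convex_class" and g: "g \<in> convex_class" and d: "0 \<le> d" "sq_dist f g \<le> d\<^sup>2"
  shows "ennreal (\<bar>\<theta> g - \<theta> f\<bar> * (2 * std_normal_cdf (- d / (2 * \<epsilon>)) - 2 * \<alpha>)) \<le> inference_benchmark law \<theta> \<alpha> f"
  unfolding inference_benchmark_def
proof (rule SUP_upper2[OF g], rule INF_greatest, clarify)
  fix l u assume "(l, u) \<in> confidence_intervals law \<theta> \<alpha> {f, g}"
  then have [measurable]: "l \<in> borel_measurable path_space" "u \<in> borel_measurable path_space"
    and lu: "\<And>y. y \<in> space path_space \<Longrightarrow> l y \<le> u y"
    and cov: "\<And>h. h \<in> {f, g} \<Longrightarrow> 1 - \<alpha> \<le> measure (law h) {y\<in>space path_space. \<theta> h \<in> {l y..u y}}"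
    by (auto simp: confidence_intervals_def)
  interpret P: prob_space "law f" by (rule prob_space_law)
  interpret Q: prob_space "law g" by (rule prob_space_law)
  define C where "C = (\<lambda>h. {y\<in>space path_space. \<theta> h \<in> {l y..u y}})"
  have C: "C h \<in> sets path_space" for h unfolding C_def atLeastAtMost_iff by measurable
  have "2 * std_normal_cdf (- d / (2 * \<epsilon>)) \<le> measure (law f) (C g) + measure (law g) (space path_space - C g)"
    using f g d C by (intro path_affinity convex_class_tame)
  also have "measure (law g) (space path_space - C g) = 1 - measure (law g) (C g)"
    using Q.prob_compl[of "C g"] C by simp
  finally have "2 * std_normal_cdf (- d / (2 * \<epsilon>)) - \<alpha> \<le> measure (law f) (C g)"
    using cov[of g] by (simp add: C_def)
  moreover have "1 - \<alpha> \<le> measure (law f) (C f)" using cov[of f] by (simp add: C_def)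
  moreover have "measure (law f) (C f \<union> C g) = measure (law f) (C f) + measure (law f) (C g) - measure (law f) (C f \<inter> C g)"
    by (rule measure_Un3) (use C in \<open>auto simp: P.fmeasurable_eq_sets\<close>)
  moreover have "measure (law f) (C f \<union> C g) \<le> 1" by simp
  ultimately have p: "2 * std_normal_cdf (- d / (2 * \<epsilon>)) - 2 * \<alpha> \<le> measure (law f) (C f \<inter> C g)"
    by linarith
  have "ennreal (\<bar>\<theta> g - \<theta> f\<bar> * (2 * std_normal_cdf (- d / (2 * \<epsilon>)) - 2 * \<alpha>))
      \<le> ennreal (\<bar>\<theta> g - \<theta> f\<bar> * measure (law f) (C f \<inter> C g))"
    by (intro ennreal_leI mult_left_mono p) simp
  also have "\<dots> = (\<integral>\<^sup>+ y. ennreal \<bar>\<theta> g - \<theta> f\<bar> * indicator (C f \<inter> C g) y \<partial>law f)"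
    using C by (subst nn_integral_cmult_indicator) (auto simp: P.emeasure_eq_measure ennreal_mult)
  also have "\<dots> \<le> (\<integral>\<^sup>+ y. ennreal (u y - l y) \<partial>law f)"
    by (rule nn_integral_mono) (auto simp: C_def indicator_def intro!: ennreal_leI)
  finally show "ennreal (\<bar>\<theta> g - \<theta> f\<bar> * (2 * std_normal_cdf (- d / (2 * \<epsilon>)) - 2 * \<alpha>))
      \<le> (\<integral>\<^sup>+ y. ennreal (u y - l y) \<partial>law f)" .
qed

end

text \<open>The sum is the integral of \<open>v\<close> against a step function carrying the
  right-endpoint values of \<open>u\<close>. These step functions are bounded, converge to
  \<open>u\<close> inside the interval by continuity and equal \<open>u\<close> at 0 and 1, so
  dominated convergence applies. The numerator and the variance of the step contrast are both of
  this form.\<close>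

lemma riemann_stieltjes_cells:
  assumes u: "tame u" and v: "tame v"
  shows "(\<lambda>n. \<Sum>i<Suc n. u (real (Suc i) / real (Suc n)) *
      integral {real i / real (Suc n)..real (Suc i) / real (Suc n)} v) \<longlonglongrightarrow> integral {0..1} (\<lambda>t. u t * v t)"
proof -
  \<comment> \<open>Rounding up selects the right end of the half-open cell containing
    \<open>t\<close>; the left end of a closed cell is a single exceptional point, removed by
    \<open>has_integral_spike_finite\<close>.\<close>
  define \<phi> where "\<phi> = (\<lambda>n t. u (real_of_int \<lceil>real (Suc n) * t\<rceil> / real (Suc n)))"
  define c where "c = (\<lambda>n i. u (real (Suc i) / real (Suc n)) * integral {real i / real (Suc n)..real (Suc i) / real (Suc n)} v)"
  obtain K where K: "K > 0" "\<And>t. t \<in> {0..1} \<Longrightarrow> \<bar>u t\<bar> \<le> K" "\<And>t. t \<in> {0..1} \<Longrightarrow> \<bar>v t\<bar> \<le> K"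
    by (rule tame_boundE2[OF u v]) (rule that)
  have step: "((\<lambda>t. \<phi> n t * v t) has_integral (\<Sum>i<k. c n i)) {0..real k / real (Suc n)}" if "k \<le> Suc n" for n k
    using that
  proof (induction k)
    case (Suc k)
    let ?a = "real k / real (Suc n)" and ?b = "real (Suc k) / real (Suc n)"
    have b: "0 \<le> ?a" "?a \<le> ?b" "?b \<le> 1" using Suc.prems by (auto simp: divide_simps)
    have "v integrable_on {?a..?b}" using b by (intro tame_integrable v)
    then have "((\<lambda>t. u ?b * v t) has_integral c n k) {?a..?b}"
      unfolding c_def by (intro has_integral_mult_right integrable_integral)
    then have "((\<lambda>t. \<phi> n t * v t) has_integral c n k) {?a..?b}"
    proof (rule has_integral_spike_finite[of "{?a}", rotated 2])
      fix t assume t: "t \<in> {?a..?b} - {?a}"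
      then have "real k < real (Suc n) * t" "real (Suc n) * t \<le> real (Suc k)"
        by (auto simp: divide_simps mult.commute)
      then have "\<lceil>real (Suc n) * t\<rceil> = int (Suc k)" by (intro ceiling_unique) auto
      then show "\<phi> n t * v t = u ?b * v t" by (simp add: \<phi>_def)
    qed simp
    then show ?case
      using has_integral_combine[OF b(1,2) Suc.IH] Suc.prems by (simp add: add.commute)
  qed (simp add: has_integral_refl)
  have int: "((\<lambda>t. \<phi> n t * v t) has_integral (\<Sum>i<Suc n. c n i)) {0..1}" for n
    using step[of "Suc n" n] by simp
  have ceil01: "real_of_int \<lceil>real (Suc n) * t\<rceil> / real (Suc n) \<in> {0..1}" if "t \<in> {0..1}" for n t
  proof -
    have "0 \<le> real (Suc n) * t" "real (Suc n) * t \<le> real (Suc n)"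
      using that by (auto intro: mult_left_le)
    then have "0 \<le> \<lceil>real (Suc n) * t\<rceil>" "\<lceil>real (Suc n) * t\<rceil> \<le> int (Suc n)"
      by (auto simp: ceiling_le_iff zero_le_ceiling less_le_trans[of "-1" 0])
    then have "0 \<le> real_of_int \<lceil>real (Suc n) * t\<rceil>" "real_of_int \<lceil>real (Suc n) * t\<rceil> \<le> real (Suc n)"
      by linarith+
    then show ?thesis by (simp add: divide_simps)
  qed
  have "(\<lambda>n. integral {0..1} (\<lambda>t. \<phi> n t * v t)) \<longlonglongrightarrow> integral {0..1} (\<lambda>t. u t * v t)"
  proof (rule dominated_convergence(2))
    show "(\<lambda>t. \<phi> n t * v t) integrable_on {0..1}" for n using int by (rule has_integral_integrable)
    show "(\<lambda>_. K * K) integrable_on {0..1::real}" by (rule integrable_const_ivl)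
    show "norm (\<phi> n t * v t) \<le> K * K" if "t \<in> {0..1}" for n t
      unfolding real_norm_def abs_mult using K ceil01[OF that] that
      by (intro mult_mono) (auto simp: \<phi>_def)
    show "(\<lambda>n. \<phi> n t * v t) \<longlonglongrightarrow> u t * v t" if t: "t \<in> {0..1}" for t
    proof (intro tendsto_mult tendsto_const)
      consider "t = 0" | "t = 1" | "t \<in> {0<..<1}" using t by fastforce
      then show "(\<lambda>n. \<phi> n t) \<longlonglongrightarrow> u t"
      proof cases
        case 3
        then have "isCont u t" using tameD[OF u] by (simp add: continuous_on_eq_continuous_at)
        moreover have "(\<lambda>n. real_of_int \<lceil>real (Suc n) * t\<rceil> / real (Suc n)) \<longlonglongrightarrow> t"
        proof (rule real_tendsto_sandwich)
          show "\<forall>\<^sub>F n in sequentially. t \<le> real_of_int \<lceil>real (Suc n) * t\<rceil> / real (Suc n)"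
            by (intro always_eventually allI) (simp add: field_simps del: of_nat_Suc)
          show "\<forall>\<^sub>F n in sequentially. real_of_int \<lceil>real (Suc n) * t\<rceil> / real (Suc n) \<le> t + 1 / real (Suc n)"
          proof (intro always_eventually allI)
            fix n
            have "real_of_int \<lceil>real (Suc n) * t\<rceil> \<le> real (Suc n) * t + 1" by linarith
            then show "real_of_int \<lceil>real (Suc n) * t\<rceil> / real (Suc n) \<le> t + 1 / real (Suc n)"
              by (simp add: field_simps del: of_nat_Suc)
          qed
          show "(\<lambda>n. t + 1 / real (Suc n)) \<longlonglongrightarrow> t"
            using tendsto_add[OF tendsto_const LIMSEQ_inverse_real_of_nat, of t] by (simp add: inverse_eq_divide)
        qed simp
        ultimately show ?thesis unfolding \<phi>_def by (rule isCont_tendsto_compose)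
      qed (auto simp: \<phi>_def simp del: of_nat_Suc)
    qed
  qed
  then show ?thesis using integral_unique[OF int] by (simp add: c_def)
qed

section \<open>Separating statistics and upper bounds for the benchmarks\<close>

context white_noise_model
begin

text \<open>\<open>S\<close> is standard normal under \<open>f\<close> and normal with mean
  \<open>x\<close> and variance one under \<open>g\<close>, so \<open>x\<close> is its
  signal-to-noise ratio. Distribution functions suffice because \<open>S\<close> is only compared
  with thresholds.\<close>

definition separates :: "(real \<Rightarrow> real) \<Rightarrow> (real \<Rightarrow> real) \<Rightarrow> real \<Rightarrow> ((real \<Rightarrow> real) \<Rightarrow> real) \<Rightarrow> bool" where
  "separates f g x S \<longleftrightarrow> S \<in> borel_measurable path_space \<and>
     (\<forall>s. measure (law f) {y\<in>space path_space. S y \<le> s} = std_normal_cdf s \<and>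
          measure (law g) {y\<in>space path_space. S y \<le> s} = std_normal_cdf (s - x))"

text \<open>The increments are centred by those of \<open>f\<close>, weighted by a step function
  with values \<open>c\<close>, and divided by the standard deviation of the resulting
  noise.\<close>

lemma step_statistic:
  fixes n :: nat and t c :: "nat \<Rightarrow> real"
  assumes f: "tame f" and g: "tame g"
    and t: "\<And>i. i \<le> n \<Longrightarrow> t i \<in> {0..1}" "\<And>i. i < n \<Longrightarrow> t i < t (Suc i)"
    and V: "V = (\<Sum>i<n. (c i)\<^sup>2 * (t (Suc i) - t i))" "0 < V"
  shows "\<exists>S. separates f g ((\<Sum>i<n. c i * integral {t i..t (Suc i)} (\<lambda>s. g s - f s)) / (\<epsilon> * sqrt V)) S"
proof -
  define D where "D = (\<lambda>(h :: real \<Rightarrow> real) i. integral {t i..t (Suc i)} h)"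
  define S where "S = (\<lambda>y. (\<Sum>i<n. c i * (y (t (Suc i)) - y (t i) - D f i)) / (\<epsilon> * sqrt V))"
  define G where "G = (\<lambda>\<omega>. \<Sum>i<n. c i * (W (t (Suc i)) \<omega> - W (t i) \<omega>))"
  have G: "distributed M lborel G (normal_density 0 (sqrt V))"
    unfolding G_def
  proof (rule weighted_increments_normal)
    show "t i \<in> {0..1}" if "i \<le> n" for i by (rule t(1)[OF that])
    show "t i < t (Suc i)" if "i < n" for i by (rule t(2)[OF that])
  qed (use V in simp_all)
  have Sm: "S \<in> borel_measurable path_space"
    unfolding S_def
    by (intro borel_measurable_divide borel_measurable_sum borel_measurable_times borel_measurable_diff
        borel_measurable_const measurable_component_singleton) (use t in auto)
  have cdf: "measure (law h) {y\<in>space path_space. S y \<le> s}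
      = std_normal_cdf (s - (\<Sum>i<n. c i * (D h i - D f i)) / (\<epsilon> * sqrt V))" if h: "tame h" for h s
  proof -
    define \<delta> where "\<delta> = (\<Sum>i<n. c i * (D h i - D f i)) / (\<epsilon> * sqrt V)"
    have eq: "S (observation W \<epsilon> h \<omega>) = \<delta> + G \<omega> / sqrt V" for \<omega>
    proof -
      have "(\<Sum>i<n. c i * (observation W \<epsilon> h \<omega> (t (Suc i)) - observation W \<epsilon> h \<omega> (t i) - D f i))
          = (\<Sum>i<n. c i * (D h i - D f i) + \<epsilon> * (c i * (W (t (Suc i)) \<omega> - W (t i) \<omega>)))"
      proof (rule sum.cong)
        fix i assume "i \<in> {..<n}"
        then have i: "i < n" by simp
        have "observation W \<epsilon> h \<omega> (t (Suc i)) - observation W \<epsilon> h \<omega> (t i)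
            = D h i + \<epsilon> * (W (t (Suc i)) \<omega> - W (t i) \<omega>)"
          using observation_increment[OF h, of "t i" "t (Suc i)" \<omega>] t(1)[of i] t(1)[of "Suc i"] t(2)[OF i] i
          by (simp add: D_def)
        then show "c i * (observation W \<epsilon> h \<omega> (t (Suc i)) - observation W \<epsilon> h \<omega> (t i) - D f i)
            = c i * (D h i - D f i) + \<epsilon> * (c i * (W (t (Suc i)) \<omega> - W (t i) \<omega>))"
          by (simp only:) (simp add: algebra_simps)
      qed simp
      also have "\<dots> = (\<Sum>i<n. c i * (D h i - D f i)) + \<epsilon> * G \<omega>"
        by (simp add: sum.distrib G_def sum_distrib_left)
      finally show ?thesis using eps V(2) by (simp add: S_def \<delta>_def add_divide_distrib)
    qed
    have ev: "S (observation W \<epsilon> h \<omega>) \<le> s \<longleftrightarrow> G \<omega> \<le> (s - \<delta>) * sqrt V" for \<omega>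
      unfolding eq using pos_divide_le_eq[of "sqrt V" "G \<omega>" "s - \<delta>"] V(2) by auto
    have "{y\<in>space path_space. S y \<le> s} \<in> sets path_space" using Sm by measurable
    then have "measure (law h) {y\<in>space path_space. S y \<le> s}
        = measure M {\<omega>\<in>space M. observation W \<epsilon> h \<omega> \<in> {y\<in>space path_space. S y \<le> s}}"
      by (rule measure_law)
    also have "\<dots> = measure M {\<omega>\<in>space M. G \<omega> \<le> (s - \<delta>) * sqrt V}"
      using measurable_space[OF observation_measurable[of h]] by (simp add: ev cong: conj_cong)
    also have "\<dots> = std_normal_cdf (s - \<delta>)"
      using normal_le[OF G] V(2) by simp
    finally show ?thesis by (simp add: \<delta>_def)
  qed
  have "D g i - D f i = integral {t i..t (Suc i)} (\<lambda>s. g s - f s)" if "i < n" for i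
    unfolding D_def using t(1)[of i] t(1)[of "Suc i"] that
    by (intro integral_diff[symmetric] tame_integrable f g) auto
  then have "(\<Sum>i<n. c i * (D g i - D f i)) = (\<Sum>i<n. c i * integral {t i..t (Suc i)} (\<lambda>s. g s - f s))"
    by (intro sum.cong) auto
  then have "separates f g ((\<Sum>i<n. c i * integral {t i..t (Suc i)} (\<lambda>s. g s - f s)) / (\<epsilon> * sqrt V)) S"
    unfolding separates_def using Sm cdf[OF f] cdf[OF g] by simp
  then show ?thesis by blast
qed

text \<open>For drifts at small distance any statistic with a nonnegative shift will do. The single
  increment over the whole interval is taken, with its sign chosen to suit.\<close>

lemma separates_trivial:
  assumes f: "tame f" and g: "tame g"
  obtains x S where "0 \<le> x" "separates f g x S"
proof -
  define I where "I = integral {0..1} (\<lambda>s. g s - f s)"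
  define k :: real where "k = (if 0 \<le> I then 1 else -1)"
  have "\<exists>S. separates f g ((\<Sum>i<1. k * integral {real i..real (Suc i)} (\<lambda>s. g s - f s)) / (\<epsilon> * sqrt 1)) S"
    by (rule step_statistic[OF f g]) (auto simp: k_def)
  then have "\<exists>S. separates f g (\<bar>I\<bar> / \<epsilon>) S" by (simp add: I_def[symmetric] k_def abs_if split: if_splits)
  then show ?thesis using that[of "\<bar>I\<bar> / \<epsilon>"] eps by auto
qed

text \<open>The ideal weight is \<open>h = g - f\<close> itself. For step functions sampled from
  \<open>h\<close>, numerator and variance both tend to the squared distance Q, so the ratio tends
  to sqrt Q / \<epsilon>; the strict inequality in \<open>far\<close> leaves room to stop at a
  finite \<open>n\<close>.\<close>

lemma separates_far:
  assumes f: "tame f" and g: "tame g" and k: "0 \<le> \<kappa>" and far: "(\<kappa> * \<epsilon>)\<^sup>2 < sq_dist f g"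
  obtains x S where "\<kappa> \<le> x" "separates f g x S"
proof -
  define h where "h = (\<lambda>s. g s - f s)"
  have h: "tame h" and h2: "tame (\<lambda>s. (h s)\<^sup>2)" unfolding h_def by (intro tame_intros f g)+
  define Q where "Q = sq_dist f g"
  have Q: "Q = integral {0..1} (\<lambda>s. h s * h s)" "Q = integral {0..1} (\<lambda>s. (h s)\<^sup>2 * 1)"
    by (simp_all add: Q_def sq_dist_def h_def power2_commute flip: power2_eq_square)
  have Q0: "0 < Q" using far by (smt (verit) Q_def zero_le_power2)
  define A where "A = (\<lambda>n. \<Sum>i<Suc n. h (real (Suc i) / real (Suc n)) *
      integral {real i / real (Suc n)..real (Suc i) / real (Suc n)} h)"
  define V where "V = (\<lambda>n. \<Sum>i<Suc n. (h (real (Suc i) / real (Suc n)))\<^sup>2 *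
      (real (Suc i) / real (Suc n) - real i / real (Suc n)))"
  have A: "A \<longlonglongrightarrow> Q" unfolding A_def Q(1) by (rule riemann_stieltjes_cells[OF h h])
  have "(\<lambda>n. \<Sum>i<Suc n. (h (real (Suc i) / real (Suc n)))\<^sup>2 *
      integral {real i / real (Suc n)..real (Suc i) / real (Suc n)} (\<lambda>_. 1)) \<longlonglongrightarrow> Q"
    unfolding Q(2) by (rule riemann_stieltjes_cells[OF h2 tame_const])
  moreover have "integral {real i / real (Suc n)..real (Suc i) / real (Suc n)} (\<lambda>_. 1)
      = real (Suc i) / real (Suc n) - real i / real (Suc n)" for i n
    by (simp add: divide_right_mono)
  ultimately have V: "V \<longlonglongrightarrow> Q" unfolding V_def by simp
  have "(\<lambda>n. A n / (\<epsilon> * sqrt (V n))) \<longlonglongrightarrow> Q / (\<epsilon> * sqrt Q)"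
    using Q0 eps by (intro tendsto_divide tendsto_mult tendsto_const tendsto_real_sqrt A V) auto
  moreover have "Q / (\<epsilon> * sqrt Q) = sqrt Q / \<epsilon>"
    using Q0 eps by (simp add: field_simps)
  moreover have "\<kappa> < sqrt Q / \<epsilon>"
  proof -
    have "\<kappa> * \<epsilon> < sqrt Q" using far k eps by (intro real_less_rsqrt) (auto simp: Q_def)
    then show ?thesis using eps by (simp add: field_simps)
  qed
  ultimately have "eventually (\<lambda>n. \<kappa> < A n / (\<epsilon> * sqrt (V n))) sequentially"
    by (intro order_tendstoD(1)) auto
  moreover have "eventually (\<lambda>n. 0 < V n) sequentially"
    by (rule order_tendstoD(1)[OF V Q0])
  ultimately have "eventually (\<lambda>n. \<kappa> < A n / (\<epsilon> * sqrt (V n)) \<and> 0 < V n) sequentially"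
    by (rule eventually_conj)
  then obtain n where n: "\<kappa> < A n / (\<epsilon> * sqrt (V n))" "0 < V n"
    by (auto simp: eventually_sequentially)
  have "\<exists>S. separates f g (A n / (\<epsilon> * sqrt (V n))) S"
    unfolding A_def h_def
  proof (rule step_statistic[OF f g])
    show "V n = (\<Sum>i<Suc n. (g (real (Suc i) / real (Suc n)) - f (real (Suc i) / real (Suc n)))\<^sup>2 *
      (real (Suc i) / real (Suc n) - real i / real (Suc n)))" by (simp add: V_def h_def)
    show "0 < V n" by (rule n(2))
    show "real i / real (Suc n) \<in> {0..1}" if "i \<le> Suc n" for i using that by (auto simp: divide_simps)
    show "real i / real (Suc n) < real (Suc i) / real (Suc n)" for i by (auto intro: divide_strict_right_mono)
  qed
  then show ?thesis using that n(1) by (meson less_imp_le)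
qed


lemma separates_measure:
  assumes "separates f g x S"
  shows "S \<in> borel_measurable path_space"
    "measure (law f) {y\<in>space path_space. S y \<le> s} = std_normal_cdf s"
    "measure (law g) {y\<in>space path_space. S y \<le> s} = std_normal_cdf (s - x)"
    "measure (law f) {y\<in>space path_space. s < S y} = std_normal_cdf (- s)"
    "measure (law g) {y\<in>space path_space. s < S y} = std_normal_cdf (x - s)"
proof -
  show S[measurable]: "S \<in> borel_measurable path_space" using assms by (simp add: separates_def)
  show f: "measure (law f) {y\<in>space path_space. S y \<le> s} = std_normal_cdf s"
    and g: "measure (law g) {y\<in>space path_space. S y \<le> s} = std_normal_cdf (s - x)"
    using assms by (auto simp: separates_def)
  have c: "{y\<in>space path_space. s < S y} = space (law h) - {y\<in>space path_space. S y \<le> s}" for h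
    by auto
  have m: "{y\<in>space path_space. S y \<le> s} \<in> sets (law h)" for h by simp measurable
  show "measure (law f) {y\<in>space path_space. s < S y} = std_normal_cdf (- s)"
    unfolding c[of f] prob_space.prob_compl[OF prob_space_law m] f by (simp add: std_normal_cdf_minus)
  show "measure (law g) {y\<in>space path_space. s < S y} = std_normal_cdf (x - s)"
    unfolding c[of g] prob_space.prob_compl[OF prob_space_law m] g
    using std_normal_cdf_minus[of "s - x"] by simp
qed

text \<open>Guess one of the two targets; the threshold \<open>x / 2\<close> makes both error
  probabilities equal to \<Phi>(-x / 2).\<close>

lemma estimation_pair_upper:
  assumes S: "separates f g x S"
  shows "(INF T\<in>borel_measurable path_space. MAX h\<in>{f, g}. \<integral>\<^sup>+ y. ennreal \<bar>T y - \<theta> h\<bar> \<partial>law h)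
    \<le> ennreal (\<bar>\<theta> g - \<theta> f\<bar> * std_normal_cdf (- x / 2))"
proof -
  note S' = separates_measure[OF S]
  have [measurable]: "S \<in> borel_measurable path_space" by (rule S'(1))
  interpret P: prob_space "law f" by (rule prob_space_law)
  interpret Q: prob_space "law g" by (rule prob_space_law)
  define T where "T = (\<lambda>y. if S y \<le> x / 2 then \<theta> f else \<theta> g)"
  have Tm: "T \<in> borel_measurable path_space" unfolding T_def by measurable
  have "(\<integral>\<^sup>+ y. ennreal \<bar>T y - \<theta> f\<bar> \<partial>law f)
      = (\<integral>\<^sup>+ y. ennreal \<bar>\<theta> g - \<theta> f\<bar> * indicator {y\<in>space path_space. x / 2 < S y} y \<partial>law f)"
    by (rule nn_integral_cong) (auto simp: T_def indicator_def)
  also have "\<dots> = ennreal (\<bar>\<theta> g - \<theta> f\<bar> * std_normal_cdf (- x / 2))"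
    using S'(4)[of "x / 2"]
    by (subst nn_integral_cmult_indicator) (auto simp: P.emeasure_eq_measure ennreal_mult std_normal_cdf_nonneg)
  finally have 1: "(\<integral>\<^sup>+ y. ennreal \<bar>T y - \<theta> f\<bar> \<partial>law f) = ennreal (\<bar>\<theta> g - \<theta> f\<bar> * std_normal_cdf (- x / 2))" .
  have "(\<integral>\<^sup>+ y. ennreal \<bar>T y - \<theta> g\<bar> \<partial>law g)
      = (\<integral>\<^sup>+ y. ennreal \<bar>\<theta> g - \<theta> f\<bar> * indicator {y\<in>space path_space. S y \<le> x / 2} y \<partial>law g)"
    by (rule nn_integral_cong) (auto simp: T_def indicator_def abs_minus_commute)
  also have "\<dots> = ennreal (\<bar>\<theta> g - \<theta> f\<bar> * std_normal_cdf (x / 2 - x))"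
    using S'(3)[of "x / 2"]
    by (subst nn_integral_cmult_indicator) (auto simp: Q.emeasure_eq_measure ennreal_mult std_normal_cdf_nonneg)
  also have "x / 2 - x = - x / 2" by simp
  finally have 2: "(\<integral>\<^sup>+ y. ennreal \<bar>T y - \<theta> g\<bar> \<partial>law g) = ennreal (\<bar>\<theta> g - \<theta> f\<bar> * std_normal_cdf (- x / 2))" .
  show ?thesis by (rule INF_lower2[OF Tm]) (simp add: 1 2)
qed

text \<open>A pair at distance X \<epsilon> has targets at most X C apart, but is confused with a
  probability of order at most 1/X. Below distance \<epsilon> the case X = 1 and the trivial bound 1
  on the error suffice.\<close>

lemma estimation_benchmark_upper:
  assumes f: "f \<in> convex_class" and C: "0 \<le> C"
    and modulus: "\<And>g X. g \<in> convex_class \<Longrightarrow> 1 \<le> X \<Longrightarrow> sq_dist f g \<le> (X * \<epsilon>)\<^sup>2 \<Longrightarrow> \<bar>\<theta> g - \<theta> f\<bar> \<le> X * C"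
  shows "estimation_benchmark law \<theta> f \<le> ennreal C"
  unfolding estimation_benchmark_def
proof (rule SUP_least)
  fix g assume g: "g \<in> convex_class"
  have tf: "tame f" and tg: "tame g" using f g by (auto intro: convex_class_tame)
  have "\<exists>x S. separates f g x S \<and> \<bar>\<theta> g - \<theta> f\<bar> * std_normal_cdf (- x / 2) \<le> C"
  proof (cases "sq_dist f g \<le> \<epsilon>\<^sup>2")
    case True
    from separates_trivial[OF tf tg] obtain x S where "0 \<le> x" and S: "separates f g x S" .
    have "\<bar>\<theta> g - \<theta> f\<bar> * std_normal_cdf (- x / 2) \<le> C * 1"
      using modulus[OF g, of 1] True C
      by (intro mult_mono) (auto simp: std_normal_cdf_nonneg std_normal_cdf_le_1)
    then show ?thesis using S by auto
  next
    case False
    define X where "X = sqrt (sq_dist f g) / \<epsilon>"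
    have pos: "0 \<le> sq_dist f g" using False by (smt (verit) zero_le_power2)
    have X: "1 < X" "sq_dist f g = (X * \<epsilon>)\<^sup>2"
      using False eps pos by (auto simp: X_def real_less_rsqrt)
    \<comment> \<open>Any factor from 4/5 up to but excluding 1 works here: below 1 for the strict
      inequality in \<open>separates_far\<close>, and at least 4/5 so that the constant 0.4 of
      \<open>std_normal_cdf_tail\<close> leaves a product of at most 1.\<close>
    have far: "(9 / 10 * X * \<epsilon>)\<^sup>2 < sq_dist f g"
    proof -
      have "9 / 10 * (X * \<epsilon>) < X * \<epsilon>" "0 \<le> 9 / 10 * (X * \<epsilon>)" using X eps by auto
      then show ?thesis unfolding X(2) by (intro power_strict_mono) (auto simp: mult.assoc)
    qed
    have "0 \<le> 9 / 10 * X" using X by simp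
    from separates_far[OF tf tg this far] obtain x S where S: "9 / 10 * X \<le> x" "separates f g x S" .
    have x: "0 < x" using S(1) X(1) by linarith
    have "x / 2 * std_normal_cdf (- x / 2) \<le> 0.4" using std_normal_cdf_tail[of "x / 2"] x by simp
    moreover have "9 / 10 * X / 2 * std_normal_cdf (- x / 2) \<le> x / 2 * std_normal_cdf (- x / 2)"
      using S(1) by (intro mult_right_mono) (auto simp: std_normal_cdf_nonneg)
    ultimately have "X * std_normal_cdf (- x / 2) \<le> 1" by simp
    then have "C * (X * std_normal_cdf (- x / 2)) \<le> C * 1" using C by (rule mult_left_mono)
    moreover have "\<bar>\<theta> g - \<theta> f\<bar> * std_normal_cdf (- x / 2) \<le> X * C * std_normal_cdf (- x / 2)"
      using modulus[OF g, of X] X by (intro mult_right_mono) (auto simp: std_normal_cdf_nonneg)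
    ultimately have "\<bar>\<theta> g - \<theta> f\<bar> * std_normal_cdf (- x / 2) \<le> C" by (simp add: ac_simps)
    then show ?thesis using S by blast
  qed
  then obtain x S where S: "separates f g x S" and le: "\<bar>\<theta> g - \<theta> f\<bar> * std_normal_cdf (- x / 2) \<le> C"
    by blast
  show "(INF T\<in>borel_measurable path_space. MAX h\<in>{f, g}. \<integral>\<^sup>+ y. ennreal \<bar>T y - \<theta> h\<bar> \<partial>law h) \<le> ennreal C"
    using estimation_pair_upper[OF S, of \<theta>] ennreal_leI[OF le] by (rule order_trans)
qed

text \<open>The thresholds \<open>w\<close> and \<open>z\<close> in the proof are chosen so that the one-point intervals miss the target
  with probability at most \<open>\<alpha>\<close>, under \<open>g\<close> and under \<open>f\<close> respectively.\<close>

lemma inference_pair_upper: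
  assumes S: "separates f g x S" and x: "0 \<le> x"
    and z: "std_normal_cdf z = 1 - \<alpha>" "std_normal_cdf (- z) = \<alpha>"
  shows "(INF (l, u)\<in>confidence_intervals law \<theta> \<alpha> {f, g}. \<integral>\<^sup>+ y. ennreal (u y - l y) \<partial>law f)
    \<le> ennreal (\<bar>\<theta> g - \<theta> f\<bar> * (if 2 * z \<le> x then 0 else 1 - 2 * \<alpha>))"
proof -
  note S' = separates_measure[OF S]
  have Sm[measurable]: "S \<in> borel_measurable path_space" by (rule S'(1))
  interpret P: prob_space "law f" by (rule prob_space_law)
  interpret Q: prob_space "law g" by (rule prob_space_law)
  define w where "w = min (x - z) z"
  \<comment> \<open>Between the thresholds neither target can be discarded, so the interval spans
    both; outside it is a single point.\<close>
  define l where "l = (\<lambda>y. if S y \<le> w then \<theta> f else if z < S y then \<theta> g else min (\<theta> f) (\<theta> g))"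
  define u where "u = (\<lambda>y. if S y \<le> w then \<theta> f else if z < S y then \<theta> g else max (\<theta> f) (\<theta> g))"
  have wz: "w \<le> z" by (simp add: w_def)
  have lm: "l \<in> borel_measurable path_space" and um: "u \<in> borel_measurable path_space"
    unfolding l_def u_def by measurable
  have cov_sets: "{y\<in>space path_space. \<theta> h \<in> {l y..u y}} \<in> sets path_space" for h
    unfolding atLeastAtMost_iff using lm um by measurable
  have "1 - \<alpha> \<le> measure (law f) {y\<in>space path_space. S y \<le> z}"
    using z by (simp add: S'(2))
  also have "\<dots> \<le> measure (law f) {y\<in>space path_space. \<theta> f \<in> {l y..u y}}"
    by (rule P.finite_measure_mono) (use cov_sets[of f] in \<open>auto simp: l_def u_def\<close>)
  finally have cf: "1 - \<alpha> \<le> measure (law f) {y\<in>space path_space. \<theta> f \<in> {l y..u y}}" .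
  have "1 - \<alpha> \<le> measure (law g) {y\<in>space path_space. w < S y}"
    using std_normal_cdf_mono[of z "x - w"] z by (simp add: S'(5) w_def)
  also have "\<dots> \<le> measure (law g) {y\<in>space path_space. \<theta> g \<in> {l y..u y}}"
    by (rule Q.finite_measure_mono) (use cov_sets[of g] in \<open>auto simp: l_def u_def\<close>)
  finally have cg: "1 - \<alpha> \<le> measure (law g) {y\<in>space path_space. \<theta> g \<in> {l y..u y}}" .
  have CI: "(l, u) \<in> confidence_intervals law \<theta> \<alpha> {f, g}"
    unfolding confidence_intervals_def
  proof (intro CollectI case_prodI conjI ballI lm um)
    show "l y \<le> u y" for y by (auto simp: l_def u_def)
    show "1 - \<alpha> \<le> measure (law h) {y\<in>space path_space. \<theta> h \<in> {l y..u y}}" if "h \<in> {f, g}" for h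
      using that cf cg by blast
  qed
  \<comment> \<open>This is the only region of positive length. It is empty once
    \<open>w = z\<close>; otherwise \<open>w \<ge> - z\<close> because \<open>x \<ge> 0\<close>, and
    its probability under \<open>f\<close> is at most \<Phi>(z) - \<Phi>(-z).\<close>
  have m: "measure (law f) {y\<in>space path_space. w < S y \<and> S y \<le> z} \<le> (if 2 * z \<le> x then 0 else 1 - 2 * \<alpha>)"
  proof -
    have "{y\<in>space path_space. w < S y \<and> S y \<le> z}
        = {y\<in>space path_space. S y \<le> z} - {y\<in>space path_space. S y \<le> w}" by auto
    then have "measure (law f) {y\<in>space path_space. w < S y \<and> S y \<le> z} = std_normal_cdf z - std_normal_cdf w"
      using wz by (simp add: P.finite_measure_Diff S'(2) Collect_mono_iff)
    moreover have "w = z" if "2 * z \<le> x" using that by (simp add: w_def)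
    moreover have "std_normal_cdf (- z) \<le> std_normal_cdf w" if "\<not> 2 * z \<le> x"
      using that x by (intro std_normal_cdf_mono) (auto simp: w_def)
    ultimately show ?thesis using z by auto
  qed
  have "(\<integral>\<^sup>+ y. ennreal (u y - l y) \<partial>law f)
      = (\<integral>\<^sup>+ y. ennreal \<bar>\<theta> g - \<theta> f\<bar> * indicator {y\<in>space path_space. w < S y \<and> S y \<le> z} y \<partial>law f)"
    by (rule nn_integral_cong) (auto simp: l_def u_def indicator_def intro!: arg_cong[where f = ennreal])
  also have "\<dots> = ennreal (\<bar>\<theta> g - \<theta> f\<bar> * measure (law f) {y\<in>space path_space. w < S y \<and> S y \<le> z})"
    by (subst nn_integral_cmult_indicator) (auto simp: P.emeasure_eq_measure ennreal_mult)
  also have "\<dots> \<le> ennreal (\<bar>\<theta> g - \<theta> f\<bar> * (if 2 * z \<le> x then 0 else 1 - 2 * \<alpha>))"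
    by (intro ennreal_leI mult_left_mono m) simp
  finally show ?thesis by (intro INF_lower2[OF CI]) simp
qed

text \<open>Beyond distance 2 z \<epsilon> some statistic has shift at least 2 z and the intervals
  collapse to points, so the modulus is needed at this one distance only.\<close>

lemma inference_benchmark_upper:
  assumes f: "f \<in> convex_class" and C: "0 \<le> C"
    and z: "std_normal_cdf z = 1 - \<alpha>" "std_normal_cdf (- z) = \<alpha>" "0 < z" and \<alpha>: "2 * \<alpha> \<le> 1"
    and modulus: "\<And>g. g \<in> convex_class \<Longrightarrow> sq_dist f g \<le> (2 * z * \<epsilon>)\<^sup>2 \<Longrightarrow> \<bar>\<theta> g - \<theta> f\<bar> \<le> C"
  shows "inference_benchmark law \<theta> \<alpha> f \<le> ennreal ((1 - 2 * \<alpha>) * C)"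
  unfolding inference_benchmark_def
proof (rule SUP_least)
  fix g assume g: "g \<in> convex_class"
  have tf: "tame f" and tg: "tame g" using f g by (auto intro: convex_class_tame)
  have "\<exists>x S. separates f g x S \<and> 0 \<le> x \<and> \<bar>\<theta> g - \<theta> f\<bar> * (if 2 * z \<le> x then 0 else 1 - 2 * \<alpha>) \<le> (1 - 2 * \<alpha>) * C"
  proof (cases "sq_dist f g \<le> (2 * z * \<epsilon>)\<^sup>2")
    case True
    from separates_trivial[OF tf tg] obtain x S where S: "0 \<le> x" "separates f g x S" .
    have "\<bar>\<theta> g - \<theta> f\<bar> * (if 2 * z \<le> x then 0 else 1 - 2 * \<alpha>) \<le> C * (1 - 2 * \<alpha>)"
      using modulus[OF g True] C \<alpha> by (intro mult_mono) auto
    then show ?thesis using S by (auto simp: mult.commute)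
  next
    case False
    then have far: "(2 * z * \<epsilon>)\<^sup>2 < sq_dist f g" by simp
    have "0 \<le> 2 * z" using z(3) by simp
    from separates_far[OF tf tg this far] obtain x S where "2 * z \<le> x" "separates f g x S" .
    then show ?thesis using z(3) C \<alpha> by (intro exI[of _ x] exI[of _ S]) auto
  qed
  then obtain x S where S: "separates f g x S" "0 \<le> x"
      and le: "\<bar>\<theta> g - \<theta> f\<bar> * (if 2 * z \<le> x then 0 else 1 - 2 * \<alpha>) \<le> (1 - 2 * \<alpha>) * C"
    by blast
  show "(INF (l, u)\<in>confidence_intervals law \<theta> \<alpha> {f, g}. \<integral>\<^sup>+ y. ennreal (u y - l y) \<partial>law f)
      \<le> ennreal ((1 - 2 * \<alpha>) * C)"
    using inference_pair_upper[OF S z(1,2), of \<theta>] ennreal_leI[OF le] by (rule order_trans)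
qed

end

text \<open>Common to estimation and inference, which differ only in the factor \<open>k\<close>
  attached to a pair at distance \<open>D\<close>. For \<delta> < D there is room for the tilted
  competitors: one of them bounds \<open>Bm\<close> by way of \<open>m\<close>, all of them together
  bound \<open>Bz\<close> by way of \<open>r\<close>.\<close>

lemma uncertainty_lower:
  fixes Bz Bm :: ennreal
  assumes f: "f \<in> convex_class" and D: "0 < D" and k: "0 \<le> k"
    and Bz: "\<And>g. g \<in> convex_class \<Longrightarrow> sq_dist f g \<le> D\<^sup>2 \<Longrightarrow> ennreal (\<bar>minimizer g - minimizer f\<bar> * k) \<le> Bz"
    and Bm: "\<And>g. g \<in> convex_class \<Longrightarrow> sq_dist f g \<le> D\<^sup>2 \<Longrightarrow> ennreal (\<bar>minimum g - minimum f\<bar> * k) \<le> Bm"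
  shows "ennreal (k ^ 3 / 2 * D\<^sup>2) \<le> Bz * Bm\<^sup>2"
proof (cases "k = 0")
  case False
  then have k: "0 < k" using k by simp
  have main: "ennreal (k ^ 3 / 2 * \<delta>\<^sup>2) \<le> Bz * Bm\<^sup>2" if \<delta>: "0 < \<delta>" "\<delta> < D" for \<delta>
  proof -
    from water_level_geometry[OF f \<delta>(1)] obtain m r where m: "0 < m" "0 < r"
        "water_level f (minimum f + m) = \<delta>\<^sup>2" "\<delta>\<^sup>2 \<le> 2 * m\<^sup>2 * r" "m\<^sup>2 * r \<le> 3 * \<delta>\<^sup>2"
        "\<forall>t\<in>{0..1}. f t \<le> minimum f + m \<longrightarrow> \<bar>t - minimizer f\<bar> \<le> r"
      and least: "\<forall>B. (\<forall>t\<in>{0..1}. f t \<le> minimum f + m \<longrightarrow> \<bar>t - minimizer f\<bar> \<le> B) \<longrightarrow> r \<le> B" .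
    have gap: "0 < D\<^sup>2 - \<delta>\<^sup>2" using \<delta> by (simp add: power_strict_mono)
    \<comment> \<open>Since \<open>\<eta> \<le> 1\<close> gives \<eta>^2 \<le> \<eta>, the extra
      cost 2 \<eta> m + \<eta>^2 is at most \<eta> (2 m + 1), which has to fit into the gap.\<close>
    define \<eta> where "\<eta> = min 1 ((D\<^sup>2 - \<delta>\<^sup>2) / (2 * m + 1))"
    have \<eta>: "0 < \<eta>" "\<eta> \<le> 1" "\<eta> * (2 * m + 1) \<le> D\<^sup>2 - \<delta>\<^sup>2"
    proof -
      show "0 < \<eta>" "\<eta> \<le> 1" using gap m by (auto simp: \<eta>_def)
      have "\<eta> * (2 * m + 1) \<le> (D\<^sup>2 - \<delta>\<^sup>2) / (2 * m + 1) * (2 * m + 1)"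
        using m by (intro mult_right_mono) (auto simp: \<eta>_def)
      then show "\<eta> * (2 * m + 1) \<le> D\<^sup>2 - \<delta>\<^sup>2" using m by simp
    qed
    have "\<eta>\<^sup>2 \<le> \<eta> * 1" unfolding power2_eq_square using \<eta> by (intro mult_left_mono) auto
    then have \<eta>2: "\<delta>\<^sup>2 + 2 * \<eta> * m + \<eta>\<^sup>2 \<le> D\<^sup>2" using \<eta>(3) by (simp add: algebra_simps)
    have near: "\<exists>g\<in>convex_class. minimizer g = b \<and> minimum g = minimum f + m \<and> sq_dist f g \<le> D\<^sup>2"
      if b: "b \<in> {0..1}" "f b \<le> minimum f + m" for b
    proof -
      from perturbation[OF f b m(1) \<eta>(1)] obtain g where "g \<in> convex_class" "minimizer g = b"
          "minimum g = minimum f + m" "sq_dist f g \<le> water_level f (minimum f + m) + 2 * \<eta> * m + \<eta>\<^sup>2" .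
      then show ?thesis using m(3) \<eta>2 by (intro bexI[of _ g]) auto
    qed
    have "f (minimizer f) \<le> minimum f + m" using m by (simp add: minimum_def)
    then obtain g where "g \<in> convex_class" "minimum g = minimum f + m" "sq_dist f g \<le> D\<^sup>2"
      using near[of "minimizer f"] convex_classD(2)[OF f] by blast
    then have bm: "ennreal (m * k) \<le> Bm" using Bm[of g] m by simp
    \<comment> \<open>If \<open>Bz\<close> is a finite \<open>B\<close>, then \<open>B / k\<close>
      bounds the distance of every reachable minimizer, hence \<open>r\<close>, although no
      competitor need have its minimizer at distance \<open>r\<close> itself.\<close>
    have bz: "ennreal (r * k) \<le> Bz"
    proof (cases Bz)
      case (real B)
      have "r \<le> B / k"
      proof (rule least[rule_format])
        fix b assume "b \<in> {0..1}" "f b \<le> minimum f + m"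
        from near[OF this] obtain g where "g \<in> convex_class" "minimizer g = b" "sq_dist f g \<le> D\<^sup>2" by blast
        then have "ennreal (\<bar>b - minimizer f\<bar> * k) \<le> ennreal B" using Bz[of g] real by simp
        then have "\<bar>b - minimizer f\<bar> * k \<le> B" using real by (simp add: ennreal_le_iff)
        then show "\<bar>b - minimizer f\<bar> \<le> B / k" using k by (simp add: field_simps)
      qed
      then have "r * k \<le> B" using k by (simp add: field_simps)
      then show ?thesis using real by (simp add: ennreal_leI)
    qed simp
    have "k ^ 3 / 2 * \<delta>\<^sup>2 \<le> k ^ 3 / 2 * (2 * m\<^sup>2 * r)" using m(4) k by (intro mult_left_mono) auto
    also have "\<dots> = (r * k) * (m * k)\<^sup>2" by (simp add: power2_eq_square power3_eq_cube)
    finally have "ennreal (k ^ 3 / 2 * \<delta>\<^sup>2) \<le> ennreal ((r * k) * (m * k)\<^sup>2)" by (rule ennreal_leI)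
    also have "\<dots> = ennreal (r * k) * (ennreal (m * k))\<^sup>2"
      using m k by (subst ennreal_mult) (auto simp: ennreal_power)
    also have "\<dots> \<le> Bz * Bm\<^sup>2" using bz bm by (intro mult_mono power_mono) auto
    finally show ?thesis .
  qed
  show ?thesis
  proof (cases "Bz * Bm\<^sup>2")
    case (real q)
    \<comment> \<open>The limit \<delta> to D: taking \<open>\<delta> = sqrt s * D\<close>
      multiplies the bound by exactly \<open>s < 1\<close>.\<close>
    have "k ^ 3 / 2 * D\<^sup>2 \<le> q"
    proof (rule field_le_mult_one_interval)
      fix s :: real assume s: "0 < s" "s < 1"
      have "sqrt s * D < 1 * D" using s D by (intro mult_strict_right_mono) auto
      then have "ennreal (k ^ 3 / 2 * (sqrt s * D)\<^sup>2) \<le> ennreal q" using main[of "sqrt s * D"] s D real by simp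
      then have "k ^ 3 / 2 * (sqrt s * D)\<^sup>2 \<le> q" using real by (simp add: ennreal_le_iff)
      then show "s * (k ^ 3 / 2 * D\<^sup>2) \<le> q" using s by (simp add: power_mult_distrib ac_simps)
    qed
    then show ?thesis using real by (simp add: ennreal_leI)
  qed simp
qed simp

theorem theorem2p2:
  fixes M :: "'a measure" and W :: "real \<Rightarrow> 'a \<Rightarrow> real"
    and \<alpha> \<epsilon> :: real and f :: "real \<Rightarrow> real"
  assumes "standard_brownian_motion M W"
    and "0 < \<alpha>" and "\<alpha> < 0.3" and "\<epsilon> > 0"
    and "f \<in> convex_class"
  shows "ennreal (274 * \<epsilon>\<^sup>2) > R_z M W \<epsilon> f * (R_m M W \<epsilon> f)\<^sup>2
       \<and> R_z M W \<epsilon> f * (R_m M W \<epsilon> f)\<^sup>2 \<ge> ennreal (std_normal_cdf (- 0.5) ^ 3 / 2 * \<epsilon>\<^sup>2)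
       \<and> ennreal (3 ^ 7 * (1 - 2 * \<alpha>) ^ 3 * z_quantile \<alpha> ^ 3 * \<epsilon>\<^sup>2)
           > L_z M W \<alpha> \<epsilon> f * (L_m M W \<alpha> \<epsilon> f)\<^sup>2
       \<and> L_z M W \<alpha> \<epsilon> f * (L_m M W \<alpha> \<epsilon> f)\<^sup>2 \<ge> ennreal ((0.6 - 2 * \<alpha>) ^ 3 / 18 * \<epsilon>\<^sup>2)"
proof -
  interpret white_noise_model M W \<epsilon> using assms by unfold_locales
  note f = \<open>f \<in> convex_class\<close>
  have prod_le: "Bz * Bm\<^sup>2 \<le> ennreal (p * (q\<^sup>2))" if "Bz \<le> ennreal p" "Bm \<le> ennreal q" "0 \<le> p" "0 \<le> q"
    for Bz Bm :: ennreal and p q :: real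
  proof -
    have "Bz * Bm\<^sup>2 \<le> ennreal p * (ennreal q)\<^sup>2" using that by (intro mult_mono power_mono) auto
    then show ?thesis using that by (simp add: ennreal_mult ennreal_power)
  qed
  \<comment> \<open>Both lower bounds use competitors at distance \<epsilon>, which is the origin of
    the argument -0.5.\<close>
  have e: "- \<epsilon> / (2 * \<epsilon>) = - 0.5" using eps by simp
  have "R_z M W \<epsilon> f * (R_m M W \<epsilon> f)\<^sup>2 < ennreal (274 * \<epsilon>\<^sup>2)"
  proof -
    from water_level_geometry[OF f eps] obtain m r where m: "0 < m" "0 < r" "water_level f (minimum f + m) = \<epsilon>\<^sup>2" "\<epsilon>\<^sup>2 \<le> 2 * m\<^sup>2 * r"
        "m\<^sup>2 * r \<le> 3 * \<epsilon>\<^sup>2"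
      and sub: "\<forall>t\<in>{0..1}. f t \<le> minimum f + m \<longrightarrow> \<bar>t - minimizer f\<bar> \<le> r"
        "\<forall>B. (\<forall>t\<in>{0..1}. f t \<le> minimum f + m \<longrightarrow> \<bar>t - minimizer f\<bar> \<le> B) \<longrightarrow> r \<le> B" .
    have "R_z M W \<epsilon> f \<le> ennreal (5 * r)" unfolding R_z_def
    proof (rule estimation_benchmark_upper[OF f])
      show "\<bar>minimizer g - minimizer f\<bar> \<le> X * (5 * r)"
        if "g \<in> convex_class" "1 \<le> X" "sq_dist f g \<le> (X * \<epsilon>)\<^sup>2" for g X
        using minimizer_modulus[OF f that(1) m(1,2) that(2) m(4) that(3) sub(1)[rule_format]] by (simp add: ac_simps)
    qed (use m in simp)
    moreover have "R_m M W \<epsilon> f \<le> ennreal (4 * m)" unfolding R_m_def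
    proof (rule estimation_benchmark_upper[OF f])
      show "\<bar>minimum g - minimum f\<bar> \<le> X * (4 * m)"
        if "g \<in> convex_class" "1 \<le> X" "sq_dist f g \<le> (X * \<epsilon>)\<^sup>2" for g X
        using minimum_modulus[OF f that(1) m(1) that(2) eps m(3) that(3)] by (simp add: ac_simps)
    qed (use m in simp)
    ultimately have "R_z M W \<epsilon> f * (R_m M W \<epsilon> f)\<^sup>2 \<le> ennreal (5 * r * (4 * m)\<^sup>2)"
      by (rule prod_le) (use m in auto)
    also have "\<dots> < ennreal (274 * \<epsilon>\<^sup>2)"
    proof (rule ennreal_lessI)
      \<comment> \<open>The moduli give 5 * 4^2 = 80 and the geometry a factor 3, so the estimate is
        240, inside the claimed 274.\<close>
      have "5 * r * (4 * m)\<^sup>2 = 80 * (m\<^sup>2 * r)" by (simp add: power_mult_distrib)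
      also have "\<dots> \<le> 240 * \<epsilon>\<^sup>2" using m(5) by linarith
      also have "\<dots> < 274 * \<epsilon>\<^sup>2" using eps by simp
      finally show "5 * r * (4 * m)\<^sup>2 < 274 * \<epsilon>\<^sup>2" .
    qed (use eps in simp)
    finally show ?thesis .
  qed
  moreover have "ennreal (std_normal_cdf (- 0.5) ^ 3 / 2 * \<epsilon>\<^sup>2) \<le> R_z M W \<epsilon> f * (R_m M W \<epsilon> f)\<^sup>2"
    unfolding R_z_def R_m_def
    using estimation_benchmark_lower[OF f, of _ \<epsilon>, unfolded e] eps
    by (intro uncertainty_lower[OF f eps std_normal_cdf_nonneg]) auto
  moreover have "L_z M W \<alpha> \<epsilon> f * (L_m M W \<alpha> \<epsilon> f)\<^sup>2 < ennreal (3 ^ 7 * (1 - 2 * \<alpha>) ^ 3 * z_quantile \<alpha> ^ 3 * \<epsilon>\<^sup>2)"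
  proof -
    define z where "z = z_quantile \<alpha>"
    have z: "std_normal_cdf z = 1 - \<alpha>" "std_normal_cdf (- z) = \<alpha>" "0.5 < z"
      using z_quantile[OF assms(2,3)] by (simp_all add: z_def)
    have z0: "0 < z" using z(3) by simp
    \<comment> \<open>The distance at which a test with both errors equal to \<alpha> becomes
      possible.\<close>
    define \<delta> where "\<delta> = 2 * z * \<epsilon>"
    have \<delta>: "0 < \<delta>" using z0 eps by (simp add: \<delta>_def)
    from water_level_geometry[OF f \<delta>] obtain m r where m: "0 < m" "0 < r" "water_level f (minimum f + m) = \<delta>\<^sup>2" "\<delta>\<^sup>2 \<le> 2 * m\<^sup>2 * r"
        "m\<^sup>2 * r \<le> 3 * \<delta>\<^sup>2"
      and sub: "\<forall>t\<in>{0..1}. f t \<le> minimum f + m \<longrightarrow> \<bar>t - minimizer f\<bar> \<le> r"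
        "\<forall>B. (\<forall>t\<in>{0..1}. f t \<le> minimum f + m \<longrightarrow> \<bar>t - minimizer f\<bar> \<le> B) \<longrightarrow> r \<le> B" .
    have "L_z M W \<alpha> \<epsilon> f \<le> ennreal ((1 - 2 * \<alpha>) * (5 * r))" unfolding L_z_def
    proof (rule inference_benchmark_upper[OF f _ z(1,2) z0])
      show "\<bar>minimizer g - minimizer f\<bar> \<le> 5 * r"
        if "g \<in> convex_class" "sq_dist f g \<le> (2 * z * \<epsilon>)\<^sup>2" for g
        using minimizer_modulus[OF f that(1) m(1,2) order_refl m(4) _ sub(1)[rule_format]] that(2) by (simp add: \<delta>_def)
    qed (use m assms in auto)
    moreover have "L_m M W \<alpha> \<epsilon> f \<le> ennreal ((1 - 2 * \<alpha>) * (4 * m))" unfolding L_m_def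
    proof (rule inference_benchmark_upper[OF f _ z(1,2) z0])
      show "\<bar>minimum g - minimum f\<bar> \<le> 4 * m"
        if "g \<in> convex_class" "sq_dist f g \<le> (2 * z * \<epsilon>)\<^sup>2" for g
        using minimum_modulus[OF f that(1) m(1) order_refl \<delta> m(3)] that(2) by (simp add: \<delta>_def)
    qed (use m assms in auto)
    ultimately have "L_z M W \<alpha> \<epsilon> f * (L_m M W \<alpha> \<epsilon> f)\<^sup>2
        \<le> ennreal ((1 - 2 * \<alpha>) * (5 * r) * ((1 - 2 * \<alpha>) * (4 * m))\<^sup>2)"
      by (rule prod_le) (use m assms in auto)
    also have "\<dots> < ennreal (3 ^ 7 * (1 - 2 * \<alpha>) ^ 3 * z ^ 3 * \<epsilon>\<^sup>2)"
    proof (rule ennreal_lessI)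
      define c where "c = (1 - 2 * \<alpha>) ^ 3 * z\<^sup>2 * \<epsilon>\<^sup>2"
      have c: "0 < c" using assms z0 by (simp add: c_def)
      have "(1 - 2 * \<alpha>) * (5 * r) * ((1 - 2 * \<alpha>) * (4 * m))\<^sup>2 = 80 * (1 - 2 * \<alpha>) ^ 3 * (m\<^sup>2 * r)"
        by (simp add: power_mult_distrib power2_eq_square power3_eq_cube)
      also have "\<dots> \<le> 80 * (1 - 2 * \<alpha>) ^ 3 * (3 * \<delta>\<^sup>2)" using m(5) assms by (intro mult_left_mono) auto
      also have "\<dots> = 960 * c" by (simp add: c_def \<delta>_def power_mult_distrib)
      \<comment> \<open>960 is 80 * 3 * 4, the 4 coming from the square of \<delta> = 2 z
        \<epsilon>. On the other side 3^7 = 2187 and z > 1/2, which also supplies the extra power of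
        z in the claim.\<close>
      also have "\<dots> < 3 ^ 7 * z * c" using c z(3) by simp
      also have "\<dots> = 3 ^ 7 * (1 - 2 * \<alpha>) ^ 3 * z ^ 3 * \<epsilon>\<^sup>2"
        by (simp add: c_def power2_eq_square power3_eq_cube)
      finally show "(1 - 2 * \<alpha>) * (5 * r) * ((1 - 2 * \<alpha>) * (4 * m))\<^sup>2 < 3 ^ 7 * (1 - 2 * \<alpha>) ^ 3 * z ^ 3 * \<epsilon>\<^sup>2" .
    qed (use assms z0 in simp)
    finally show ?thesis by (simp add: z_def)
  qed
  moreover have "ennreal ((0.6 - 2 * \<alpha>) ^ 3 / 18 * \<epsilon>\<^sup>2) \<le> L_z M W \<alpha> \<epsilon> f * (L_m M W \<alpha> \<epsilon> f)\<^sup>2"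
  proof -
    \<comment> \<open>1/2 - 0.4 * 0.5; this rational bound produces the 0.6 of the claim.\<close>
    have "0.3 \<le> std_normal_cdf (- 0.5)"
      using std_normal_cdf_lipschitz[of "- 0.5" 0] by (simp add: std_normal_cdf_0)
    then have le: "0.6 - 2 * \<alpha> \<le> 2 * std_normal_cdf (- 0.5) - 2 * \<alpha>" by simp
    have low: "ennreal (\<bar>\<theta> g - \<theta> f\<bar> * (0.6 - 2 * \<alpha>)) \<le> inference_benchmark law \<theta> \<alpha> f"
      if "g \<in> convex_class" "sq_dist f g \<le> \<epsilon>\<^sup>2" for g \<theta>
    proof -
      have "ennreal (\<bar>\<theta> g - \<theta> f\<bar> * (0.6 - 2 * \<alpha>))
          \<le> ennreal (\<bar>\<theta> g - \<theta> f\<bar> * (2 * std_normal_cdf (- 0.5) - 2 * \<alpha>))"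
        by (intro ennreal_leI mult_left_mono le) simp
      also have "\<dots> \<le> inference_benchmark law \<theta> \<alpha> f"
        using inference_benchmark_lower[OF f that(1) _ that(2), unfolded e] eps by simp
      finally show ?thesis .
    qed
    \<comment> \<open>The argument yields the stronger constant 1/2 in place of 1/18.\<close>
    have "ennreal ((0.6 - 2 * \<alpha>) ^ 3 / 18 * \<epsilon>\<^sup>2) \<le> ennreal ((0.6 - 2 * \<alpha>) ^ 3 / 2 * \<epsilon>\<^sup>2)"
      using assms by (intro ennreal_leI mult_right_mono divide_left_mono) auto
    also have "\<dots> \<le> L_z M W \<alpha> \<epsilon> f * (L_m M W \<alpha> \<epsilon> f)\<^sup>2"
      unfolding L_z_def L_m_def using assms low
      by (intro uncertainty_lower[OF f eps]) auto
    finally show ?thesis .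
  qed
  ultimately show ?thesis by blast
qed

end
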